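(* In $\mathrm{U}_q(\widehat{\mathfrak{gl}}_{M|N})$ the quantum Berezinian decomposes as $$B_q(L^{\pm}(z))=\bigl|L^{\pm}(z)^{(1)}\bigr|_{11}\cdots\bigl|L^{\pm}(zq^{2M-2})^{(M)}\bigr|_{MM}\times\bigl|L^{\pm}(zq^{2M-2})^{(M+1)}\bigr|^{-1}_{M+1,M+1}\cdots\bigl|L^{\pm}(zq^{2M-2N})^{(M+N)}\bigr|^{-1}_{M+N,M+N},$$ where the $j$-th factor ($1\le j\le M$) is $|L^\pm(zq^{2j-2})^{(j)}|_{jj}$ and the $(M+k)$-th factor ($1\le k\le N$) is $|L^\pm(zq^{2M-2k})^{(M+k)}|^{-1}_{M+k,M+k}$. Moreover, the factors in this decomposition are mutually commutative.
   Context: Let $M,N\ge 0$ be integers with $M\ne N$. The base field is $\mathbb{C}(q)$ ($q$ is not a root of unity). For $1\le i\le M+N$ put $\bar i=0$ if $i\le M$ and $\bar i=1$ if $i>M$, and $q_i=q^{1-2\bar i}$. $\mathbb{C}^{M|N}$ is the superspace with basis $e_i$ of parity $\bar i$, and $E_{ij}\in\mathrm{End}\,\mathbb{C}^{M|N}$ are the matrix units (of parity $\bar i+\bar j$). Tensor products of superalgebras are graded: $(a\otimes b)(a'\otimes b')=(-1)^{|b||a'|}aa'\otimes bb'$. Put $R(z,w)=\sum_i (zq_i-wq_i^{-1})E_{ii}\otimes E_{ii}+(z-w)\sum_{i\ne j}E_{ii}\otimes E_{jj}+z\sum_{i<j}(q_j-q_j^{-1})E_{ij}\otimes E_{ji}+w\sum_{i>j}(q_j-q_j^{-1})E_{ij}\otimes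 E_{ji}$, $\overline R(x)=R(x,1)/(xq-q^{-1})$ and $R(x)=f(x)\overline R(x)$, where $f(x)=1+\sum_{k\ge1}f_kx^{-k}$ is the formal series uniquely determined by $f(xq^{2N-2M})=f(x)\frac{(1-xq^{-2})(1-xq^{2N-2M+2})}{(1-x)(1-xq^{2N-2M})}$; $R(x)$ is expanded in powers of $x^{-1}$. $\mathrm{U}_q(\widehat{\mathfrak{gl}}_{M|N})$ is the superalgebra over $\mathbb{C}(q)$ generated by $l_{ij}^{\pm(r)}$ ($1\le i,j\le M+N$, $r\ge 0$, parity $\bar i+\bar j$) and an invertible central even element $q^c$. Put $l_{ij}^{\pm}(z)=\sum_{r\ge0}l_{ij}^{\pm(r)}z^{\mp r}$, $L^{\pm}(z)=\sum_{i,j}l^{\pm}_{ij}(z)\otimes E_{ij}$, and let $L_a^\pm(z)$ denote $L^\pm(z)$ acting in the $a$-th copy of $\mathrm{End}\,\mathbb{C}^{M|N}$. The defining relations are: $l_{ji}^{+(0)}=l_{ij}^{-(0)}=0$ for $i<j$; $l_{ii}^{-(0)}l_{ii}^{+(0)}=l_{ii}^{+(0)}l_{ii}^{-(0)}=1$; $R(z/w)L_1^{\pm}(z)L_2^{\pm}(w)=L_2^{\pm}(w)L_1^{\pm}(z)R(z/w)$; $R(zq^{c}/w)L_1^{+}(z)L_2^{-}(w)=L_2^{-}(w)L_1^{+}(z)R(zq^{-c}/w)$. Matrices are multiplied and inverted as elements of the graded tensor product with the matrix superalgebra, i.e. $(AB)_{ij}=\sum_k(-1)^{(\bar i+\bar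 k)(\bar k+\bar j)}A_{ik}B_{kj}$ for even elements $A=\sum A_{ij}\otimes E_{ij}$, $B$; submatrices inherit the index parities. $A^{(k)}$ denotes the principal submatrix $(A_{ij})_{1\le i,j\le k}$. The quasideterminant of an invertible matrix $A$ is $|A|_{ij}=\bigl((A^{-1})_{ji}\bigr)^{-1}$. The quantum Berezinian is $$B_q(L^{\pm}(z))=\sum_{\sigma\in S_M}(-q)^{-l(\sigma)}L^{\pm}(z)_{\sigma(1),1}\cdots L^{\pm}(zq^{2M-2})_{\sigma(M),M}\sum_{\tau\in S_N}(-q)^{-l(\tau)}\bigl(L^{\pm}(zq^{2M-2})^{-1}\bigr)_{M+1,M+\tau(1)}\cdots\bigl(L^{\pm}(zq^{2M-2N})^{-1}\bigr)_{M+N,M+\tau(N)},$$ where in the first product the $j$-th factor has argument $zq^{2j-2}$, in the second product the $k$-th factor has argument $zq^{2M-2k}$, and $l$ is the length function on permutations. *)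

theory Defs
  imports
    "HOL-Complex_Analysis.Laurent_Convergence"
    "HOL-Computational_Algebra.Fraction_Field"
    "HOL-Computational_Algebra.Polynomial"
    "HOL-Library.Poly_Mapping"
    "HOL-Library.Type_Length"
    "HOL-Combinatorics.Permutations"
begin

section \<open>The base field\<close>

type_synonym cq = "complex poly fract"

definition qq :: cq where
  "qq = Fract [:0, 1:] 1"


section \<open>Index parities and the R-matrix\<close>

text \<open>
  Indices run over \<open>{1..M+N}\<close>; the first \<open>M\<close> are even and the last \<open>N\<close> are odd.
\<close>

definition par :: "nat \<Rightarrow> nat \<Rightarrow> nat" where
  "par M i = (if i \<le> M then 0 else 1)"

definition q_at :: "nat \<Rightarrow> nat \<Rightarrow> cq" where
  "q_at M i = qq powi (1 - 2 * int (par M i))"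

text \<open>
  An element \<open>\<Sum> X i j k l \<otimes> E\<^sub>i\<^sub>j \<otimes> E\<^sub>k\<^sub>l\<close> of (algebra) \<open>\<otimes> End \<otimes> End\<close> is represented by its
  family of coefficients \<open>X i j k l\<close>.
\<close>

type_synonym 'a tens2 = "nat \<Rightarrow> nat \<Rightarrow> nat \<Rightarrow> nat \<Rightarrow> 'a"

text \<open>
  Formal Laurent series over \<open>cq\<close> are taken in the variable \<open>x\<^sup>-\<^sup>1\<close>, that is, \<open>fls_X\<close> stands for
  \<open>x\<^sup>-\<^sup>1\<close> and \<open>fls_X_inv\<close> for \<open>x\<close>.  Division in this field is thus expansion in powers of \<open>x\<^sup>-\<^sup>1\<close>.
\<close>

definition R_zw :: "nat \<Rightarrow> cq fls \<Rightarrow> cq fls \<Rightarrow> cq fls tens2" where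
  "R_zw M z w i j k l =
     (if i = j \<and> k = l then
        (if i = k then z * fls_const (q_at M i) - w * fls_const (inverse (q_at M i)) else z - w)
      else if k = j \<and> l = i then
        (if i < j then z else w) * fls_const (q_at M j - inverse (q_at M j))
      else 0)"

definition R_bar :: "nat \<Rightarrow> cq fls tens2" where
  "R_bar M i j k l =
     R_zw M fls_X_inv 1 i j k l / (fls_X_inv * fls_const qq - fls_const (inverse qq))"

text \<open>\<open>fps_nth (f_series M N) k\<close> is the coefficient of \<open>x\<^sup>-\<^sup>k\<close> in \<open>f(x)\<close>.\<close>

definition f_series :: "nat \<Rightarrow> nat \<Rightarrow> cq fps" where
  "f_series M N = (THE f.
     fps_nth f 0 = 1 \<and>
     (let a = 2 * int N - 2 * int M; x = fls_X_inv in
        fps_to_fls (Abs_fps (\<lambda>k. qq powi (- (a * int k)) * fps_nth f k)) =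
        fps_to_fls f *
          (((1 - x * fls_const (qq powi (- 2))) * (1 - x * fls_const (qq powi (a + 2)))) /
           ((1 - x) * (1 - x * fls_const (qq powi a))))))"

definition R_x :: "nat \<Rightarrow> nat \<Rightarrow> cq fls tens2" where
  "R_x M N i j k l = fps_to_fls (f_series M N) * R_bar M i j k l"

definition R_coeff :: "nat \<Rightarrow> nat \<Rightarrow> nat \<Rightarrow> cq tens2" where
  "R_coeff M N m i j k l = fls_nth (R_x M N i j k l) (int m)"

text \<open>
  Product of \<^emph>\<open>even\<close> elements in the graded tensor product (algebra) \<open>\<otimes> End \<otimes> End\<close>: the coefficient
  \<open>Y a j b l\<close> then has the parity of \<open>E\<^sub>a\<^sub>j \<otimes> E\<^sub>b\<^sub>l\<close>.  In
  \<open>(X \<otimes> E\<^sub>i\<^sub>a \<otimes> E\<^sub>k\<^sub>b) (Y \<otimes> E\<^sub>a\<^sub>j \<otimes> E\<^sub>b\<^sub>l)\<close> the first summand of the exponent comes from moving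
  \<open>E\<^sub>i\<^sub>a \<otimes> E\<^sub>k\<^sub>b\<close> past \<open>Y\<close>, the second one from moving \<open>E\<^sub>k\<^sub>b\<close> past \<open>E\<^sub>a\<^sub>j\<close>.
\<close>

definition tmul :: "nat \<Rightarrow> nat \<Rightarrow> 'a::ring_1 tens2 \<Rightarrow> 'a tens2 \<Rightarrow> 'a tens2" where
  "tmul M N X Y i j k l =
     (let p = par M in
      \<Sum>a\<in>{1..M+N}. \<Sum>b\<in>{1..M+N}.
        (- 1) ^ ((p i + p a + p k + p b) * (p a + p j + p b + p l) + (p k + p b) * (p a + p j))
        * X i a k b * Y a j b l)"


section \<open>The free algebra\<close>

datatype 'a free_monoid = Word (letters: "'a list")

instantiation free_monoid :: (type) monoid_add
begin
definition zero_free_monoid :: "'a free_monoid" where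
  "0 = Word []"
definition plus_free_monoid :: "'a free_monoid \<Rightarrow> 'a free_monoid \<Rightarrow> 'a free_monoid" where
  "u + v = Word (letters u @ letters v)"
instance
  by standard (simp_all add: zero_free_monoid_def plus_free_monoid_def)
end

datatype pm = Plus | Minus

text \<open>\<open>Lgen s i j r\<close> is \<open>l\<^sub>i\<^sub>j\<^sup>\<plusminus>\<^sup>(\<^sup>r\<^sup>)\<close>; \<open>QC\<close> and \<open>QCinv\<close> are \<open>q\<^sup>c\<close> and its inverse.\<close>

datatype uq_gen = Lgen pm nat nat nat | QC | QCinv

type_synonym free_alg = "uq_gen free_monoid \<Rightarrow>\<^sub>0 cq"

definition gen :: "uq_gen \<Rightarrow> free_alg" where
  "gen g = Poly_Mapping.single (Word [g]) 1"

definition fscal :: "cq \<Rightarrow> free_alg" where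
  "fscal c = Poly_Mapping.single 0 c"

inductive_set ideal_gen :: "'a::ring_1 set \<Rightarrow> 'a set" for S where
  base: "x \<in> S \<Longrightarrow> x \<in> ideal_gen S"
| zero: "0 \<in> ideal_gen S"
| add: "x \<in> ideal_gen S \<Longrightarrow> y \<in> ideal_gen S \<Longrightarrow> x + y \<in> ideal_gen S"
| lmult: "x \<in> ideal_gen S \<Longrightarrow> a * x \<in> ideal_gen S"
| rmult: "x \<in> ideal_gen S \<Longrightarrow> x * a \<in> ideal_gen S"


section \<open>The defining relations\<close>

text \<open>\<open>L\<^sup>\<plusminus>(z)\<close> is a series in \<open>z\<close> raised to \<open>zexp s\<close>.\<close>

definition zexp :: "pm \<Rightarrow> int" where
  "zexp s = (case s of Plus \<Rightarrow> - 1 | Minus \<Rightarrow> 1)"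

definition L1 :: "pm \<Rightarrow> nat \<Rightarrow> free_alg tens2" where
  "L1 s r i j k l = (if k = l then gen (Lgen s i j r) else 0)"

definition L2 :: "pm \<Rightarrow> nat \<Rightarrow> free_alg tens2" where
  "L2 s r i j k l = (if i = j then gen (Lgen s k l r) else 0)"

text \<open>The coefficient of \<open>(w/z)\<^sup>m\<close> in \<open>R(zv/w)\<close>, where \<open>u\<close> is the inverse of the central \<open>v\<close>.\<close>

definition R_tw :: "nat \<Rightarrow> nat \<Rightarrow> free_alg \<Rightarrow> nat \<Rightarrow> free_alg tens2" where
  "R_tw M N u m i j k l = fscal (R_coeff M N m i j k l) * u ^ m"

text \<open>
  The monomial \<open>(w/z)\<^sup>m z\<^bsup>\<plusminus>r\<^esup> w\<^bsup>\<plusminus>r'\<^esup>\<close> equals \<open>z\<^sup>a w\<^sup>b\<close>.  For the three pairs of signs occurring in the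
  relations, this set is finite.
\<close>

definition zw_idx :: "pm \<Rightarrow> pm \<Rightarrow> int \<Rightarrow> int \<Rightarrow> (nat \<times> nat \<times> nat) set" where
  "zw_idx s s' a b =
     {(m, r, r'). zexp s * int r - int m = a \<and> zexp s' * int r' + int m = b}"

text \<open>The coefficients of \<open>z\<^sup>a w\<^sup>b\<close> in \<open>R L\<^sub>1(z) L\<^sub>2(w)\<close> and in \<open>L\<^sub>2(w) L\<^sub>1(z) R\<close>.\<close>

definition RLL :: "nat \<Rightarrow> nat \<Rightarrow> pm \<Rightarrow> pm \<Rightarrow> free_alg \<Rightarrow> int \<Rightarrow> int \<Rightarrow> free_alg tens2" where
  "RLL M N s s' u a b i j k l =
     (\<Sum>(m, r, r')\<in>zw_idx s s' a b.
        tmul M N (tmul M N (R_tw M N u m) (L1 s r)) (L2 s' r') i j k l)"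

definition LLR :: "nat \<Rightarrow> nat \<Rightarrow> pm \<Rightarrow> pm \<Rightarrow> free_alg \<Rightarrow> int \<Rightarrow> int \<Rightarrow> free_alg tens2" where
  "LLR M N s s' u a b i j k l =
     (\<Sum>(m, r, r')\<in>zw_idx s s' a b.
        tmul M N (tmul M N (L2 s' r') (L1 s r)) (R_tw M N u m) i j k l)"

text \<open>
  \<open>(x, y) \<in> uq_rels M N\<close> stands for the relation \<open>x = y\<close>.  The first rule discards the letters
  \<open>Lgen s i j r\<close> with an index outside \<open>{1..M+N}\<close>, which are not among the generators.
\<close>

inductive_set uq_rels :: "nat \<Rightarrow> nat \<Rightarrow> (free_alg \<times> free_alg) set" for M N where
  outside: "i \<notin> {1..M+N} \<or> j \<notin> {1..M+N} \<Longrightarrow> (gen (Lgen s i j r), 0) \<in> uq_rels M N"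
| plus0: "1 \<le> i \<Longrightarrow> i < j \<Longrightarrow> j \<le> M+N \<Longrightarrow> (gen (Lgen Plus j i 0), 0) \<in> uq_rels M N"
| minus0: "1 \<le> i \<Longrightarrow> i < j \<Longrightarrow> j \<le> M+N \<Longrightarrow> (gen (Lgen Minus i j 0), 0) \<in> uq_rels M N"
| minus_plus: "i \<in> {1..M+N} \<Longrightarrow>
    (gen (Lgen Minus i i 0) * gen (Lgen Plus i i 0), 1) \<in> uq_rels M N"
| plus_minus: "i \<in> {1..M+N} \<Longrightarrow>
    (gen (Lgen Plus i i 0) * gen (Lgen Minus i i 0), 1) \<in> uq_rels M N"
| qc_right: "(gen QC * gen QCinv, 1) \<in> uq_rels M N"
| qc_left: "(gen QCinv * gen QC, 1) \<in> uq_rels M N"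
| qc_central: "(gen QC * gen g, gen g * gen QC) \<in> uq_rels M N"
| RLL_same: "i \<in> {1..M+N} \<Longrightarrow> j \<in> {1..M+N} \<Longrightarrow> k \<in> {1..M+N} \<Longrightarrow> l \<in> {1..M+N} \<Longrightarrow>
    (RLL M N s s 1 a b i j k l, LLR M N s s 1 a b i j k l) \<in> uq_rels M N"
| RLL_mixed: "i \<in> {1..M+N} \<Longrightarrow> j \<in> {1..M+N} \<Longrightarrow> k \<in> {1..M+N} \<Longrightarrow> l \<in> {1..M+N} \<Longrightarrow>
    (RLL M N Plus Minus (gen QCinv) a b i j k l,
     LLR M N Plus Minus (gen QC) a b i j k l) \<in> uq_rels M N"

definition uq_ideal :: "nat \<Rightarrow> nat \<Rightarrow> free_alg set" where
  "uq_ideal M N = ideal_gen {x - y | x y. (x, y) \<in> uq_rels M N}"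

lemma ideal_gen_uminus: "x \<in> ideal_gen S \<Longrightarrow> - x \<in> ideal_gen S"
  using ideal_gen.lmult[of x S "- 1"] by simp

lemma ideal_gen_diff: "x \<in> ideal_gen S \<Longrightarrow> y \<in> ideal_gen S \<Longrightarrow> x - y \<in> ideal_gen S"
  using ideal_gen.add[of x S "- y"] ideal_gen_uminus[of y S] by simp


subsection \<open>The ideal is proper\<close>

text \<open>
  The assignment \<open>l\<^sub>i\<^sub>j\<^sup>\<plusminus>\<^sup>(\<^sup>r\<^sup>) \<mapsto> \<delta>\<^sub>i\<^sub>j \<delta>\<^sub>r\<^sub>0\<close>, \<open>q\<^sup>c \<mapsto> 1\<close> satisfies all relations.
\<close>

fun ev_gen :: "nat \<Rightarrow> uq_gen \<Rightarrow> cq" where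
  "ev_gen d (Lgen s i j r) = (if i = j \<and> i \<in> {1..d} \<and> r = 0 then 1 else 0)"
| "ev_gen d QC = 1"
| "ev_gen d QCinv = 1"

definition ev_word :: "nat \<Rightarrow> uq_gen free_monoid \<Rightarrow> cq" where
  "ev_word d w = prod_list (map (ev_gen d) (letters w))"

definition ev :: "nat \<Rightarrow> free_alg \<Rightarrow> cq" where
  "ev d p = (\<Sum>w\<in>Poly_Mapping.keys p. Poly_Mapping.lookup p w * ev_word d w)"

lemma ev_word_plus: "ev_word d (u + v) = ev_word d u * ev_word d v"
  by (simp add: ev_word_def plus_free_monoid_def)

lemma ev_superset:
  "finite A \<Longrightarrow> Poly_Mapping.keys p \<subseteq> A \<Longrightarrow>
    ev d p = (\<Sum>w\<in>A. Poly_Mapping.lookup p w * ev_word d w)"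
  unfolding ev_def by (rule sum.mono_neutral_left) (auto simp: in_keys_iff)

lemma ev_add: "ev d (p + p') = ev d p + ev d p'"
proof -
  let ?A = "Poly_Mapping.keys p \<union> Poly_Mapping.keys p'"
  have "ev d (p + p') = (\<Sum>w\<in>?A. Poly_Mapping.lookup (p + p') w * ev_word d w)"
    by (rule ev_superset) (auto dest: subsetD[OF Poly_Mapping.keys_add])
  also have "\<dots> = (\<Sum>w\<in>?A. Poly_Mapping.lookup p w * ev_word d w)
      + (\<Sum>w\<in>?A. Poly_Mapping.lookup p' w * ev_word d w)"
    by (simp add: lookup_add distrib_right sum.distrib)
  also have "\<dots> = ev d p + ev d p'"
    using ev_superset[of ?A p d] ev_superset[of ?A p' d] by simp
  finally show ?thesis .
qed

lemma ev_0 [simp]: "ev d 0 = 0"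
  by (simp add: ev_def)

lemma ev_sum: "ev d (sum F A) = (\<Sum>x\<in>A. ev d (F x))"
  by (induction A rule: infinite_finite_induct) (simp_all add: ev_add)

lemma ev_single: "ev d (Poly_Mapping.single w c) = c * ev_word d w"
  by (cases "c = 0") (simp_all add: ev_def)

lemma ev_mult: "ev d (p * p') = ev d p * ev d p'"
proof -
  have *: "(\<Sum>w\<in>Poly_Mapping.keys p. Poly_Mapping.single w (Poly_Mapping.lookup p w)) = p"
    for p :: free_alg
    by (rule poly_mapping_eqI) (auto simp: lookup_sum lookup_single when_def in_keys_iff)
  have "ev d (p * p') =
    ev d ((\<Sum>w\<in>Poly_Mapping.keys p. Poly_Mapping.single w (Poly_Mapping.lookup p w)) *
          (\<Sum>v\<in>Poly_Mapping.keys p'. Poly_Mapping.single v (Poly_Mapping.lookup p' v)))"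
    by (simp only: *)
  also have "\<dots> = (\<Sum>w\<in>Poly_Mapping.keys p. \<Sum>v\<in>Poly_Mapping.keys p'.
      (Poly_Mapping.lookup p w * ev_word d w) * (Poly_Mapping.lookup p' v * ev_word d v))"
    by (simp add: sum_product ev_sum mult_single ev_single ev_word_plus mult_ac)
  also have "\<dots> = ev d p * ev d p'"
    by (simp add: ev_def sum_product)
  finally show ?thesis .
qed

lemma ev_1 [simp]: "ev d 1 = 1"
  unfolding single_one[symmetric] ev_single by (simp add: ev_word_def zero_free_monoid_def)

lemma ev_diff: "ev d (p - p') = ev d p - ev d p'"
  using ev_add[of d "p - p'" p'] by simp

lemma ev_uminus: "ev d (- p) = - ev d p"
  using ev_diff[of d 0 p] by simp

lemma ev_gen_eq: "ev d (gen g) = ev_gen d g"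
  by (simp add: gen_def ev_single ev_word_def)

lemma ev_power: "ev d (p ^ m) = ev d p ^ m"
  by (induction m) (simp_all add: ev_mult)

lemma ev_fscal: "ev d (fscal c) = c"
  by (simp add: fscal_def ev_single ev_word_def zero_free_monoid_def)

lemma ev_tmul:
  "ev (M+N) (tmul M N X Y i j k l) =
     tmul M N (\<lambda>i j k l. ev (M+N) (X i j k l)) (\<lambda>i j k l. ev (M+N) (Y i j k l)) i j k l"
  by (simp add: tmul_def Let_def ev_sum ev_mult ev_power ev_uminus)

lemma tmul_id_right:
  assumes "j \<in> {1..M+N}" "l \<in> {1..M+N}"
    and Y: "\<And>i j k l. i \<in> {1..M+N} \<Longrightarrow> k \<in> {1..M+N} \<Longrightarrow> Y i j k l = (if i = j \<and> k = l then c else 0)"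
  shows "tmul M N X Y i j k l = X i j k l * (c :: 'a :: comm_ring_1)"
proof -
  have "tmul M N X Y i j k l =
     (\<Sum>a\<in>{1..M+N}. \<Sum>b\<in>{1..M+N}. if b = l then if a = j then X i j k l * c else 0 else 0)"
    unfolding tmul_def Let_def
    by (intro sum.cong refl) (auto simp: Y minus_one_power_iff)
  also have "\<dots> = X i j k l * c"
    using assms(1,2) by (simp only: sum.delta finite_atLeastAtMost if_True)
  finally show ?thesis .
qed

lemma tmul_id_left:
  assumes "i \<in> {1..M+N}" "k \<in> {1..M+N}"
    and Y: "\<And>j l. j \<in> {1..M+N} \<Longrightarrow> l \<in> {1..M+N} \<Longrightarrow> Y i j k l = (if i = j \<and> k = l then c else 0)"
  shows "tmul M N Y X i j k l = c * (X i j k l :: 'a :: comm_ring_1)"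
proof -
  have "tmul M N Y X i j k l =
     (\<Sum>a\<in>{1..M+N}. \<Sum>b\<in>{1..M+N}. if b = k then if a = i then c * X i j k l else 0 else 0)"
    unfolding tmul_def Let_def
    by (intro sum.cong refl) (auto simp: Y minus_one_power_iff)
  also have "\<dots> = c * X i j k l"
    using assms(1,2) by (simp only: sum.delta finite_atLeastAtMost if_True)
  finally show ?thesis .
qed

lemma ev_RLL_LLR:
  assumes idx: "i \<in> {1..M+N}" "j \<in> {1..M+N}" "k \<in> {1..M+N}" "l \<in> {1..M+N}"
    and u: "ev (M+N) u = 1" and v: "ev (M+N) v = 1"
  shows "ev (M+N) (RLL M N s s' u a b i j k l) = ev (M+N) (LLR M N s s' v a b i j k l)"
proof -
  let ?e = "ev (M+N)"
  have L1: "?e (L1 s r i j k l) = (if i = j \<and> k = l then if r = 0 then 1 else 0 else 0)"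
    if "i \<in> {1..M+N}" "k \<in> {1..M+N}" for s r i j k l
    using that by (simp add: L1_def ev_gen_eq)
  have L2: "?e (L2 s r i j k l) = (if i = j \<and> k = l then if r = 0 then 1 else 0 else 0)"
    if "i \<in> {1..M+N}" "k \<in> {1..M+N}" for s r i j k l
    using that by (simp add: L2_def ev_gen_eq)
  have R: "?e (R_tw M N w m i j k l) = R_coeff M N m i j k l" if "?e w = 1" for w m
    by (simp add: R_tw_def ev_mult ev_fscal ev_power that)
  have "?e (tmul M N (tmul M N (R_tw M N u m) (L1 s r)) (L2 s' r') i j k l) =
        ?e (tmul M N (tmul M N (L2 s' r') (L1 s r)) (R_tw M N v m) i j k l)" (is "?a = ?b") for m r r'
  proof -
    let ?c = "\<lambda>r::nat. if r = 0 then 1 else (0::cq)"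
    have "?a = tmul M N (\<lambda>i j k l. ?e (tmul M N (R_tw M N u m) (L1 s r) i j k l))
                 (\<lambda>i j k l. ?e (L2 s' r' i j k l)) i j k l"
      by (rule ev_tmul)
    also have "\<dots> = ?e (tmul M N (R_tw M N u m) (L1 s r) i j k l) * ?c r'"
      by (rule tmul_id_right[OF idx(2,4)]) (rule L2)
    also have "?e (tmul M N (R_tw M N u m) (L1 s r) i j k l) =
        tmul M N (\<lambda>i j k l. ?e (R_tw M N u m i j k l)) (\<lambda>i j k l. ?e (L1 s r i j k l)) i j k l"
      by (rule ev_tmul)
    also have "\<dots> = ?e (R_tw M N u m i j k l) * ?c r"
      by (rule tmul_id_right[OF idx(2,4)]) (rule L1)
    finally have a: "?a = R_coeff M N m i j k l * ?c r * ?c r'"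
      by (simp only: R[OF u])
    have LL: "?e (tmul M N (L2 s' r') (L1 s r) i j k l) =
        (if i = j \<and> k = l then ?c r' * ?c r else 0)"
      if "j \<in> {1..M+N}" "l \<in> {1..M+N}" for j l
    proof -
      have "?e (tmul M N (L2 s' r') (L1 s r) i j k l) =
          tmul M N (\<lambda>i j k l. ?e (L2 s' r' i j k l)) (\<lambda>i j k l. ?e (L1 s r i j k l)) i j k l"
        by (rule ev_tmul)
      also have "\<dots> = ?c r' * ?e (L1 s r i j k l)"
        by (rule tmul_id_left[OF idx(1,3)]) (rule L2[OF idx(1,3)])
      finally show ?thesis
        by (simp add: L1[OF idx(1,3)])
    qed
    have "?b = tmul M N (\<lambda>i j k l. ?e (tmul M N (L2 s' r') (L1 s r) i j k l))
                 (\<lambda>i j k l. ?e (R_tw M N v m i j k l)) i j k l"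
      by (rule ev_tmul)
    also have "\<dots> = (?c r' * ?c r) * ?e (R_tw M N v m i j k l)"
      by (rule tmul_id_left[OF idx(1,3)]) (rule LL)
    finally have b: "?b = ?c r' * ?c r * R_coeff M N m i j k l"
      by (simp only: R[OF v])
    show ?thesis
      unfolding a b by (simp only: mult.commute mult.left_commute)
  qed
  thus ?thesis
    unfolding RLL_def LLR_def ev_sum by (intro sum.cong refl) (auto split: prod.splits)
qed

lemma ev_rels: "(x, y) \<in> uq_rels M N \<Longrightarrow> ev (M+N) x = ev (M+N) y"
  by (erule uq_rels.cases)
     (auto simp: ev_gen_eq ev_mult intro!: ev_RLL_LLR)

lemma ev_ideal: "x \<in> uq_ideal M N \<Longrightarrow> ev (M+N) x = 0"
  unfolding uq_ideal_def
  by (induction rule: ideal_gen.induct) (auto simp: ev_add ev_mult ev_diff dest: ev_rels)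

lemma one_notin_uq_ideal: "1 \<notin> uq_ideal M N"
  using ev_ideal[of 1 M N] by auto


section \<open>The quantum affine superalgebra\<close>

text \<open>
  The algebra depends on the naturals \<open>M = LENGTH('m)\<close> and \<open>N = LENGTH('n)\<close>, which are encoded in
  type arguments as for machine words.  All values, including \<open>0\<close>, occur as \<open>LENGTH\<close> of a numeral type.
\<close>

definition uq_rel :: "'m::len0 itself \<Rightarrow> 'n::len0 itself \<Rightarrow> free_alg \<Rightarrow> free_alg \<Rightarrow> bool" where
  "uq_rel m n x y \<longleftrightarrow> x - y \<in> uq_ideal (len_of m) (len_of n)"

lemma equivp_uq_rel: "equivp (uq_rel m n)"
proof (intro equivpI reflpI sympI transpI)
  show "uq_rel m n x x" for x
    by (simp add: uq_rel_def uq_ideal_def ideal_gen.zero)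
  show "uq_rel m n y x" if "uq_rel m n x y" for x y
    using that ideal_gen_uminus[of "x - y"] by (simp add: uq_rel_def uq_ideal_def)
  show "uq_rel m n x z" if "uq_rel m n x y" "uq_rel m n y z" for x y z
    using that ideal_gen.add[of "x - y" _ "y - z"] by (simp add: uq_rel_def uq_ideal_def)
qed

lemma uq_rel_eqI: "x = y \<Longrightarrow> uq_rel m n x y"
  using equivp_reflp[OF equivp_uq_rel] by simp

quotient_type (overloaded) ('m, 'n) uq_gl =
    free_alg / "uq_rel TYPE('m::len0) TYPE('n::len0)"
  by (rule equivp_uq_rel)

instantiation uq_gl :: (len0, len0) ring_1
begin

lift_definition zero_uq_gl :: "('a, 'b) uq_gl" is 0 .

lift_definition one_uq_gl :: "('a, 'b) uq_gl" is 1 .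

lift_definition plus_uq_gl :: "('a, 'b) uq_gl \<Rightarrow> ('a, 'b) uq_gl \<Rightarrow> ('a, 'b) uq_gl" is "(+)"
  unfolding uq_rel_def uq_ideal_def add_diff_add by (rule ideal_gen.add)

lift_definition minus_uq_gl :: "('a, 'b) uq_gl \<Rightarrow> ('a, 'b) uq_gl \<Rightarrow> ('a, 'b) uq_gl" is "(-)"
proof -
  fix x x' y y' :: free_alg
  assume "uq_rel TYPE('a) TYPE('b) x x'" "uq_rel TYPE('a) TYPE('b) y y'"
  then have "(x - x') - (y - y') \<in> uq_ideal LENGTH('a) LENGTH('b)"
    unfolding uq_rel_def uq_ideal_def by (rule ideal_gen_diff)
  then show "uq_rel TYPE('a) TYPE('b) (x - y) (x' - y')"
    unfolding uq_rel_def by (simp add: algebra_simps)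
qed

lift_definition uminus_uq_gl :: "('a, 'b) uq_gl \<Rightarrow> ('a, 'b) uq_gl" is "uminus"
  unfolding uq_rel_def uq_ideal_def minus_diff_minus by (rule ideal_gen_uminus)

lift_definition times_uq_gl :: "('a, 'b) uq_gl \<Rightarrow> ('a, 'b) uq_gl \<Rightarrow> ('a, 'b) uq_gl" is "(*)"
proof -
  fix x x' y y' :: free_alg
  assume "uq_rel TYPE('a) TYPE('b) x x'" "uq_rel TYPE('a) TYPE('b) y y'"
  then have "(x - x') * y + x' * (y - y') \<in> uq_ideal LENGTH('a) LENGTH('b)"
    unfolding uq_rel_def uq_ideal_def by (intro ideal_gen.add ideal_gen.lmult ideal_gen.rmult)
  then show "uq_rel TYPE('a) TYPE('b) (x * y) (x' * y')"
    unfolding uq_rel_def by (simp add: algebra_simps)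
qed

instance
proof
  show "(0 :: ('a, 'b) uq_gl) \<noteq> 1"
  proof transfer
    show "\<not> uq_rel TYPE('a) TYPE('b) 0 1"
      using ideal_gen_uminus[of "- 1 :: free_alg"] one_notin_uq_ideal[of "LENGTH('a)" "LENGTH('b)"]
      by (auto simp: uq_rel_def uq_ideal_def)
  qed
qed (transfer, rule uq_rel_eqI, simp add: algebra_simps)+

end

lift_definition uscal :: "cq \<Rightarrow> ('m::len0, 'n::len0) uq_gl" is fscal .

lift_definition lgen :: "pm \<Rightarrow> nat \<Rightarrow> nat \<Rightarrow> nat \<Rightarrow> ('m::len0, 'n::len0) uq_gl"
  is "\<lambda>s i j r. gen (Lgen s i j r)" .


section \<open>Graded matrices and quasideterminants\<close>

definition ring_inv :: "'a::ring_1 \<Rightarrow> 'a" where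
  "ring_inv x = (THE y. x * y = 1 \<and> y * x = 1)"

text \<open>
  An \<open>n\<close> by \<open>n\<close> matrix is a function on indices, of which only the values on \<open>{1..n}\<close> matter; so the
  principal submatrix of size \<open>k\<close> is obtained by using the size \<open>k\<close> with the same function.
  The argument \<open>p\<close> gives the parities of the indices.
\<close>

definition smat_mult ::
  "(nat \<Rightarrow> nat) \<Rightarrow> nat \<Rightarrow> (nat \<Rightarrow> nat \<Rightarrow> 'a::ring_1) \<Rightarrow> (nat \<Rightarrow> nat \<Rightarrow> 'a) \<Rightarrow> nat \<Rightarrow> nat \<Rightarrow> 'a" where
  "smat_mult p n A B i j =
     (\<Sum>k\<in>{1..n}. (- 1) ^ ((p i + p k) * (p k + p j)) * A i k * B k j)"

definition smat_inv ::
  "(nat \<Rightarrow> nat) \<Rightarrow> nat \<Rightarrow> (nat \<Rightarrow> nat \<Rightarrow> 'a::ring_1) \<Rightarrow> nat \<Rightarrow> nat \<Rightarrow> 'a" where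
  "smat_inv p n A = (THE B.
     (\<forall>i j. i \<notin> {1..n} \<or> j \<notin> {1..n} \<longrightarrow> B i j = 0) \<and>
     (\<forall>i\<in>{1..n}. \<forall>j\<in>{1..n}. smat_mult p n A B i j = (if i = j then 1 else 0) \<and>
                           smat_mult p n B A i j = (if i = j then 1 else 0)))"

definition quasidet ::
  "(nat \<Rightarrow> nat) \<Rightarrow> nat \<Rightarrow> (nat \<Rightarrow> nat \<Rightarrow> 'a::ring_1) \<Rightarrow> nat \<Rightarrow> nat \<Rightarrow> 'a" where
  "quasidet p n A i j = ring_inv (smat_inv p n A j i)"


section \<open>The quantum Berezinian\<close>

text \<open>
  The matrix \<open>L\<^sup>\<plusminus>(z q\<^sup>a)\<close>.  Its entries are formal power series in \<open>z\<^sup>-\<^sup>1\<close> for the sign \<open>Plus\<close> and in \<open>z\<close>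
  for the sign \<open>Minus\<close>.
\<close>

definition Lmat :: "pm \<Rightarrow> int \<Rightarrow> nat \<Rightarrow> nat \<Rightarrow> ('m::len0, 'n::len0) uq_gl fps" where
  "Lmat s a i j = Abs_fps (\<lambda>r. uscal (qq powi (zexp s * a * int r)) * lgen s i j r)"

definition perm_length :: "nat \<Rightarrow> (nat \<Rightarrow> nat) \<Rightarrow> nat" where
  "perm_length n \<sigma> = card {(i, j). i \<in> {1..n} \<and> j \<in> {1..n} \<and> i < j \<and> \<sigma> j < \<sigma> i}"

definition q_sign :: "nat \<Rightarrow> ('m::len0, 'n::len0) uq_gl fps" where
  "q_sign l = fps_const (uscal ((- qq) powi (- int l)))"

definition q_berezinian :: "pm \<Rightarrow> ('m::len0, 'n::len0) uq_gl fps" where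
  "q_berezinian s =
     (let M = LENGTH('m); N = LENGTH('n) in
      (\<Sum>\<sigma> | \<sigma> permutes {1..M}.
         q_sign (perm_length M \<sigma>) *
         prod_list (map (\<lambda>j. Lmat s (2 * int j - 2) (\<sigma> j) j) [1..<M+1])) *
      (\<Sum>\<tau> | \<tau> permutes {1..N}.
         q_sign (perm_length N \<tau>) *
         prod_list (map (\<lambda>k. smat_inv (par M) (M + N) (Lmat s (2 * int M - 2 * int k))
                               (M + k) (M + \<tau> k)) [1..<N+1])))"

text \<open>
  \<open>L_quasidet s a i\<close> is \<open>|L\<^sup>\<plusminus>(z q\<^sup>a)\<^sup>(\<^sup>i\<^sup>)|\<^sub>i\<^sub>i\<close>.
\<close>

definition L_quasidet :: "pm \<Rightarrow> int \<Rightarrow> nat \<Rightarrow> ('m::len0, 'n::len0) uq_gl fps" where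
  "L_quasidet s a i = quasidet (par LENGTH('m)) i (Lmat s a) i i"

definition ber_factor :: "pm \<Rightarrow> nat \<Rightarrow> ('m::len0, 'n::len0) uq_gl fps" where
  "ber_factor s i =
     (let M = LENGTH('m) in
      if i \<le> M then L_quasidet s (2 * int i - 2) i
      else ring_inv (L_quasidet s (2 * int M - 2 * int (i - M)) i))"

end

theory Submission
  imports Defs
begin

text \<open>
  Each sum over permutations in the Berezinian is a quantum minor, and a quantum minor peels off one
  quasideterminant at a time.

  For the even block this is the classical argument.  When the arguments of consecutive columns differ
  by the factor \<open>q\<^sup>2\<close>, the R-matrix degenerates and the RTT relation says that the \<open>2\<close> by \<open>2\<close> quantum
  minors change by a factor \<open>- q\<close> or \<open>- q\<^sup>-\<^sup>1\<close> when their columns are exchanged (\<open>q_exchange\<close>); hence a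
  quantum minor with two equal columns vanishes (\<open>q_det_equal_columns\<close>).  Expanding along the last column therefore
  gives a row vector \<open>V\<close> with \<open>V L(z q\<^sup>2\<^sup>m\<^sup>-\<^sup>2)\<^sup>(\<^sup>m\<^sup>) = (0, \<dots>, 0, D\<^sub>m)\<close> whose last entry is \<open>D\<^sub>m\<^sub>-\<^sub>1\<close>.
  Multiplying by the inverse matrix yields \<open>D\<^sub>m = D\<^sub>m\<^sub>-\<^sub>1 |L\<^sup>(\<^sup>m\<^sup>)|\<^sub>m\<^sub>m\<close> (\<open>even_minor\<close>).

  For the odd block the entries of \<open>L\<^sup>-\<^sup>1\<close> satisfy the RTT relation with the factors in opposite order
  (\<open>graded_rtt_inverse_odd\<close>), so the same theory applies to the transposed block.  Expansion along the
  first column now yields a column vector \<open>W\<close> such that \<open>X = L\<^sup>-\<^sup>1 W\<close> has no entries below position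
  \<open>M+m\<close>, while \<open>W\<close> has none above it.  Thus only the principal submatrix of size \<open>M+m\<close> enters the
  equation \<open>L X = W\<close> in its first \<open>M+m\<close> rows, and its last entry is the required recursion
  (\<open>odd_minor\<close>).

  The factors commute because \<open>|L(w)\<^sup>(\<^sup>n\<^sup>)|\<^sub>n\<^sub>n\<close> commutes with all entries of \<open>L(z)\<^sup>(\<^sup>n\<^sup>-\<^sup>1\<^sup>)\<close>
  (\<open>corner_commute\<close>), hence with the smaller quasideterminants.  The RTT relation gives this after
  division by \<open>z - w\<close>, so for \<open>w = z q\<^sup>y\<close> with \<open>y \<noteq> 0\<close>; a Vandermonde argument over infinitely many
  \<open>y\<close> turns it into the commutation of all coefficients, which covers the case \<open>w = z\<close> too.

  All this needs the RTT relation between matrices of power series in one variable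
  (\<open>graded_rtt_L_twist\<close>).  It is extracted from the defining relations by cancelling the common scalar
  factor \<open>f(x) / (x q - q\<^sup>-\<^sup>1)\<close> of the R-matrix coefficient by coefficient (\<open>rll_defect_eq_0\<close>).  The condition
  \<open>M \<noteq> N\<close> enters here, since it makes \<open>f\<close> well defined with leading coefficient \<open>1\<close>.  Finally, the signs of
  the graded matrix product disappear after multiplying the entry \<open>(i, j)\<close> by \<open>twist_sign\<close>, which changes
  neither the even block nor the odd block nor the diagonal; so all matrices below are multiplied in
  the ordinary way.
\<close>

section \<open>Quantum minors\<close>

text \<open>
  The left side is the \<open>2\<close> by \<open>2\<close> quantum minor in the rows \<open>a < b\<close> and the columns \<open>j\<close>, \<open>l\<close>, with
  \<open>v = - q\<^sup>-\<^sup>1\<close> and \<open>w = - q\<close>.  The relation is the form in which an RTT relation presents itself when the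
  arguments of the two factors are such that the diagonal coefficients of the R-matrix vanish.
\<close>
definition q_exchange :: "'a::ring_1 \<Rightarrow> 'a \<Rightarrow> nat set \<Rightarrow> (nat \<Rightarrow> nat \<Rightarrow> 'a) \<Rightarrow> (nat \<Rightarrow> nat \<Rightarrow> 'a) \<Rightarrow> bool" where
  "q_exchange v w I T T' \<longleftrightarrow>
     (\<forall>a\<in>I. \<forall>b\<in>I. \<forall>j\<in>I. \<forall>l\<in>I. a < b \<longrightarrow>
        T a j * T' b l + v * (T b j * T' a l) =
        (if j = l then 0
         else T' b l * T a j + (if l < j then v else w) * (T' b j * T a l)))"

text \<open>
  The quantum minor in the rows \<open>{m..n}\<close> whose \<open>k\<close>-th column is the column \<open>J k\<close> of the matrix \<open>T k\<close>.
  Free columns are needed in order to state that equal columns give zero, and the family \<open>T\<close>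
  accommodates the shifts of the argument.
\<close>
definition q_det ::
  "'a::ring_1 \<Rightarrow> (nat \<Rightarrow> nat \<Rightarrow> nat \<Rightarrow> 'a) \<Rightarrow> nat \<Rightarrow> nat \<Rightarrow> (nat \<Rightarrow> nat) \<Rightarrow> 'a" where
  "q_det v T m n J =
     (\<Sum>\<sigma> | \<sigma> permutes {m..n}.
        v ^ perm_length n \<sigma> * prod_list (map (\<lambda>k. T k (\<sigma> k) (J k)) [m..<n+1]))"

lemma central_power:
  fixes v :: "'a::ring_1"
  assumes "\<And>x. v * x = x * v"
  shows "v ^ k * x = x * v ^ k"
proof (induction k)
  case (Suc k)
  have "v ^ Suc k * x = v * (v ^ k * x)" by (simp add: mult.assoc)
  also have "\<dots> = x * v ^ Suc k"
    by (simp only: Suc assms mult.assoc power_Suc2)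
  finally show ?case .
qed simp

lemma permutes_mem:
  "\<sigma> permutes {m..n} \<Longrightarrow> m \<le> i \<Longrightarrow> i \<le> n \<Longrightarrow> \<sigma> i \<in> {m..n}" for m n :: nat
  by (subst permutes_in_image) auto

text \<open>
  Composition with the transposition maps inversions to inversions; only the pair \<open>(k, k + 1)\<close>
  changes its status.
\<close>
lemma perm_length_swap:
  assumes k: "1 \<le> k" "k < n" and less: "\<sigma> k < \<sigma> (Suc k)"
  shows "perm_length n (\<sigma> \<circ> Transposition.transpose k (Suc k)) = Suc (perm_length n \<sigma>)"
proof -
  let ?s = "Transposition.transpose k (Suc k)"
  define Inv where "Inv \<rho> = {(i, j). i \<in> {1..n} \<and> j \<in> {1..n} \<and> i < j \<and> \<rho> j < \<rho> i}"
    for \<rho> :: "nat \<Rightarrow> nat"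
  have fin: "finite (Inv \<rho>)" for \<rho>
    by (rule finite_subset[of _ "{1..n} \<times> {1..n}"]) (auto simp: Inv_def)
  have s_in: "?s i \<in> {1..n} \<longleftrightarrow> i \<in> {1..n}" for i
    using k by (auto simp: Transposition.transpose_def)
  have s_less: "i < j \<Longrightarrow> (i, j) \<noteq> (k, Suc k) \<Longrightarrow> ?s i < ?s j" for i j
    by (auto simp: Transposition.transpose_def)
  have "Inv (\<sigma> \<circ> ?s) = insert (k, Suc k) (map_prod ?s ?s ` Inv \<sigma>)"
  proof (intro equalityI subsetI)
    fix x assume x: "x \<in> Inv (\<sigma> \<circ> ?s)"
    obtain i j where ij: "x = (i, j)" by (cases x)
    show "x \<in> insert (k, Suc k) (map_prod ?s ?s ` Inv \<sigma>)"
    proof (cases "x = (k, Suc k)")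
      case False
      then have "(?s i, ?s j) \<in> Inv \<sigma>"
        using x ij s_in s_less[of i j] by (auto simp: Inv_def simp del: atLeastAtMost_iff)
      moreover have "x = map_prod ?s ?s (?s i, ?s j)"
        using ij by simp
      ultimately show ?thesis by blast
    qed simp
  next
    fix x assume "x \<in> insert (k, Suc k) (map_prod ?s ?s ` Inv \<sigma>)"
    then consider "x = (k, Suc k)" | i j where "x = (?s i, ?s j)" "(i, j) \<in> Inv \<sigma>"
      by auto
    then show "x \<in> Inv (\<sigma> \<circ> ?s)"
    proof cases
      case 1
      then show ?thesis using k less by (simp add: Inv_def)
    next
      case (2 i j)
      then have "(i, j) \<noteq> (k, Suc k)" using less by (auto simp: Inv_def)
      with 2 show ?thesis
        using s_in s_less[of i j] by (auto simp: Inv_def simp del: atLeastAtMost_iff)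
    qed
  qed
  moreover have "(k, Suc k) \<notin> map_prod ?s ?s ` Inv \<sigma>"
  proof
    assume "(k, Suc k) \<in> map_prod ?s ?s ` Inv \<sigma>"
    then obtain i j where "k = ?s i" "Suc k = ?s j" "(i, j) \<in> Inv \<sigma>"
      by (auto simp only: map_prod_simp prod.inject image_iff)
    then show False
      by (auto simp: Inv_def Transposition.transpose_def split: if_splits)
  qed
  moreover have "inj_on (map_prod ?s ?s) (Inv \<sigma>)"
    by (rule inj_on_subset[of _ UNIV]) (auto intro: prod.inj_map inj_transpose)
  ultimately have "card (Inv (\<sigma> \<circ> ?s)) = Suc (card (Inv \<sigma>))"
    by (simp add: fin card_image)
  then show ?thesis
    by (simp add: perm_length_def Inv_def)
qed

text \<open>
  Grouping a permutation with its composition with \<open>(k, k + 1)\<close> exhibits \<open>2\<close> by \<open>2\<close> minors in the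
  columns \<open>k\<close> and \<open>k + 1\<close>, which is where the exchange relation can be applied.
\<close>
lemma q_det_pairs:
  fixes v :: "'a::ring_1"
  assumes v: "\<And>x. v * x = x * v" and k: "1 \<le> m" "m \<le> k" "k < n"
  shows "q_det v T m n J =
    (\<Sum>\<sigma> | \<sigma> permutes {m..n} \<and> \<sigma> k < \<sigma> (Suc k).
       v ^ perm_length n \<sigma> *
       (prod_list (map (\<lambda>i. T i (\<sigma> i) (J i)) [m..<k]) *
        (T k (\<sigma> k) (J k) * T (Suc k) (\<sigma> (Suc k)) (J (Suc k)) +
         v * (T k (\<sigma> (Suc k)) (J k) * T (Suc k) (\<sigma> k) (J (Suc k)))) *
        prod_list (map (\<lambda>i. T i (\<sigma> i) (J i)) [Suc (Suc k)..<n+1])))"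
proof -
  let ?s = "Transposition.transpose k (Suc k)"
  let ?P = "{\<sigma>. \<sigma> permutes {m..n}}"
  let ?L = "{\<sigma>. \<sigma> permutes {m..n} \<and> \<sigma> k < \<sigma> (Suc k)}"
  let ?G = "{\<sigma>. \<sigma> permutes {m..n} \<and> \<sigma> (Suc k) < \<sigma> k}"
  define f where "f \<sigma> = v ^ perm_length n \<sigma> * prod_list (map (\<lambda>k. T k (\<sigma> k) (J k)) [m..<n+1])" for \<sigma>
  have s: "?s permutes {m..n}"
    using k by (intro permutes_swap_id) auto
  have fin: "finite ?P" by (simp add: finite_permutations)
  have finL: "finite ?L" by (rule finite_subset[OF _ fin]) auto
  have finG: "finite ?G" by (rule finite_subset[OF _ fin]) auto
  have neq: "\<sigma> k \<noteq> \<sigma> (Suc k)" if "\<sigma> permutes {m..n}" for \<sigma>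
    using that by (metis permutes_inj injD n_not_Suc_n)
  have split: "?P = ?L \<union> ?G"
    by (auto dest: neq simp: neq_iff)
  have upt: "[m..<n+1] = [m..<k] @ [k, Suc k] @ [Suc (Suc k)..<n+1]"
  proof -
    have "[m..<n+1] = [m..<k] @ [k..<n+1]"
      using k by (metis upt_add_eq_append le_add_diff_inverse less_imp_le trans_le_add1)
    also have "[k..<n+1] = k # Suc k # [Suc (Suc k)..<n+1]"
      using k by (simp add: upt_conv_Cons)
    finally show ?thesis by simp
  qed
  have bij: "bij_betw (\<lambda>\<sigma>. \<sigma> \<circ> ?s) ?L ?G"
    by (rule bij_betwI[of _ _ _ "\<lambda>\<sigma>. \<sigma> \<circ> ?s"])
       (auto simp: comp_assoc intro: permutes_compose s)
  have "q_det v T m n J = (\<Sum>\<sigma>\<in>?L \<union> ?G. f \<sigma>)"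
    unfolding q_det_def f_def split[symmetric] ..
  also have "\<dots> = (\<Sum>\<sigma>\<in>?L. f \<sigma>) + (\<Sum>\<sigma>\<in>?G. f \<sigma>)"
    by (rule sum.union_disjoint) (auto simp: finL finG)
  also have "(\<Sum>\<sigma>\<in>?G. f \<sigma>) = (\<Sum>\<sigma>\<in>?L. f (\<sigma> \<circ> ?s))"
    by (rule sum.reindex_bij_betw[OF bij, symmetric])
  also have "(\<Sum>\<sigma>\<in>?L. f \<sigma>) + (\<Sum>\<sigma>\<in>?L. f (\<sigma> \<circ> ?s)) = (\<Sum>\<sigma>\<in>?L. f \<sigma> + f (\<sigma> \<circ> ?s))"
    by (rule sum.distrib[symmetric])
  also have "\<dots> = (\<Sum>\<sigma>\<in>?L. v ^ perm_length n \<sigma> *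
       (prod_list (map (\<lambda>i. T i (\<sigma> i) (J i)) [m..<k]) *
        (T k (\<sigma> k) (J k) * T (Suc k) (\<sigma> (Suc k)) (J (Suc k)) +
         v * (T k (\<sigma> (Suc k)) (J k) * T (Suc k) (\<sigma> k) (J (Suc k)))) *
        prod_list (map (\<lambda>i. T i (\<sigma> i) (J i)) [Suc (Suc k)..<n+1])))"
  proof (rule sum.cong[OF refl])
    fix \<sigma> assume "\<sigma> \<in> ?L"
    then have len: "perm_length n (\<sigma> \<circ> ?s) = Suc (perm_length n \<sigma>)"
      using k by (intro perm_length_swap) auto
    have pull: "x * (v * y) * z = v * (x * y * z)" for x y z
      by (simp only: mult.assoc[symmetric] v[of x, symmetric])
    define A where "A = prod_list (map (\<lambda>i. T i (\<sigma> i) (J i)) [m..<k])"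
    define B where "B = prod_list (map (\<lambda>i. T i (\<sigma> i) (J i)) [Suc (Suc k)..<n+1])"
    have A': "prod_list (map (\<lambda>i. T i ((\<sigma> \<circ> ?s) i) (J i)) [m..<k]) = A"
      unfolding A_def by (rule arg_cong[where f=prod_list]) (auto simp: Transposition.transpose_def)
    have B': "prod_list (map (\<lambda>i. T i ((\<sigma> \<circ> ?s) i) (J i)) [Suc (Suc k)..<n+1]) = B"
      unfolding B_def by (rule arg_cong[where f=prod_list]) (auto simp: Transposition.transpose_def)
    have 1: "f \<sigma> = v ^ perm_length n \<sigma> * (A * (T k (\<sigma> k) (J k) * T (Suc k) (\<sigma> (Suc k)) (J (Suc k))) * B)"
      unfolding f_def upt by (simp add: A_def B_def mult.assoc del: upt_Suc)
    have "f (\<sigma> \<circ> ?s) = v ^ Suc (perm_length n \<sigma>) *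
        (A * (T k (\<sigma> (Suc k)) (J k) * T (Suc k) (\<sigma> k) (J (Suc k))) * B)"
      unfolding f_def upt len map_append prod_list.append A' B'
      by (simp add: mult.assoc)
    also have "\<dots> = v ^ perm_length n \<sigma> *
        (A * (v * (T k (\<sigma> (Suc k)) (J k) * T (Suc k) (\<sigma> k) (J (Suc k)))) * B)"
      by (simp only: power_Suc2 mult.assoc pull[unfolded mult.assoc])
    finally show "f \<sigma> + f (\<sigma> \<circ> ?s) = v ^ perm_length n \<sigma> *
       (prod_list (map (\<lambda>i. T i (\<sigma> i) (J i)) [m..<k]) *
        (T k (\<sigma> k) (J k) * T (Suc k) (\<sigma> (Suc k)) (J (Suc k)) +
         v * (T k (\<sigma> (Suc k)) (J k) * T (Suc k) (\<sigma> k) (J (Suc k)))) *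
        prod_list (map (\<lambda>i. T i (\<sigma> i) (J i)) [Suc (Suc k)..<n+1]))"
      unfolding 1 A_def[symmetric] B_def[symmetric] by (simp add: algebra_simps)
  qed
  finally show ?thesis .
qed

context
  fixes v w :: "'a::ring_1" and T :: "nat \<Rightarrow> nat \<Rightarrow> nat \<Rightarrow> 'a" and m n :: nat
  assumes v: "\<And>x. v * x = x * v" and vw: "v * w = 1"
    and m: "1 \<le> m"
    and exch: "\<And>k. m \<le> k \<Longrightarrow> k < n \<Longrightarrow> q_exchange v w {m..n} (T k) (T (Suc k))"
begin

lemma q_det_equal_adjacent:
  assumes "m \<le> k" "k < n" "J k \<in> {m..n}" "J (Suc k) = J k"
  shows "q_det v T m n J = 0"
proof -
  have "T k (\<sigma> k) (J k) * T (Suc k) (\<sigma> (Suc k)) (J (Suc k)) +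
        v * (T k (\<sigma> (Suc k)) (J k) * T (Suc k) (\<sigma> k) (J (Suc k))) = 0"
    if "\<sigma> permutes {m..n}" "\<sigma> k < \<sigma> (Suc k)" for \<sigma>
  proof -
    have "\<sigma> k \<in> {m..n}" "\<sigma> (Suc k) \<in> {m..n}"
      using assms by (intro permutes_mem[OF that(1)]; simp)+
    then show ?thesis
      using exch[OF assms(1,2)] that(2) assms(3,4) unfolding q_exchange_def by simp
  qed
  then show ?thesis
    unfolding q_det_pairs[OF v m assms(1,2)] by (intro sum.neutral) simp
qed

lemma q_det_swap_columns:
  assumes k: "m \<le> k" "k < n" and J: "J k \<in> {m..n}" "J (Suc k) \<in> {m..n}" and less: "J (Suc k) < J k"
  shows "q_det v T m n J = v * q_det v T m n (J \<circ> Transposition.transpose k (Suc k))"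
proof -
  let ?J = "J \<circ> Transposition.transpose k (Suc k)"
  have vp: "v ^ l * (v * x) = v * (v ^ l * x)" for l x
    by (simp only: mult.assoc[symmetric] power_commutes)
  have *: "T k (\<sigma> k) (J k) * T (Suc k) (\<sigma> (Suc k)) (J (Suc k)) +
        v * (T k (\<sigma> (Suc k)) (J k) * T (Suc k) (\<sigma> k) (J (Suc k))) =
        v * (T k (\<sigma> k) (?J k) * T (Suc k) (\<sigma> (Suc k)) (?J (Suc k)) +
        v * (T k (\<sigma> (Suc k)) (?J k) * T (Suc k) (\<sigma> k) (?J (Suc k))))"
    if "\<sigma> permutes {m..n}" "\<sigma> k < \<sigma> (Suc k)" for \<sigma>
  proof -
    have "\<sigma> k \<in> {m..n}" "\<sigma> (Suc k) \<in> {m..n}"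
      using assms by (intro permutes_mem[OF that(1)]; simp)+
    note ex = exch[OF k, unfolded q_exchange_def, rule_format, OF this _ _ that(2)]
    have "v * (w * x) = x" for x
      by (simp add: mult.assoc[symmetric] vw)
    then show ?thesis
      using ex[OF J] ex[OF J(2,1)] less by (simp add: distrib_left add.commute)
  qed
  have 1: "map (\<lambda>i. T i (\<sigma> i) (?J i)) [m..<k] = map (\<lambda>i. T i (\<sigma> i) (J i)) [m..<k]" for \<sigma>
    by (auto simp: Transposition.transpose_def)
  have 2: "map (\<lambda>i. T i (\<sigma> i) (?J i)) [Suc (Suc k)..<n+1] = map (\<lambda>i. T i (\<sigma> i) (J i)) [Suc (Suc k)..<n+1]" for \<sigma>
    by (auto simp: Transposition.transpose_def)
  have pull: "x * (v * y) * z = v * (x * y * z)" for x y z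
    by (simp only: mult.assoc[symmetric] v[of x, symmetric])
  show ?thesis
    unfolding q_det_pairs[OF v m k] 1 2 sum_distrib_left
  proof (rule sum.cong[OF refl], goal_cases)
    case (1 \<sigma>)
    then show ?case by (simp only: mem_Collect_eq * vp[symmetric] pull)
  qed
qed

text \<open>
  The second of the equal columns is moved to the left until it meets an equal neighbour.  Each
  exchange of neighbours is either \<open>q_det_swap_columns\<close> or, if the columns are in increasing order, its inverse;
  the latter costs a division by \<open>v\<close>.
\<close>
theorem q_det_equal_columns:
  assumes "m \<le> a" "a < b" "b \<le> n" "J a = J b" "J ` {m..n} \<subseteq> {m..n}"
  shows "q_det v T m n J = 0"
  using assms
proof (induction "b - a" arbitrary: b J)
  case 0
  then show ?case by simp
next
  case (Suc d)
  obtain c where c: "b = Suc c" using Suc.prems by (cases b) auto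
  have Jc: "J c \<in> {m..n}" "J (Suc c) \<in> {m..n}"
    using subsetD[OF Suc.prems(5) imageI, of c] subsetD[OF Suc.prems(5) imageI, of "Suc c"]
      Suc.prems(1,2,3) c by simp_all
  have mc: "m \<le> c" "c < n" using Suc.prems c by auto
  let ?J = "J \<circ> Transposition.transpose c (Suc c)"
  \<comment> \<open>\<open>c\<close> is the left neighbour of \<open>b\<close>\<close>
  consider "J c = J b" | "c \<noteq> a" "J b < J c" | "c \<noteq> a" "J c < J b"
    using Suc.prems(4) by (metis linorder_neqE_nat)
  then show ?case
  proof cases
    case 1
    show ?thesis
      by (rule q_det_equal_adjacent[where J = J, OF mc Jc(1)]) (use 1 c in simp)
  next
    case 2
    have "q_det v T m n ?J = 0"
    proof (rule Suc.hyps(1))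
      show "?J ` {m..n} \<subseteq> {m..n}"
        using Suc.prems(5) mc by (auto simp: Transposition.transpose_def image_subset_iff)
      show "?J a = ?J c" using 2 Suc.prems c by (simp add: Transposition.transpose_def)
    qed (use 2 Suc c in auto)
    then show ?thesis
      using q_det_swap_columns[where J = J, OF mc Jc] 2 c by simp
  next
    case 3
    have "q_det v T m n ?J = 0"
    proof (rule Suc.hyps(1))
      show "?J ` {m..n} \<subseteq> {m..n}"
        using Suc.prems(5) mc by (auto simp: Transposition.transpose_def image_subset_iff)
      show "?J a = ?J c" using 3 Suc.prems c by (simp add: Transposition.transpose_def)
    qed (use 3 Suc c in auto)
    moreover have "q_det v T m n ?J = v * q_det v T m n (?J \<circ> Transposition.transpose c (Suc c))"
      by (rule q_det_swap_columns[OF mc]) (use 3 c Jc in auto)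
    moreover have "?J \<circ> Transposition.transpose c (Suc c) = J"
      by (simp add: comp_assoc)
    ultimately have "v * q_det v T m n J = 0" by simp
    then have "w * v * q_det v T m n J = 0" by (simp add: mult.assoc)
    then show ?thesis using vw v[of w] by simp
  qed
qed

text \<open>
  \<open>V i\<close> collects the permutations that map \<open>n\<close> to \<open>i\<close>.  Replacing the last column by the column \<open>j\<close>
  turns the expansion into a minor with two equal columns unless \<open>j = n\<close>.
\<close>
lemma q_det_expand_last:
  assumes "m \<le> n"
  shows "\<exists>V. V n = q_det v T m (n - 1) id \<and>
    (\<forall>j\<in>{m..n}. (\<Sum>i\<in>{m..n}. V i * T n i j) = (if j = n then q_det v T m n id else 0))"
proof -
  let ?P = "\<lambda>i. {\<sigma>. \<sigma> permutes {m..n} \<and> \<sigma> n = i}"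
  define V where "V i = (\<Sum>\<sigma>\<in>?P i. v ^ perm_length n \<sigma> * prod_list (map (\<lambda>k. T k (\<sigma> k) k) [m..<n]))" for i
  have upt: "[m..<n+1] = [m..<n] @ [n]" using assms by simp
  have "(\<Sum>i\<in>{m..n}. V i * T n i j) = q_det v T m n (id(n := j))" for j
  proof -
    have "(\<Sum>i\<in>{m..n}. V i * T n i j) = (\<Sum>i\<in>{m..n}. \<Sum>\<sigma>\<in>?P i.
       v ^ perm_length n \<sigma> * prod_list (map (\<lambda>k. T k (\<sigma> k) ((id(n := j)) k)) [m..<n+1]))"
      unfolding V_def sum_distrib_right
    proof (intro sum.cong refl, goal_cases)
      case (1 i \<sigma>)
      have "map (\<lambda>k. T k (\<sigma> k) ((id(n := j)) k)) [m..<n] = map (\<lambda>k. T k (\<sigma> k) k) [m..<n]"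
        by auto
      note eq = this
      show ?case
        unfolding upt map_append prod_list.append eq using 1 by (simp add: mult.assoc)
    qed
    also have "\<dots> = sum (\<lambda>\<sigma>. v ^ perm_length n \<sigma> * prod_list (map (\<lambda>k. T k (\<sigma> k) ((id(n := j)) k)) [m..<n+1]))
        (\<Union>i\<in>{m..n}. ?P i)"
      by (rule sum.UNION_disjoint[symmetric])
         (auto intro: finite_subset[OF _ finite_permutations[of "{m..n}"]])
    also have "(\<Union>i\<in>{m..n}. ?P i) = {\<sigma>. \<sigma> permutes {m..n}}"
      using assms permutes_mem[of _ m n n] by auto
    finally show ?thesis unfolding q_det_def .
  qed
  moreover have "q_det v T m n (id(n := j)) = (if j = n then q_det v T m n id else 0)" if "j \<in> {m..n}" for j
  proof (cases "j = n")
    case True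
    then show ?thesis by (simp add: fun_upd_idem)
  next
    case False
    then have "q_det v T m n (id(n := j)) = 0"
      using that by (intro q_det_equal_columns[of j n]) auto
    with False show ?thesis by simp
  qed
  moreover have "V n = q_det v T m (n - 1) id"
  proof -
    obtain n' where n': "n = Suc n'" using assms m by (cases n) auto
    have "?P n = {\<sigma>. \<sigma> permutes {m..n'}}"
    proof (intro equalityI subsetI)
      fix \<sigma> assume s: "\<sigma> \<in> ?P n"
      show "\<sigma> \<in> {\<sigma>. \<sigma> permutes {m..n'}}"
        using s n' by (auto intro!: permutes_superset[of \<sigma> "{m..n}"] simp: atLeastAtMostSuc_conv[of m n'] le_Suc_eq)
    next
      fix \<sigma> assume "\<sigma> \<in> {\<sigma>. \<sigma> permutes {m..n'}}"
      then show "\<sigma> \<in> ?P n"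
        using n' permutes_subset[of \<sigma> "{m..n'}" "{m..n}"] permutes_not_in[of \<sigma> "{m..n'}" n]
        by simp
    qed
    moreover have "perm_length n \<sigma> = perm_length n' \<sigma>" if "\<sigma> permutes {m..n'}" for \<sigma>
    proof -
      have "\<sigma> i \<le> n'" if "i \<le> n'" for i
        using \<open>\<sigma> permutes {m..n'}\<close> that permutes_in_image[of \<sigma> "{m..n'}" i] permutes_not_in[of \<sigma> "{m..n'}" i]
        by (cases "i \<in> {m..n'}") auto
      note le = this
      have fix_n: "\<sigma> (Suc n') = Suc n'" using that by (simp add: permutes_not_in)
      have "j \<le> n'" if "i < j" "j \<le> Suc n'" "\<sigma> j < \<sigma> i" for i j
        using that fix_n le[of i] by (cases "j = Suc n'") auto
      then have "{(i, j). i \<in> {1..n} \<and> j \<in> {1..n} \<and> i < j \<and> \<sigma> j < \<sigma> i} =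
            {(i, j). i \<in> {1..n'} \<and> j \<in> {1..n'} \<and> i < j \<and> \<sigma> j < \<sigma> i}"
        using n' by auto
      then show ?thesis by (simp add: perm_length_def)
    qed
    ultimately show ?thesis
      unfolding V_def q_det_def using n' by simp
  qed
  ultimately show ?thesis by (intro exI[of _ V]) simp
qed

text \<open>
  The same with the first column.  Here the complementary minors stand on the right, so the family
  \<open>W\<close> behaves like a column vector.
\<close>
lemma q_det_expand_first:
  assumes "m \<le> n"
  shows "\<exists>W. W m = q_det v T (Suc m) n id \<and>
    (\<forall>j\<in>{m..n}. (\<Sum>i\<in>{m..n}. T m i j * W i) = (if j = m then q_det v T m n id else 0))"
proof -
  let ?P = "\<lambda>i. {\<sigma>. \<sigma> permutes {m..n} \<and> \<sigma> m = i}"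
  define W where "W i = (\<Sum>\<sigma>\<in>?P i. v ^ perm_length n \<sigma> * prod_list (map (\<lambda>k. T k (\<sigma> k) k) [Suc m..<n+1]))" for i
  have upt: "[m..<n+1] = m # [Suc m..<n+1]" using assms by (simp add: upt_conv_Cons)
  have pull: "x * (v ^ l * y) = v ^ l * (x * y)" for x y l
    by (simp only: mult.assoc[symmetric] central_power[OF v, of _ x, symmetric])
  have "(\<Sum>i\<in>{m..n}. T m i j * W i) = q_det v T m n (id(m := j))" for j
  proof -
    have "(\<Sum>i\<in>{m..n}. T m i j * W i) = (\<Sum>i\<in>{m..n}. \<Sum>\<sigma>\<in>?P i.
       v ^ perm_length n \<sigma> * prod_list (map (\<lambda>k. T k (\<sigma> k) ((id(m := j)) k)) [m..<n+1]))"
      unfolding W_def sum_distrib_left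
    proof (intro sum.cong refl, goal_cases)
      case (1 i \<sigma>)
      have "map (\<lambda>k. T k (\<sigma> k) ((id(m := j)) k)) [Suc m..<n+1] = map (\<lambda>k. T k (\<sigma> k) k) [Suc m..<n+1]"
        by auto
      note eq = this
      show ?case
        unfolding upt list.map prod_list.Cons pull eq using 1 by simp
    qed
    also have "\<dots> = sum (\<lambda>\<sigma>. v ^ perm_length n \<sigma> * prod_list (map (\<lambda>k. T k (\<sigma> k) ((id(m := j)) k)) [m..<n+1]))
        (\<Union>i\<in>{m..n}. ?P i)"
      by (rule sum.UNION_disjoint[symmetric])
         (auto intro: finite_subset[OF _ finite_permutations[of "{m..n}"]])
    also have "(\<Union>i\<in>{m..n}. ?P i) = {\<sigma>. \<sigma> permutes {m..n}}"
      using assms permutes_mem[of _ m n m] by auto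
    finally show ?thesis unfolding q_det_def .
  qed
  moreover have "q_det v T m n (id(m := j)) = (if j = m then q_det v T m n id else 0)" if "j \<in> {m..n}" for j
  proof (cases "j = m")
    case True
    then show ?thesis by (simp add: fun_upd_idem)
  next
    case False
    then have "q_det v T m n (id(m := j)) = 0"
      using that by (intro q_det_equal_columns[of m j]) auto
    with False show ?thesis by simp
  qed
  moreover have "W m = q_det v T (Suc m) n id"
  proof -
    have "?P m = {\<sigma>. \<sigma> permutes {Suc m..n}}"
    proof (intro equalityI subsetI)
      fix \<sigma> assume s: "\<sigma> \<in> ?P m"
      show "\<sigma> \<in> {\<sigma>. \<sigma> permutes {Suc m..n}}"
        using s assms by (auto intro!: permutes_superset[of \<sigma> "{m..n}"] simp: Suc_le_eq order_le_less)
    next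
      fix \<sigma> assume "\<sigma> \<in> {\<sigma>. \<sigma> permutes {Suc m..n}}"
      then show "\<sigma> \<in> ?P m"
        using permutes_subset[of \<sigma> "{Suc m..n}" "{m..n}"] permutes_not_in[of \<sigma> "{Suc m..n}" m]
        by simp
    qed
    then show ?thesis
      unfolding W_def q_det_def by simp
  qed
  ultimately show ?thesis by (intro exI[of _ W]) simp
qed

end


section \<open>Inverse matrices and quasideterminants\<close>

text \<open>
  Matrices are functions of which only the entries with indices in \<open>{1..n}\<close> are looked at, so that the
  size \<open>n\<close> selects a principal submatrix.  The products are ordinary ones, without signs.
\<close>
definition mat_inverse :: "nat \<Rightarrow> (nat \<Rightarrow> nat \<Rightarrow> 'a::ring_1) \<Rightarrow> (nat \<Rightarrow> nat \<Rightarrow> 'a) \<Rightarrow> bool" where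
  "mat_inverse n A B \<longleftrightarrow> (\<forall>i\<in>{1..n}. \<forall>j\<in>{1..n}.
     (\<Sum>k\<in>{1..n}. A i k * B k j) = (if i = j then 1 else 0) \<and>
     (\<Sum>k\<in>{1..n}. B i k * A k j) = (if i = j then 1 else 0))"

lemma mat_inverseD:
  assumes "mat_inverse n A B" "i \<in> {1..n}" "j \<in> {1..n}"
  shows "(\<Sum>k\<in>{1..n}. A i k * B k j) = (if i = j then 1 else 0)"
    and "(\<Sum>k\<in>{1..n}. B i k * A k j) = (if i = j then 1 else 0)"
  using assms by (auto simp: mat_inverse_def simp del: atLeastAtMost_iff One_nat_def)

lemma mat_inverse_solve_left:
  assumes inv: "mat_inverse n A B" and i: "i \<in> {1..n}"
    and eq: "\<And>j. j \<in> {1..n} \<Longrightarrow> (\<Sum>k\<in>{1..n}. A j k * y k) = x j"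
  shows "y i = (\<Sum>k\<in>{1..n}. B i k * x k)"
proof -
  have "(\<Sum>k\<in>{1..n}. B i k * x k) = (\<Sum>k\<in>{1..n}. B i k * (\<Sum>l\<in>{1..n}. A k l * y l))"
    by (intro sum.cong refl) (simp only: eq)
  also have "\<dots> = (\<Sum>l\<in>{1..n}. (\<Sum>k\<in>{1..n}. B i k * A k l) * y l)"
    unfolding sum_distrib_left sum_distrib_right mult.assoc by (rule sum.swap)
  also have "\<dots> = (\<Sum>l\<in>{1..n}. if l = i then y l else 0)"
    by (intro sum.cong refl) (simp add: mat_inverseD(2)[OF inv i] del: atLeastAtMost_iff One_nat_def)
  also have "\<dots> = y i" using i by (simp only: sum.delta' sum.delta finite_atLeastAtMost if_True)
  finally show ?thesis by simp
qed

lemma mat_inverse_solve_right: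
  assumes inv: "mat_inverse n A B" and i: "i \<in> {1..n}"
    and eq: "\<And>j. j \<in> {1..n} \<Longrightarrow> (\<Sum>k\<in>{1..n}. y k * A k j) = x j"
  shows "y i = (\<Sum>k\<in>{1..n}. x k * B k i)"
proof -
  have "(\<Sum>k\<in>{1..n}. x k * B k i) = (\<Sum>k\<in>{1..n}. (\<Sum>l\<in>{1..n}. y l * A l k) * B k i)"
    by (intro sum.cong refl) (simp only: eq)
  also have "\<dots> = (\<Sum>l\<in>{1..n}. y l * (\<Sum>k\<in>{1..n}. A l k * B k i))"
    unfolding sum_distrib_left sum_distrib_right mult.assoc by (rule sum.swap)
  also have "\<dots> = (\<Sum>l\<in>{1..n}. if l = i then y l else 0)"
    by (intro sum.cong refl) (simp add: mat_inverseD(1)[OF inv _ i] del: atLeastAtMost_iff One_nat_def)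
  also have "\<dots> = y i" using i by (simp only: sum.delta' sum.delta finite_atLeastAtMost if_True)
  finally show ?thesis by simp
qed

lemma mat_inverse_unique:
  assumes "mat_inverse n A B" "mat_inverse n A C" "i \<in> {1..n}" "j \<in> {1..n}"
  shows "C i j = B i j"
proof -
  have "C i j = (\<Sum>k\<in>{1..n}. B i k * (if k = j then 1 else 0))"
    by (rule mat_inverse_solve_left[OF assms(1,3)]) (rule mat_inverseD(1)[OF assms(2) _ assms(4)])
  also have "\<dots> = (\<Sum>k\<in>{1..n}. if k = j then B i k else 0)"
    by (intro sum.cong refl) simp
  also have "\<dots> = B i j" using assms(4) by (simp only: sum.delta finite_atLeastAtMost if_True)
  finally show ?thesis .
qed

lemma mat_inverse_commute:
  assumes inv: "mat_inverse n A B" and ij: "i \<in> {1..n}" "j \<in> {1..n}"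
    and comm: "\<And>a b. a \<in> {1..n} \<Longrightarrow> b \<in> {1..n} \<Longrightarrow> c * A a b = A a b * c"
  shows "c * B i j = B i j * c"
proof -
  have "c * B i j = (\<Sum>k\<in>{1..n}. B i k * (if k = j then c else 0))"
  proof (rule mat_inverse_solve_left[OF inv ij(1)])
    fix a assume a: "a \<in> {1..n}"
    have "(\<Sum>k\<in>{1..n}. A a k * (c * B k j)) = c * (\<Sum>k\<in>{1..n}. A a k * B k j)"
      unfolding sum_distrib_left
      by (intro sum.cong refl) (simp only: mult.assoc[symmetric] comm[OF a])
    then show "(\<Sum>k\<in>{1..n}. A a k * (c * B k j)) = (if a = j then c else 0)"
      by (simp add: mat_inverseD(1)[OF inv a ij(2)] del: atLeastAtMost_iff One_nat_def)
  qed
  also have "\<dots> = (\<Sum>k\<in>{1..n}. if k = j then B i k * c else 0)"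
    by (intro sum.cong refl) simp
  also have "\<dots> = B i j * c" using ij(2) by (simp only: sum.delta finite_atLeastAtMost if_True)
  finally show ?thesis .
qed

text \<open>
  Inversion of a bordered matrix: \<open>d\<close> is the Schur complement of the leading block.  The vectors \<open>x\<close>
  and \<open>y\<close> of the proof satisfy \<open>x A = d e\<^sub>N\<close> and \<open>A y = d e\<^sub>N\<close> (as row and column), and the inverse is the
  inverse of the leading block, padded with zeros, plus the rank one matrix \<open>y d\<^sup>-\<^sup>1 x\<close>.
\<close>
lemma mat_inverse_Suc:
  fixes A :: "nat \<Rightarrow> nat \<Rightarrow> 'a::ring_1"
  assumes Y: "mat_inverse n A Y"
    and d: "d = A (Suc n) (Suc n) - (\<Sum>a\<in>{1..n}. \<Sum>b\<in>{1..n}. A (Suc n) a * Y a b * A b (Suc n))"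
    and e: "d * e = 1" "e * d = 1"
  shows "\<exists>B. mat_inverse (Suc n) A B \<and> B (Suc n) (Suc n) = e"
proof -
  let ?N = "Suc n"
  define x where "x j = (if j = ?N then 1 else - (\<Sum>a\<in>{1..n}. A ?N a * Y a j))" for j
  define y where "y i = (if i = ?N then 1 else - (\<Sum>b\<in>{1..n}. Y i b * A b ?N))" for i
  define Y' where "Y' i j = (if i = ?N \<or> j = ?N then 0 else Y i j)" for i j
  define B where "B i j = Y' i j + y i * e * x j" for i j
  have split: "sum f {1..?N} = sum f {1..n} + f ?N" for f :: "nat \<Rightarrow> 'a"
    by simp
  have ran: "j \<in> {1..?N} \<longleftrightarrow> j = ?N \<or> j \<in> {1..n}" for j by auto
  have N: "k \<noteq> ?N" if "k \<in> {1..n}" for k using that by auto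
  have delta: "(\<Sum>k\<in>{1..n}. f k * (if k = j then 1 else 0)) = f j"
       "(\<Sum>k\<in>{1..n}. (if j = k then 1 else 0) * f k) = f j" if "j \<in> {1..n}" for f :: "nat \<Rightarrow> 'a" and j
    using that by (simp_all add: if_distrib[of "\<lambda>x. _ * x"] if_distrib[of "\<lambda>x. x * _"] cong: if_cong)
  have xA: "(\<Sum>i\<in>{1..?N}. x i * A i j) = (if j = ?N then d else 0)" if "j \<in> {1..?N}" for j
  proof -
    have "(\<Sum>i\<in>{1..?N}. x i * A i j) = A ?N j - (\<Sum>i\<in>{1..n}. \<Sum>a\<in>{1..n}. A ?N a * Y a i * A i j)"
      unfolding split by (simp add: x_def N sum_negf sum_distrib_right)
    also have "(\<Sum>i\<in>{1..n}. \<Sum>a\<in>{1..n}. A ?N a * Y a i * A i j) =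
        (\<Sum>a\<in>{1..n}. A ?N a * (\<Sum>i\<in>{1..n}. Y a i * A i j))"
      unfolding sum_distrib_left mult.assoc by (rule sum.swap)
    finally have *: "(\<Sum>i\<in>{1..?N}. x i * A i j) =
      A ?N j - (\<Sum>a\<in>{1..n}. A ?N a * (\<Sum>i\<in>{1..n}. Y a i * A i j))" .
    show ?thesis
    proof (cases "j = ?N")
      case True
      then show ?thesis unfolding * by (simp add: d sum_distrib_left mult.assoc)
    next
      case False
      then have j: "j \<in> {1..n}" using that by auto
      then show ?thesis unfolding * using False
        by (simp add: mat_inverseD(2)[OF Y _ j] delta(1)[OF j] del: atLeastAtMost_iff One_nat_def cong: sum.cong)
    qed
  qed
  have Ay: "(\<Sum>k\<in>{1..?N}. A i k * y k) = (if i = ?N then d else 0)" if "i \<in> {1..?N}" for i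
  proof -
    have "(\<Sum>k\<in>{1..?N}. A i k * y k) = A i ?N - (\<Sum>k\<in>{1..n}. \<Sum>b\<in>{1..n}. A i k * Y k b * A b ?N)"
      unfolding split by (simp add: y_def N sum_negf sum_distrib_left mult.assoc)
    also have "(\<Sum>k\<in>{1..n}. \<Sum>b\<in>{1..n}. A i k * Y k b * A b ?N) =
        (\<Sum>b\<in>{1..n}. (\<Sum>k\<in>{1..n}. A i k * Y k b) * A b ?N)"
      unfolding sum_distrib_right by (rule sum.swap)
    finally have *: "(\<Sum>k\<in>{1..?N}. A i k * y k) =
      A i ?N - (\<Sum>b\<in>{1..n}. (\<Sum>k\<in>{1..n}. A i k * Y k b) * A b ?N)" .
    show ?thesis
    proof (cases "i = ?N")
      case True
      have "(\<Sum>b\<in>{1..n}. (\<Sum>k\<in>{1..n}. A i k * Y k b) * A b ?N) =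
        (\<Sum>a\<in>{1..n}. \<Sum>b\<in>{1..n}. A ?N a * Y a b * A b ?N)"
        unfolding sum_distrib_right True by (rule sum.swap)
      then show ?thesis unfolding * using True by (simp add: d)
    next
      case False
      then have i: "i \<in> {1..n}" using that by auto
      then show ?thesis unfolding * using False
        by (simp add: mat_inverseD(1)[OF Y i] delta(2)[OF i] del: atLeastAtMost_iff One_nat_def cong: sum.cong)
    qed
  qed
  have AY: "(\<Sum>k\<in>{1..?N}. A i k * Y' k j) = (if j = ?N then 0 else if i = ?N then - x j else if i = j then 1 else 0)"
    if "i \<in> {1..?N}" "j \<in> {1..?N}" for i j
    using that unfolding split ran
    by (auto simp: Y'_def x_def N mat_inverseD(1)[OF Y] simp del: atLeastAtMost_iff One_nat_def)
  have YA: "(\<Sum>k\<in>{1..?N}. Y' i k * A k j) = (if i = ?N then 0 else if j = ?N then - y i else if i = j then 1 else 0)"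
    if "i \<in> {1..?N}" "j \<in> {1..?N}" for i j
    using that unfolding split ran
    by (auto simp: Y'_def y_def N mat_inverseD(2)[OF Y] simp del: atLeastAtMost_iff One_nat_def)
  have "mat_inverse ?N A B"
    unfolding mat_inverse_def
  proof (intro ballI conjI)
    fix i j assume ij: "i \<in> {1..?N}" "j \<in> {1..?N}"
    have "(\<Sum>k\<in>{1..?N}. A i k * B k j) =
        (\<Sum>k\<in>{1..?N}. A i k * Y' k j) + (\<Sum>k\<in>{1..?N}. A i k * y k) * (e * x j)"
      unfolding B_def by (simp only: distrib_left sum.distrib sum_distrib_right mult.assoc)
    also have "\<dots> = (if i = j then 1 else 0)"
      unfolding AY[OF ij] Ay[OF ij(1)] by (simp add: mult.assoc[symmetric] e x_def)
    finally show "(\<Sum>k\<in>{1..?N}. A i k * B k j) = (if i = j then 1 else 0)" .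
    have "(\<Sum>k\<in>{1..?N}. B i k * A k j) =
        (\<Sum>k\<in>{1..?N}. Y' i k * A k j) + (y i * e) * (\<Sum>k\<in>{1..?N}. x k * A k j)"
      unfolding B_def by (simp only: distrib_right sum.distrib sum_distrib_left mult.assoc)
    also have "\<dots> = (if i = j then 1 else 0)"
      unfolding YA[OF ij] xA[OF ij(2)] by (simp add: mult.assoc e y_def)
    finally show "(\<Sum>k\<in>{1..?N}. B i k * A k j) = (if i = j then 1 else 0)" .
  qed
  moreover have "B ?N ?N = e" by (simp add: B_def Y'_def x_def y_def)
  ultimately show ?thesis by blast
qed

lemma fps_unit:
  fixes f :: "'a::ring_1 fps"
  assumes "fps_nth f 0 * c = 1" "c * fps_nth f 0 = 1"
  shows "\<exists>g. f * g = 1 \<and> g * f = 1"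
proof -
  have l: "fps_left_inverse f c * f = 1" by (rule fps_left_inverse) fact
  have r: "f * fps_right_inverse f c = 1" by (rule fps_right_inverse) fact
  have "fps_left_inverse f c = fps_left_inverse f c * (f * fps_right_inverse f c)"
    by (simp only: r mult_1_right)
  also have "\<dots> = fps_right_inverse f c"
    by (simp only: mult.assoc[symmetric] l mult_1_left)
  finally show ?thesis using l r by auto
qed

text \<open>
  By triangularity every term subtracted in the Schur complement has zero constant coefficient.  The
  complement is therefore a unit, like the diagonal entry, and the matrix can be inverted one border
  at a time.
\<close>
lemma mat_inverse_triangular_const:
  fixes A :: "nat \<Rightarrow> nat \<Rightarrow> 'a::ring_1 fps"
  assumes tri: "(\<forall>i\<in>{1..n}. \<forall>j\<in>{1..n}. i < j \<longrightarrow> fps_nth (A i j) 0 = 0) \<or>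
                (\<forall>i\<in>{1..n}. \<forall>j\<in>{1..n}. j < i \<longrightarrow> fps_nth (A i j) 0 = 0)"
    and diag: "\<And>i. i \<in> {1..n} \<Longrightarrow> \<exists>c. fps_nth (A i i) 0 * c = 1 \<and> c * fps_nth (A i i) 0 = 1"
  shows "\<exists>B. mat_inverse n A B \<and> (n \<noteq> 0 \<longrightarrow> (\<exists>d. B n n * d = 1 \<and> d * B n n = 1))"
  using assms
proof (induction n)
  case 0
  then show ?case by (simp add: mat_inverse_def)
next
  case (Suc n)
  let ?N = "Suc n"
  have sub: "i \<in> {1..?N}" if "i \<in> {1..n}" for i using that by auto
  have "\<exists>B. mat_inverse n A B \<and> (n \<noteq> 0 \<longrightarrow> (\<exists>d. B n n * d = 1 \<and> d * B n n = 1))"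
  proof (rule Suc.IH)
    show "(\<forall>i\<in>{1..n}. \<forall>j\<in>{1..n}. i < j \<longrightarrow> fps_nth (A i j) 0 = 0) \<or>
          (\<forall>i\<in>{1..n}. \<forall>j\<in>{1..n}. j < i \<longrightarrow> fps_nth (A i j) 0 = 0)"
      using Suc.prems(1) sub by blast
  qed (use Suc.prems(2) sub in blast)
  then obtain Y where Y: "mat_inverse n A Y" by blast
  define d where "d = A ?N ?N - (\<Sum>a\<in>{1..n}. \<Sum>b\<in>{1..n}. A ?N a * Y a b * A b ?N)"
  have "fps_nth (A ?N a) 0 = 0 \<or> fps_nth (A b ?N) 0 = 0" if "a \<in> {1..n}" "b \<in> {1..n}" for a b
    using Suc.prems(1)
  proof
    assume h: "\<forall>i\<in>{1..?N}. \<forall>j\<in>{1..?N}. i < j \<longrightarrow> fps_nth (A i j) 0 = 0"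
    have "fps_nth (A b ?N) 0 = 0" using h[rule_format, of b ?N] that by simp
    then show ?thesis ..
  next
    assume h: "\<forall>i\<in>{1..?N}. \<forall>j\<in>{1..?N}. j < i \<longrightarrow> fps_nth (A i j) 0 = 0"
    have "fps_nth (A ?N a) 0 = 0" using h[rule_format, of ?N a] that by simp
    then show ?thesis ..
  qed
  note zero = this
  have "fps_nth (A ?N a * Y a b * A b ?N) 0 = 0" if "a \<in> {1..n}" "b \<in> {1..n}" for a b
    using zero[OF that] by (elim disjE) simp_all
  then have "fps_nth d 0 = fps_nth (A ?N ?N) 0"
    by (simp add: d_def fps_sum_nth)
  then obtain e where e: "d * e = 1" "e * d = 1"
    using fps_unit[of d] Suc.prems(2)[of ?N] by auto
  obtain B where "mat_inverse ?N A B" "B ?N ?N = e"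
    using mat_inverse_Suc[OF Y d_def e] by blast
  then show ?case using e by blast
qed

text \<open>
  The cocycle \<open>(p i + p k) * (p k + p j)\<close> of the graded matrix product is the coboundary of this sign, as
  \<open>smat_mult_twist_sign\<close> says.
\<close>
definition twist_sign :: "(nat \<Rightarrow> nat) \<Rightarrow> nat \<Rightarrow> nat \<Rightarrow> 'a::ring_1" where
  "twist_sign p i j = (- 1) ^ (p i * p j + p j)"

lemma twist_sign_cancel: "twist_sign p i j * (twist_sign p i j * x) = (x :: 'a::ring_1)"
  by (simp add: twist_sign_def minus_one_power_iff)

lemma twist_sign_diag [simp]: "twist_sign p i i = 1"
  by (simp add: twist_sign_def minus_one_power_iff)

lemma smat_mult_twist_sign:
  "smat_mult p n A B i j =
     twist_sign p i j * (\<Sum>k\<in>{1..n}. (twist_sign p i k * A i k) * (twist_sign p k j * B k j))"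
  unfolding smat_mult_def sum_distrib_left
proof (intro sum.cong refl)
  fix k
  show "(- 1) ^ ((p i + p k) * (p k + p j)) * A i k * B k j =
         twist_sign p i j * (twist_sign p i k * A i k * (twist_sign p k j * B k j))"
    by (cases "even (p i)"; cases "even (p j)"; cases "even (p k)")
       (simp_all add: twist_sign_def minus_one_power_iff)
qed

lemma smat_inv_eq:
  fixes A :: "nat \<Rightarrow> nat \<Rightarrow> 'a::ring_1"
  assumes B: "mat_inverse n (\<lambda>i j. twist_sign p i j * A i j) B"
  shows "smat_inv p n A = (\<lambda>i j. if i \<in> {1..n} \<and> j \<in> {1..n} then twist_sign p i j * B i j else 0)"
    (is "_ = ?C")
  unfolding smat_inv_def
proof (rule the_equality)
  have eq1: "twist_sign p i j * (if i = j then 1 else 0) = (if i = j then 1 else (0::'a))" for i j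
    by simp
  have "smat_mult p n A ?C i j = twist_sign p i j * (\<Sum>k\<in>{1..n}. (twist_sign p i k * A i k) * B k j)"
       "smat_mult p n ?C A i j = twist_sign p i j * (\<Sum>k\<in>{1..n}. B i k * (twist_sign p k j * A k j))"
    if "i \<in> {1..n}" "j \<in> {1..n}" for i j
    using that unfolding smat_mult_twist_sign
    by (auto simp: twist_sign_cancel simp del: atLeastAtMost_iff One_nat_def intro!: arg_cong[where f="\<lambda>x. _ * x"] sum.cong)
  then show "(\<forall>i j. i \<notin> {1..n} \<or> j \<notin> {1..n} \<longrightarrow> ?C i j = 0) \<and>
     (\<forall>i\<in>{1..n}. \<forall>j\<in>{1..n}. smat_mult p n A ?C i j = (if i = j then 1 else 0) \<and>
                           smat_mult p n ?C A i j = (if i = j then 1 else 0))"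
    by (simp add: mat_inverseD[OF B] eq1 del: atLeastAtMost_iff One_nat_def)
next
  fix D
  assume D: "(\<forall>i j. i \<notin> {1..n} \<or> j \<notin> {1..n} \<longrightarrow> D i j = 0) \<and>
     (\<forall>i\<in>{1..n}. \<forall>j\<in>{1..n}. smat_mult p n A D i j = (if i = j then 1 else 0) \<and>
                           smat_mult p n D A i j = (if i = j then 1 else 0))"
  have "mat_inverse n (\<lambda>i j. twist_sign p i j * A i j) (\<lambda>i j. twist_sign p i j * D i j)"
    unfolding mat_inverse_def
  proof (intro ballI)
    fix i j assume ij: "i \<in> {1..n}" "j \<in> {1..n}"
    have "twist_sign p i j * smat_mult p n A D i j = (if i = j then 1 else 0)"
         "twist_sign p i j * smat_mult p n D A i j = (if i = j then 1 else 0)"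
      using D ij by (simp_all del: atLeastAtMost_iff One_nat_def)
    then show "(\<Sum>k\<in>{1..n}. twist_sign p i k * A i k * (twist_sign p k j * D k j)) = (if i = j then 1 else 0) \<and>
      (\<Sum>k\<in>{1..n}. twist_sign p i k * D i k * (twist_sign p k j * A k j)) = (if i = j then 1 else 0)"
      unfolding smat_mult_twist_sign twist_sign_cancel by blast
  qed
  note u = mat_inverse_unique[OF B this]
  show "D = ?C"
  proof (intro ext)
    fix i j
    show "D i j = ?C i j"
    proof (cases "i \<in> {1..n} \<and> j \<in> {1..n}")
      case True
      then have "twist_sign p i j * (twist_sign p i j * D i j) = twist_sign p i j * B i j"
        using u[of i j] by simp
      with True show ?thesis unfolding twist_sign_cancel by simp
    next
      case False
      then show ?thesis using D by auto
    qed
  qed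
qed

lemma ring_inv_eq: "x * y = 1 \<Longrightarrow> y * x = 1 \<Longrightarrow> ring_inv x = y"
  unfolding ring_inv_def
  by (rule the_equality) (auto, metis mult.assoc mult.left_neutral mult.right_neutral)

lemma quasidet_eq:
  assumes "mat_inverse n (\<lambda>i j. twist_sign p i j * A i j) B" "n \<noteq> 0" "B n n * d = 1" "d * B n n = 1"
  shows "quasidet p n A n n = d"
  unfolding quasidet_def smat_inv_eq[OF assms(1)] using assms by (simp add: ring_inv_eq)


section \<open>Consequences of a graded RTT relation\<close>

lemma sum_if_eq:
  fixes f :: "nat \<Rightarrow> 'a::ring_1"
  assumes "b \<in> {1..n}"
  shows "(\<Sum>i\<in>{1..n}. f i * (if i = b then 1 else 0)) = f b"
    and "(\<Sum>i\<in>{1..n}. f i * (if b = i then 1 else 0)) = f b"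
    and "(\<Sum>i\<in>{1..n}. (if i = b then 1 else 0) * f i) = f b"
    and "(\<Sum>i\<in>{1..n}. (if b = i then 1 else 0) * f i) = f b"
    and "(\<Sum>i\<in>{1..n}. if i = b then f i else 0) = f b"
    and "(\<Sum>i\<in>{1..n}. if b = i then f i else 0) = f b"
  using assms by (simp_all add: if_distrib[of "\<lambda>x. _ * x"] if_distrib[of "\<lambda>x. x * _"] cong: if_cong)

text \<open>
  The passage from \<open>R T\<^sub>1 T'\<^sub>2 = T'\<^sub>2 T\<^sub>1 R\<close> to \<open>Y\<^sub>2 R T\<^sub>1 = T\<^sub>1 R Y\<^sub>2\<close>, where \<open>Y\<close> is the inverse of \<open>T'\<close>, in
  components.  Each of the four sums contains a product of \<open>T'\<close> and \<open>Y\<close> over a common index, which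
  collapses it.  This works since the coefficients on the left do not depend on \<open>l\<close>, and those on the
  right do not depend on \<open>k\<close>.
\<close>
lemma rtt_half_inverse:
  fixes A A' B B' :: "nat \<Rightarrow> nat \<Rightarrow> nat \<Rightarrow> 'a::ring_1"
  assumes cA: "\<And>i j k x. x * A i j k = A i j k * x" and cA': "\<And>i j k x. x * A' i j k = A' i j k * x"
    and cB: "\<And>i j k x. x * B i j k = B i j k * x" and cB': "\<And>i j k x. x * B' i j k = B' i j k * x"
    and rel: "\<And>k l. k \<in> {1..n} \<Longrightarrow> l \<in> {1..n} \<Longrightarrow>
      A i j k * (t i j * t' k l) + B i j k * (t k j * t' i l) =
      A' i j l * (t' k l * t i j) + B' i j l * (t' k j * t i l)"
    and Y: "mat_inverse n t' Y"
    and idx: "i \<in> {1..n}" "j \<in> {1..n}" "m \<in> {1..n}" "o' \<in> {1..n}"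
  shows "A i j o' * (Y m o' * t i j) + (if i = o' then \<Sum>k\<in>{1..n}. B i j k * (Y m k * t k j) else 0) =
         A' i j m * (t i j * Y m o') + (if j = m then \<Sum>l\<in>{1..n}. B' i j l * (t i l * Y l o') else 0)"
proof -
  have lA: "x * (A i j k * y) = A i j k * (x * y)" for k x y
    by (simp only: mult.assoc[symmetric] cA)
  have lA': "x * (A' i j k * y) = A' i j k * (x * y)" for k x y
    by (simp only: mult.assoc[symmetric] cA')
  have lB: "x * (B i j k * y) = B i j k * (x * y)" for k x y
    by (simp only: mult.assoc[symmetric] cB)
  have lB': "x * (B' i j k * y) = B' i j k * (x * y)" for k x y
    by (simp only: mult.assoc[symmetric] cB')
  have 1: "(\<Sum>k\<in>{1..n}. \<Sum>l\<in>{1..n}. Y m k * (A i j k * (t i j * t' k l)) * Y l o') = A i j o' * (Y m o' * t i j)"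
  proof -
    have "(\<Sum>k\<in>{1..n}. \<Sum>l\<in>{1..n}. Y m k * (A i j k * (t i j * t' k l)) * Y l o') =
          (\<Sum>k\<in>{1..n}. A i j k * (Y m k * t i j) * (\<Sum>l\<in>{1..n}. t' k l * Y l o'))"
      by (simp only: sum_distrib_left mult.assoc lA)
    also have "\<dots> = (\<Sum>k\<in>{1..n}. A i j k * (Y m k * t i j) * (if k = o' then 1 else 0))"
      by (intro sum.cong refl) (simp only: mat_inverseD(1)[OF Y _ idx(4)])
    finally show ?thesis by (simp only: sum_if_eq[OF idx(4)])
  qed
  have 2: "(\<Sum>k\<in>{1..n}. \<Sum>l\<in>{1..n}. Y m k * (B i j k * (t k j * t' i l)) * Y l o') =
       (if i = o' then \<Sum>k\<in>{1..n}. B i j k * (Y m k * t k j) else 0)"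
  proof -
    have "(\<Sum>k\<in>{1..n}. \<Sum>l\<in>{1..n}. Y m k * (B i j k * (t k j * t' i l)) * Y l o') =
          (\<Sum>k\<in>{1..n}. B i j k * (Y m k * t k j) * (\<Sum>l\<in>{1..n}. t' i l * Y l o'))"
      by (simp only: sum_distrib_left mult.assoc lB)
    then show ?thesis by (simp add: mat_inverseD(1)[OF Y idx(1,4)] del: atLeastAtMost_iff One_nat_def)
  qed
  have 3: "(\<Sum>k\<in>{1..n}. \<Sum>l\<in>{1..n}. Y m k * (A' i j l * (t' k l * t i j)) * Y l o') = A' i j m * (t i j * Y m o')"
  proof -
    have "(\<Sum>k\<in>{1..n}. \<Sum>l\<in>{1..n}. Y m k * (A' i j l * (t' k l * t i j)) * Y l o') =
          (\<Sum>l\<in>{1..n}. A' i j l * ((\<Sum>k\<in>{1..n}. Y m k * t' k l) * (t i j * Y l o')))"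
      by (subst sum.swap) (simp only: sum_distrib_left sum_distrib_right mult.assoc lA')
    also have "\<dots> = (\<Sum>l\<in>{1..n}. A' i j l * ((if m = l then 1 else 0) * (t i j * Y l o')))"
      by (intro sum.cong refl) (simp only: mat_inverseD(2)[OF Y idx(3)])
    also have "\<dots> = (\<Sum>l\<in>{1..n}. if m = l then A' i j l * (t i j * Y l o') else 0)"
      by (intro sum.cong refl) simp
    finally show ?thesis by (simp only: sum_if_eq[OF idx(3)])
  qed
  have 4: "(\<Sum>k\<in>{1..n}. \<Sum>l\<in>{1..n}. Y m k * (B' i j l * (t' k j * t i l)) * Y l o') =
       (if j = m then \<Sum>l\<in>{1..n}. B' i j l * (t i l * Y l o') else 0)"
  proof -
    have "(\<Sum>k\<in>{1..n}. \<Sum>l\<in>{1..n}. Y m k * (B' i j l * (t' k j * t i l)) * Y l o') =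
          (\<Sum>l\<in>{1..n}. B' i j l * ((\<Sum>k\<in>{1..n}. Y m k * t' k j) * (t i l * Y l o')))"
      by (subst sum.swap) (simp only: sum_distrib_left sum_distrib_right mult.assoc lB')
    then show ?thesis by (auto simp: mat_inverseD(2)[OF Y idx(3,2)] simp del: atLeastAtMost_iff One_nat_def)
  qed
  have "(\<Sum>k\<in>{1..n}. \<Sum>l\<in>{1..n}. Y m k * (A i j k * (t i j * t' k l) + B i j k * (t k j * t' i l)) * Y l o') =
     (\<Sum>k\<in>{1..n}. \<Sum>l\<in>{1..n}. Y m k * (A' i j l * (t' k l * t i j) + B' i j l * (t' k j * t i l)) * Y l o')"
    by (intro sum.cong refl arg_cong[where f = "\<lambda>x. _ * x * _"] rel)
  then show ?thesis
    by (simp only: distrib_left distrib_right sum.distrib 1 2 3 4)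
qed

text \<open>
  The relation \<open>R T\<^sub>1 T'\<^sub>2 = T'\<^sub>2 T\<^sub>1 R\<close> in components, for matrices already multiplied by \<open>twist_sign\<close>.
  The diagonal coefficients of \<open>R\<close> are \<open>r\<close>, and \<open>h\<close> are the other ones up to a sign; \<open>h i i\<close> is to be zero in
  the applications.  The signs are distributed so that those on the left do not involve \<open>l\<close>
  and those on the right do not involve \<open>k\<close>, as \<open>rtt_half_inverse\<close> requires.
\<close>
definition graded_rtt ::
  "(nat \<Rightarrow> nat) \<Rightarrow> nat \<Rightarrow> (nat \<Rightarrow> nat \<Rightarrow> 'a::ring_1) \<Rightarrow> (nat \<Rightarrow> nat \<Rightarrow> 'a) \<Rightarrow>
   (nat \<Rightarrow> nat \<Rightarrow> 'a) \<Rightarrow> (nat \<Rightarrow> nat \<Rightarrow> 'a) \<Rightarrow> bool" where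
  "graded_rtt p n r h t t' \<longleftrightarrow>
     (\<forall>i k x. x * r i k = r i k * x \<and> x * h i k = h i k * x) \<and>
     (\<forall>i\<in>{1..n}. \<forall>j\<in>{1..n}. \<forall>k\<in>{1..n}. \<forall>l\<in>{1..n}.
        (-1) ^ ((p i + p j) * p k) * r i k * (t i j * t' k l) +
        (-1) ^ (p i * p j) * h i k * (t k j * t' i l) =
        (-1) ^ ((p i + p j) * p l) * r j l * (t' k l * t i j) +
        (-1) ^ (p i * p j) * h l j * (t' k j * t i l))"

lemma sign_commute: "x * (-1) ^ k = (-1) ^ k * (x :: 'a::ring_1)"
  by (simp add: minus_one_power_iff)

lemma graded_rtt_central:
  assumes "graded_rtt p n r h t t'"
  shows "x * r i k = r i k * x" "x * h i k = h i k * x"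
    "x * ((-1) ^ e * r i k) = (-1) ^ e * r i k * x"
    "x * ((-1) ^ e * h i k) = (-1) ^ e * h i k * x"
proof -
  show *: "x * r i k = r i k * x" "x * h i k = h i k * x" for x i k
    using assms unfolding graded_rtt_def by blast+
  have "x * (s * y) = s * y * x" if "x * s = s * x" "x * y = y * x" for x y s :: 'a
    by (simp only: mult.assoc[symmetric] that(1)) (simp only: mult.assoc that(2))
  then show "x * ((-1) ^ e * r i k) = (-1) ^ e * r i k * x"
    "x * ((-1) ^ e * h i k) = (-1) ^ e * h i k * x"
    using sign_commute * by blast+
qed

lemma graded_rttD:
  assumes "graded_rtt p n r h t t'" "i \<in> {1..n}" "j \<in> {1..n}" "k \<in> {1..n}" "l \<in> {1..n}"
  shows "(-1) ^ ((p i + p j) * p k) * r i k * (t i j * t' k l) +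
        (-1) ^ (p i * p j) * h i k * (t k j * t' i l) =
        (-1) ^ ((p i + p j) * p l) * r j l * (t' k l * t i j) +
        (-1) ^ (p i * p j) * h l j * (t' k j * t i l)"
  using assms(1) unfolding graded_rtt_def
  by (elim conjE) (drule bspec[OF _ assms(2)], drule bspec[OF _ assms(3)],
      drule bspec[OF _ assms(4)], erule bspec[OF _ assms(5)])

lemma graded_rtt_mono:
  assumes "graded_rtt p n r h t t'" "m \<le> n"
  shows "graded_rtt p m r h t t'"
proof -
  have sub: "i \<in> {1..n}" if "i \<in> {1..m}" for i using that assms(2) by auto
  show ?thesis
    unfolding graded_rtt_def
    by (intro conjI ballI allI graded_rtt_central[OF assms(1)] graded_rttD[OF assms(1)] sub)
qed

lemma graded_rtt_half_inverse:
  assumes R: "graded_rtt p n r h t t'" and Y: "mat_inverse n t' Y"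
    and idx: "i \<in> {1..n}" "j \<in> {1..n}" "m \<in> {1..n}" "o' \<in> {1..n}"
  shows "(-1) ^ ((p i + p j) * p o') * r i o' * (Y m o' * t i j) +
           (if i = o' then \<Sum>k\<in>{1..n}. (-1) ^ (p i * p j) * h i k * (Y m k * t k j) else 0) =
         (-1) ^ ((p i + p j) * p m) * r j m * (t i j * Y m o') +
           (if j = m then \<Sum>l\<in>{1..n}. (-1) ^ (p i * p j) * h l j * (t i l * Y l o') else 0)"
  by (rule rtt_half_inverse[where A = "\<lambda>i j k. (-1) ^ ((p i + p j) * p k) * r i k"
        and A' = "\<lambda>i j l. (-1) ^ ((p i + p j) * p l) * r j l"
        and B = "\<lambda>i j k. (-1) ^ (p i * p j) * h i k"
        and B' = "\<lambda>i j l. (-1) ^ (p i * p j) * h l j", OF _ _ _ _ _ Y idx])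
     (rule graded_rtt_central[OF R] graded_rttD[OF R idx(1,2)]; assumption?)+

text \<open>
  In the component of \<open>Y\<^sub>2 R T\<^sub>1 = T\<^sub>1 R Y\<^sub>2\<close> that involves \<open>Y n n\<close> and \<open>t i j\<close>, the off-diagonal terms of \<open>R\<close>
  are absent as neither \<open>i\<close> nor \<open>j\<close> equals \<open>n\<close>.
\<close>
lemma graded_rtt_corner_commute:
  assumes R: "graded_rtt p n r h t t'" and Y: "mat_inverse n t' Y"
    and ij: "i \<in> {1..n}" "j \<in> {1..n}" "i \<noteq> n" "j \<noteq> n"
    and c: "r i n = c" "r j n = c" "e * c = 1"
  shows "Y n n * t i j = t i j * Y n n"
proof -
  have n: "n \<in> {1..n}" using ij by auto
  define s where "s = (-1 :: 'a) ^ ((p i + p j) * p n)"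
  have ss: "s * (s * x) = x" for x by (simp add: s_def minus_one_power_iff)
  have "s * c * (Y n n * t i j) = s * c * (t i j * Y n n)"
    using graded_rtt_half_inverse[OF R Y ij(1,2) n n] ij(3,4) c by (simp add: s_def)
  then have "e * (s * (s * c * (Y n n * t i j))) = e * (s * (s * c * (t i j * Y n n)))" by simp
  then show ?thesis
    by (simp only: mult.assoc ss) (simp only: mult.assoc[symmetric] c mult_1_left)
qed

text \<open>
  Multiplying \<open>Y\<^sub>2 R T\<^sub>1 = T\<^sub>1 R Y\<^sub>2\<close> by the inverse \<open>P\<close> of \<open>T\<close> on both sides gives \<open>R Y\<^sub>2 P\<^sub>1 = P\<^sub>1 Y\<^sub>2 R\<close>.
  For odd indices \<open>m\<close> and \<open>o'\<close> the signs of the diagonal terms reduce to one common sign for given \<open>i\<close> and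
  \<open>j\<close>, and the off-diagonal terms have the opposite sign.
\<close>
lemma graded_rtt_inverse_odd:
  assumes R: "graded_rtt p n r h t t'" and P: "mat_inverse n t P" and Y: "mat_inverse n t' Y"
    and idx: "a \<in> {1..n}" "b \<in> {1..n}" "m \<in> {1..n}" "o' \<in> {1..n}"
    and odd: "odd (p m)" "odd (p o')"
  shows "r b o' * (P a b * Y m o') - h o' b * (P a o' * Y m b) =
         r a m * (Y m o' * P a b) - h a m * (Y a o' * P m b)"
proof -
  note cen = graded_rtt_central[OF R]
  have lr: "x * (r i k * y) = r i k * (x * y)" for i k x y
    by (simp only: mult.assoc[symmetric] cen)
  have lh: "x * (h i k * y) = h i k * (x * y)" for i k x y
    by (simp only: mult.assoc[symmetric] cen)
  have H: "r i o' * (Y m o' * t i j) - (if i = o' then \<Sum>k\<in>{1..n}. h i k * (Y m k * t k j) else 0) =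
           r j m * (t i j * Y m o') - (if j = m then \<Sum>l\<in>{1..n}. h l j * (t i l * Y l o') else 0)"
    if ij: "i \<in> {1..n}" "j \<in> {1..n}" for i j
  proof -
    define s where "s = (-1 :: 'a) ^ (p i + p j)"
    have ss: "s * (s * x) = x" for x by (simp add: s_def minus_one_power_iff)
    have s1: "(-1 :: 'a) ^ ((p i + p j) * p o') = s" "(-1 :: 'a) ^ ((p i + p j) * p m) = s"
      using odd by (simp_all add: s_def minus_one_power_iff)
    have s2: "odd (p i) \<Longrightarrow> (-1 :: 'a) ^ (p i * p j) = - s"
      "odd (p j) \<Longrightarrow> (-1 :: 'a) ^ (p i * p j) = - s"
      by (simp_all add: s_def minus_one_power_iff)
    have "s * (r i o' * (Y m o' * t i j) - (if i = o' then \<Sum>k\<in>{1..n}. h i k * (Y m k * t k j) else 0)) =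
      s * r i o' * (Y m o' * t i j) +
           (if i = o' then \<Sum>k\<in>{1..n}. (-1) ^ (p i * p j) * h i k * (Y m k * t k j) else 0)"
      using s2(1) odd by (cases "i = o'")
        (simp_all add: right_diff_distrib sum_distrib_left mult.assoc sum_negf)
    also have "\<dots> = s * r j m * (t i j * Y m o') +
           (if j = m then \<Sum>l\<in>{1..n}. (-1) ^ (p i * p j) * h l j * (t i l * Y l o') else 0)"
      using graded_rtt_half_inverse[OF R Y ij idx(3,4)] unfolding s1 .
    also have "\<dots> = s * (r j m * (t i j * Y m o') - (if j = m then \<Sum>l\<in>{1..n}. h l j * (t i l * Y l o') else 0))"
      using s2(2) odd by (cases "j = m")
        (simp_all add: right_diff_distrib sum_distrib_left mult.assoc sum_negf)
    finally have "s * (s * (r i o' * (Y m o' * t i j) - (if i = o' then \<Sum>k\<in>{1..n}. h i k * (Y m k * t k j) else 0))) =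
      s * (s * (r j m * (t i j * Y m o') - (if j = m then \<Sum>l\<in>{1..n}. h l j * (t i l * Y l o') else 0)))"
      by (rule arg_cong)
    then show ?thesis unfolding ss .
  qed
  have 1: "(\<Sum>i\<in>{1..n}. \<Sum>j\<in>{1..n}. P a i * (r i o' * (Y m o' * t i j)) * P j b) = r b o' * (P a b * Y m o')"
  proof -
    have "(\<Sum>i\<in>{1..n}. \<Sum>j\<in>{1..n}. P a i * (r i o' * (Y m o' * t i j)) * P j b) =
       (\<Sum>i\<in>{1..n}. r i o' * (P a i * Y m o') * (\<Sum>j\<in>{1..n}. t i j * P j b))"
      by (simp only: sum_distrib_left mult.assoc lr)
    also have "\<dots> = (\<Sum>i\<in>{1..n}. r i o' * (P a i * Y m o') * (if i = b then 1 else 0))"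
      by (intro sum.cong refl) (simp only: mat_inverseD(1)[OF P _ idx(2)])
    finally show ?thesis by (simp only: sum_if_eq[OF idx(2)])
  qed
  have 2: "(\<Sum>i\<in>{1..n}. \<Sum>j\<in>{1..n}. P a i * (if i = o' then \<Sum>k\<in>{1..n}. h i k * (Y m k * t k j) else 0) * P j b) =
     h o' b * (P a o' * Y m b)"
  proof -
    have "(\<Sum>i\<in>{1..n}. \<Sum>j\<in>{1..n}. P a i * (if i = o' then \<Sum>k\<in>{1..n}. h i k * (Y m k * t k j) else 0) * P j b) =
      (\<Sum>i\<in>{1..n}. if i = o' then \<Sum>j\<in>{1..n}. P a i * (\<Sum>k\<in>{1..n}. h i k * (Y m k * t k j)) * P j b else 0)"
      by (intro sum.cong refl) simp
    also have "\<dots> = (\<Sum>j\<in>{1..n}. \<Sum>k\<in>{1..n}. h o' k * (P a o' * (Y m k * (t k j * P j b))))"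
      by (simp only: sum_if_eq[OF idx(4)] sum_distrib_left sum_distrib_right mult.assoc lh)
    also have "\<dots> = (\<Sum>k\<in>{1..n}. h o' k * (P a o' * Y m k) * (\<Sum>j\<in>{1..n}. t k j * P j b))"
      by (subst sum.swap) (simp only: sum_distrib_left mult.assoc)
    also have "\<dots> = (\<Sum>k\<in>{1..n}. h o' k * (P a o' * Y m k) * (if k = b then 1 else 0))"
      by (intro sum.cong refl) (simp only: mat_inverseD(1)[OF P _ idx(2)])
    finally show ?thesis by (simp only: sum_if_eq[OF idx(2)])
  qed
  have 3: "(\<Sum>i\<in>{1..n}. \<Sum>j\<in>{1..n}. P a i * (r j m * (t i j * Y m o')) * P j b) = r a m * (Y m o' * P a b)"
  proof -
    have "(\<Sum>i\<in>{1..n}. \<Sum>j\<in>{1..n}. P a i * (r j m * (t i j * Y m o')) * P j b) =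
       (\<Sum>j\<in>{1..n}. r j m * ((\<Sum>i\<in>{1..n}. P a i * t i j) * (Y m o' * P j b)))"
      by (subst sum.swap) (simp only: sum_distrib_left sum_distrib_right mult.assoc lr)
    also have "\<dots> = (\<Sum>j\<in>{1..n}. r j m * ((if a = j then 1 else 0) * (Y m o' * P j b)))"
      by (intro sum.cong refl) (simp only: mat_inverseD(2)[OF P idx(1)])
    also have "\<dots> = (\<Sum>j\<in>{1..n}. if a = j then r j m * (Y m o' * P j b) else 0)"
      by (intro sum.cong refl) simp
    finally show ?thesis by (simp only: sum_if_eq[OF idx(1)])
  qed
  have 4: "(\<Sum>i\<in>{1..n}. \<Sum>j\<in>{1..n}. P a i * (if j = m then \<Sum>l\<in>{1..n}. h l j * (t i l * Y l o') else 0) * P j b) =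
     h a m * (Y a o' * P m b)"
  proof -
    have "(\<Sum>i\<in>{1..n}. \<Sum>j\<in>{1..n}. P a i * (if j = m then \<Sum>l\<in>{1..n}. h l j * (t i l * Y l o') else 0) * P j b) =
      (\<Sum>j\<in>{1..n}. if j = m then \<Sum>i\<in>{1..n}. P a i * (\<Sum>l\<in>{1..n}. h l j * (t i l * Y l o')) * P j b else 0)"
      by (subst sum.swap) (intro sum.cong refl, simp)
    also have "\<dots> = (\<Sum>i\<in>{1..n}. \<Sum>l\<in>{1..n}. h l m * (P a i * (t i l * (Y l o' * P m b))))"
      by (simp only: sum_if_eq[OF idx(3)] sum_distrib_left sum_distrib_right mult.assoc lh)
    also have "\<dots> = (\<Sum>l\<in>{1..n}. h l m * ((\<Sum>i\<in>{1..n}. P a i * t i l) * (Y l o' * P m b)))"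
      by (subst sum.swap) (simp only: sum_distrib_left sum_distrib_right mult.assoc)
    also have "\<dots> = (\<Sum>l\<in>{1..n}. h l m * ((if a = l then 1 else 0) * (Y l o' * P m b)))"
      by (intro sum.cong refl) (simp only: mat_inverseD(2)[OF P idx(1)])
    also have "\<dots> = (\<Sum>l\<in>{1..n}. if a = l then h l m * (Y l o' * P m b) else 0)"
      by (intro sum.cong refl) simp
    finally show ?thesis by (simp only: sum_if_eq[OF idx(1)])
  qed
  have "(\<Sum>i\<in>{1..n}. \<Sum>j\<in>{1..n}. P a i * (r i o' * (Y m o' * t i j) -
        (if i = o' then \<Sum>k\<in>{1..n}. h i k * (Y m k * t k j) else 0)) * P j b) =
     (\<Sum>i\<in>{1..n}. \<Sum>j\<in>{1..n}. P a i * (r j m * (t i j * Y m o') -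
        (if j = m then \<Sum>l\<in>{1..n}. h l j * (t i l * Y l o') else 0)) * P j b)"
    by (intro sum.cong refl arg_cong[where f = "\<lambda>x. _ * x * _"] H)
  then show ?thesis
    by (simp only: right_diff_distrib left_diff_distrib sum_subtractf 1 2 3 4)
qed

lemma q_exchange_even:
  assumes R: "graded_rtt p n r h t t'" and I: "I \<subseteq> {1..n}" and even: "\<And>i. i \<in> I \<Longrightarrow> even (p i)"
    and r: "\<And>i k. i \<in> I \<Longrightarrow> k \<in> I \<Longrightarrow> r i k = (if i = k then 0 else c)"
    and h: "\<And>i k. i \<in> I \<Longrightarrow> k \<in> I \<Longrightarrow> h i k = (if i = k then 0 else c * (if i < k then v else w))"
    and c: "e * c = 1"
  shows "q_exchange v w I t t'"
  unfolding q_exchange_def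
proof (intro ballI impI)
  fix a b j l assume I': "a \<in> I" "b \<in> I" "j \<in> I" "l \<in> I" and ab: "a < b"
  then have n: "a \<in> {1..n}" "b \<in> {1..n}" "j \<in> {1..n}" "l \<in> {1..n}" using I by auto
  have "(-1) ^ ((p a + p j) * p b) * r a b * (t a j * t' b l) +
        (-1) ^ (p a * p j) * h a b * (t b j * t' a l) =
        (-1) ^ ((p a + p j) * p l) * r j l * (t' b l * t a j) +
        (-1) ^ (p a * p j) * h l j * (t' b j * t a l)"
    by (rule graded_rttD[OF R n(1,3,2,4)])
  then have "c * (t a j * t' b l + v * (t b j * t' a l)) =
     c * (if j = l then 0 else t' b l * t a j + (if l < j then v else w) * (t' b j * t a l))"
    using I' ab even by (auto simp: r h minus_one_power_iff distrib_left mult.assoc)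
  then have "e * (c * (t a j * t' b l + v * (t b j * t' a l))) =
     e * (c * (if j = l then 0 else t' b l * t a j + (if l < j then v else w) * (t' b j * t a l)))"
    by (rule arg_cong)
  then show "t a j * t' b l + v * (t b j * t' a l) =
     (if j = l then 0 else t' b l * t a j + (if l < j then v else w) * (t' b j * t a l))"
    by (simp only: mult.assoc[symmetric] c mult_1_left)
qed

text \<open>
  Inversion reverses the order of the factors, and so rows and columns change their roles: the exchange
  relation holds for the transposed odd block.
\<close>
lemma q_exchange_odd:
  assumes R: "graded_rtt p n r h t t'" and P: "mat_inverse n t P" and Y: "mat_inverse n t' Y"
    and I: "\<And>i. i \<in> I \<Longrightarrow> M + i \<in> {1..n}" and odd: "\<And>i. i \<in> I \<Longrightarrow> odd (p (M + i))"
    and r: "\<And>i k. i \<in> I \<Longrightarrow> k \<in> I \<Longrightarrow> r (M + i) (M + k) = (if i = k then 0 else c)"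
    and h: "\<And>i k. i \<in> I \<Longrightarrow> k \<in> I \<Longrightarrow>
      h (M + i) (M + k) = (if i = k then 0 else - (c * (if i < k then w else v)))"
    and c: "e * c = 1"
  shows "q_exchange v w I (\<lambda>i j. P (M + j) (M + i)) (\<lambda>i j. Y (M + j) (M + i))"
  unfolding q_exchange_def
proof (intro ballI impI)
  fix a b j l assume I': "a \<in> I" "b \<in> I" "j \<in> I" "l \<in> I" and ab: "a < b"
  note n = I'[THEN I]
  let ?P = "\<lambda>i j. P (M + j) (M + i)" and ?Y = "\<lambda>i j. Y (M + j) (M + i)"
  have "c * (?P a j * ?Y b l + v * (?P b j * ?Y a l)) =
     c * (if j = l then 0 else ?Y b l * ?P a j + (if l < j then v else w) * (?Y b j * ?P a l))"
    using graded_rtt_inverse_odd[OF R P Y n(3) n(1) n(4) n(2) odd odd, OF I'(4) I'(2)] I' ab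
    by (auto simp: r h distrib_left mult.assoc)
  then have "e * (c * (?P a j * ?Y b l + v * (?P b j * ?Y a l))) =
     e * (c * (if j = l then 0 else ?Y b l * ?P a j + (if l < j then v else w) * (?Y b j * ?P a l)))"
    by (rule arg_cong)
  then show "?P a j * ?Y b l + v * (?P b j * ?Y a l) =
     (if j = l then 0 else ?Y b l * ?P a j + (if l < j then v else w) * (?Y b j * ?P a l))"
    by (simp only: mult.assoc[symmetric] c mult_1_left)
qed


section \<open>The parameter q and the scalar factor of the R-matrix\<close>

lemma qq_neq_0 [simp]: "qq \<noteq> 0"
  by (simp add: qq_def Zero_fract_def eq_fract)

lemma qq_power: "qq ^ n = Fract (monom 1 n) 1"
proof (induction n)
  case 0
  then show ?case by (simp add: One_fract_def)
next
  case (Suc n)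
  then show ?case by (simp add: qq_def monom_Suc)
qed

lemma qq_power_eq_1_iff: "qq ^ n = 1 \<longleftrightarrow> n = 0"
proof
  assume "qq ^ n = 1"
  then have "monom 1 n = (1 :: complex poly)"
    by (simp add: qq_power One_fract_def eq_fract)
  then have "degree (monom (1::complex) n) = 0" by simp
  then show "n = 0" by (simp add: degree_monom_eq)
qed simp

lemma qq_powi_eq_1_iff: "qq powi n = 1 \<longleftrightarrow> n = 0"
proof (cases "n \<ge> 0")
  case True
  then show ?thesis by (auto simp: power_int_def qq_power_eq_1_iff)
next
  case False
  then show ?thesis by (auto simp: power_int_def qq_power_eq_1_iff power_inverse)
qed

lemma qq_powi_inj: "qq powi m = qq powi n \<longleftrightarrow> m = n"
proof
  assume "qq powi m = qq powi n"
  then have "qq powi (m - n) = 1"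
    by (simp add: power_int_diff qq_neq_0)
  then show "m = n" by (simp add: qq_powi_eq_1_iff)
qed simp

text \<open>
  The functional equation \<open>f(x u\<^sup>-\<^sup>1) = f(x) c(x)\<close> for a series in \<open>x\<^sup>-\<^sup>1\<close>, solved for its coefficients.
\<close>
fun dilation_coeff :: "'a::field \<Rightarrow> (nat \<Rightarrow> 'a) \<Rightarrow> nat \<Rightarrow> 'a" where
  "dilation_coeff u c k =
     (if k = 0 then 1 else (\<Sum>i<k. dilation_coeff u c i * c (k - i)) / (u ^ k - 1))"

declare dilation_coeff.simps [simp del]

lemma dilation_equation_unique_solution:
  fixes c :: "'a::field fps"
  assumes u: "\<And>k. k > 0 \<Longrightarrow> u ^ k \<noteq> 1" and c: "fps_nth c 0 = 1"
  shows "\<exists>!f. fps_nth f 0 = 1 \<and> Abs_fps (\<lambda>k. u ^ k * fps_nth f k) = f * c"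
proof -
  have eq: "Abs_fps (\<lambda>k. u ^ k * fps_nth f k) = f * c \<longleftrightarrow>
      (\<forall>k>0. fps_nth f k * (u ^ k - 1) = (\<Sum>i<k. fps_nth f i * fps_nth c (k - i)))" for f
  proof -
    have "fps_nth (f * c) k = (\<Sum>i<k. fps_nth f i * fps_nth c (k - i)) + fps_nth f k" for k
    proof -
      have "{0..k} = insert k {..<k}" by auto
      then show ?thesis by (simp add: fps_mult_nth c)
    qed
    then have "Abs_fps (\<lambda>k. u ^ k * fps_nth f k) = f * c \<longleftrightarrow>
      (\<forall>k. fps_nth f k * (u ^ k - 1) = (\<Sum>i<k. fps_nth f i * fps_nth c (k - i)))"
      by (auto simp: fps_eq_iff algebra_simps)
    also have "\<dots> \<longleftrightarrow> (\<forall>k>0. fps_nth f k * (u ^ k - 1) = (\<Sum>i<k. fps_nth f i * fps_nth c (k - i)))"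
    proof -
      have "fps_nth f 0 * (u ^ 0 - 1) = (\<Sum>i<0. fps_nth f i * fps_nth c (0 - i))" by simp
      then show ?thesis by (intro iffI allI impI) (simp, rename_tac k, case_tac "k = 0", simp_all)
    qed
    finally show ?thesis .
  qed
  show ?thesis
  proof (rule ex1I)
    show "fps_nth (Abs_fps (dilation_coeff u (fps_nth c))) 0 = 1 \<and>
      Abs_fps (\<lambda>k. u ^ k * fps_nth (Abs_fps (dilation_coeff u (fps_nth c))) k) =
      Abs_fps (dilation_coeff u (fps_nth c)) * c"
      unfolding eq
    proof (intro conjI allI impI)
      fix k :: nat assume "k > 0"
      then show "fps_nth (Abs_fps (dilation_coeff u (fps_nth c))) k * (u ^ k - 1) =
        (\<Sum>i<k. fps_nth (Abs_fps (dilation_coeff u (fps_nth c))) i * fps_nth c (k - i))"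
        using u[of k] by (subst (1) fps_nth_Abs_fps, subst dilation_coeff.simps) simp
    qed (simp add: dilation_coeff.simps)
  next
    fix f assume f: "fps_nth f 0 = 1 \<and> Abs_fps (\<lambda>k. u ^ k * fps_nth f k) = f * c"
    have "fps_nth f k = dilation_coeff u (fps_nth c) k" for k
    proof (induction k rule: less_induct)
      case (less k)
      show ?case
      proof (cases "k = 0")
        case True
        then show ?thesis using f by (simp add: dilation_coeff.simps)
      next
        case False
        then have "fps_nth f k * (u ^ k - 1) = (\<Sum>i<k. fps_nth f i * fps_nth c (k - i))"
          using f unfolding eq by simp
        also have "\<dots> = (\<Sum>i<k. dilation_coeff u (fps_nth c) i * fps_nth c (k - i))"
          using less by (intro sum.cong) auto
        finally show ?thesis
          using False u[of k] by (subst dilation_coeff.simps) (simp add: field_simps)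
      qed
    qed
    then show "f = Abs_fps (dilation_coeff u (fps_nth c))"
      by (simp add: fps_eq_iff)
  qed
qed

lemma fls_X_inv_times_X: "fls_X_inv * fls_X = (1 :: 'a::semiring_1 fls)"
  by (simp add: fls_X_inv_times_conv_shift)

text \<open>
  In the variable \<open>x\<^sup>-\<^sup>1\<close> the rational function of the functional equation has the constant coefficient
  \<open>q\<^sup>-\<^sup>2 q\<^sup>a\<^sup>+\<^sup>2 q\<^sup>-\<^sup>a = 1\<close>, and \<open>q\<^sup>a\<close> is not a root of unity because \<open>a = 2N - 2M\<close> is nonzero.
\<close>
lemma f_series_nth_0:
  assumes "M \<noteq> N"
  shows "fps_nth (f_series M N) 0 = 1"
proof -
  define a where "a = 2 * int N - 2 * int M"
  define u where "u = qq powi (- a)"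
  define c1 c2 c3 where "c1 = qq powi (-2)" and "c2 = qq powi (a + 2)" and "c3 = qq powi a"
  define C where "C = (fps_X - fps_const c1) * (fps_X - fps_const c2) * inverse ((fps_X - 1) * (fps_X - fps_const c3))"
  have u_pow: "u ^ k = qq powi (- (a * int k))" for k
    by (simp add: u_def power_int_power')
  have u1: "u ^ k \<noteq> 1" if "k > 0" for k
    using that assms by (simp add: u_pow qq_powi_eq_1_iff a_def)
  have c0: "c3 \<noteq> 0" by (simp add: c3_def)
  have "c1 * c2 = c3" by (simp add: c1_def c2_def c3_def flip: power_int_add)
  then have C0: "fps_nth C 0 = 1"
    using c0 by (simp add: C_def)
  have x: "1 - fls_X_inv * fls_const c = fls_X_inv * (fls_X - fls_const c)" for c :: cq
    by (simp add: right_diff_distrib fls_X_inv_times_X)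
  have x0: "(fls_X_inv :: cq fls) \<noteq> 0" by simp
  have quot: "((1 - fls_X_inv * fls_const c1) * (1 - fls_X_inv * fls_const c2)) /
      ((1 - fls_X_inv) * (1 - fls_X_inv * fls_const c3)) = fps_to_fls C"
  proof -
    let ?D = "(fps_X - 1) * (fps_X - fps_const c3) :: cq fps"
    have D0: "fps_nth ?D 0 \<noteq> 0" using c0 by simp
    then have "?D \<noteq> 0" by (metis fps_zero_nth)
    then have nz: "fps_to_fls ?D \<noteq> 0" by simp
    have "C * ?D = (fps_X - fps_const c1) * (fps_X - fps_const c2)"
      unfolding C_def using inverse_mult_eq_1[OF D0] by (simp add: mult.assoc)
    then have "fps_to_fls C * fps_to_fls ?D = fps_to_fls ((fps_X - fps_const c1) * (fps_X - fps_const c2))"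
      by (simp only: fls_times_fps_to_fls[symmetric])
    then have "fps_to_fls C * fps_to_fls ?D = (fls_X - fls_const c1) * (fls_X - fls_const c2)"
      by (simp only: fls_times_fps_to_fls fps_to_fls_minus fps_X_to_fls fps_const_to_fls)
    then have C: "fps_to_fls C = ((fls_X - fls_const c1) * (fls_X - fls_const c2)) / fps_to_fls ?D"
      using nz by (simp add: field_simps)
    have one: "1 - fls_X_inv = fls_X_inv * (fls_X - (1 :: cq fls))"
      using x[of 1] by simp
    have D: "fps_to_fls ?D = (fls_X - 1) * (fls_X - fls_const c3)"
      by (simp add: fls_times_fps_to_fls)
    show ?thesis
      unfolding C x one D by (simp add: mult_ac)
  qed
  have "\<exists>!f. fps_nth f 0 = 1 \<and>
     (let a = 2 * int N - 2 * int M; x = fls_X_inv in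
        fps_to_fls (Abs_fps (\<lambda>k. qq powi (- (a * int k)) * fps_nth f k)) =
        fps_to_fls f *
          (((1 - x * fls_const (qq powi (- 2))) * (1 - x * fls_const (qq powi (a + 2)))) /
           ((1 - x) * (1 - x * fls_const (qq powi a)))))"
    using dilation_equation_unique_solution[OF u1 C0]
    unfolding Let_def a_def[symmetric] c1_def[symmetric] c2_def[symmetric] c3_def[symmetric] quot
      u_pow fls_times_fps_to_fls[symmetric] fps_to_fls_eq_iff .
  from theI'[OF this] show ?thesis unfolding f_series_def by blast
qed

text \<open>
  \<open>R(x, 1) = x R_lead + R_const\<close>.
\<close>
definition R_lead :: "nat \<Rightarrow> cq tens2" where
  "R_lead M i j k l =
     (if i = j \<and> k = l then (if i = k then q_at M i else 1)
      else if k = j \<and> l = i then (if i < j then q_at M j - inverse (q_at M j) else 0)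
      else 0)"

definition R_const :: "nat \<Rightarrow> cq tens2" where
  "R_const M i j k l =
     (if i = j \<and> k = l then (if i = k then - inverse (q_at M i) else - 1)
      else if k = j \<and> l = i then (if i < j then 0 else q_at M j - inverse (q_at M j))
      else 0)"

text \<open>
  \<open>h\<close> consists of the coefficients of \<open>f(x) x / (x q - q\<^sup>-\<^sup>1)\<close>, a series in \<open>x\<^sup>-\<^sup>1\<close> with constant
  coefficient \<open>q\<^sup>-\<^sup>1\<close>.
\<close>
lemma R_coeff_factor:
  assumes "M \<noteq> N"
  shows "\<exists>h :: nat \<Rightarrow> cq. h 0 \<noteq> 0 \<and> (\<forall>m i j k l. R_coeff M N m i j k l =
     h m * R_lead M i j k l + (if m = 0 then 0 else h (m - 1) * R_const M i j k l))"
proof -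
  define D where "D = fps_const qq - fps_const (inverse qq) * fps_X"
  define h where "h = f_series M N * inverse D"
  have D0: "fps_nth D 0 \<noteq> 0" by (simp add: D_def qq_neq_0)
  then have "D \<noteq> 0" by (metis fps_zero_nth)
  then have nz: "fps_to_fls D \<noteq> 0" by simp
  have hD: "h * D = f_series M N"
    unfolding h_def using inverse_mult_eq_1[OF D0] by (simp add: mult.assoc)
  have den: "fls_X_inv * fls_const qq - fls_const (inverse qq) = fls_X_inv * fps_to_fls D"
    by (simp add: D_def fls_times_fps_to_fls right_diff_distrib mult.left_commute[of fls_X_inv] fls_X_inv_times_X)
  have num: "R_zw M fls_X_inv 1 i j k l =
      fls_X_inv * fps_to_fls (fps_const (R_lead M i j k l) + fps_X * fps_const (R_const M i j k l))" for i j k l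
  proof -
    have "fls_X_inv * fps_to_fls (fps_const a + fps_X * fps_const b) = fls_X_inv * fls_const a + fls_const b" for a b :: cq
      by (simp add: fls_times_fps_to_fls distrib_left mult.assoc[symmetric] fls_X_inv_times_X)
    note eq = this
    show ?thesis
      unfolding eq R_zw_def R_lead_def R_const_def
      by (simp only: fls_const_uminus fls_const_0 fls_const_1 mult_1_right mult_1_left mult_zero_right add_0_right
          add_0_left diff_conv_add_uminus split: if_split) blast
  qed
  have "R_x M N i j k l = fps_to_fls (h * (fps_const (R_lead M i j k l) + fps_X * fps_const (R_const M i j k l)))" for i j k l
  proof -
    have "R_x M N i j k l = fps_to_fls h * fps_to_fls D * (fps_to_fls (fps_const (R_lead M i j k l) + fps_X * fps_const (R_const M i j k l)) / fps_to_fls D)"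
      unfolding R_x_def R_bar_def num den hD[symmetric] fls_times_fps_to_fls by simp
    then show ?thesis using nz by (simp add: fls_times_fps_to_fls)
  qed
  then have "R_coeff M N m i j k l =
     fps_nth h m * R_lead M i j k l + (if m = 0 then 0 else fps_nth h (m - 1) * R_const M i j k l)" for m i j k l
    by (simp add: R_coeff_def distrib_left mult.assoc[symmetric])
  moreover have "fps_nth h 0 \<noteq> 0"
    using D0 by (simp add: h_def f_series_nth_0[OF assms])
  ultimately show ?thesis by (intro exI[of _ "fps_nth h"]) simp
qed


section \<open>Components of the defining relations\<close>

abbreviation uq :: "free_alg \<Rightarrow> ('m::len0, 'n::len0) uq_gl" where "uq \<equiv> abs_uq_gl"

lemma uq_add: "uq (x + y) = uq x + uq y" by (rule plus_uq_gl.abs_eq[symmetric])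
lemma uq_mult: "uq (x * y) = uq x * uq y" by (rule times_uq_gl.abs_eq[symmetric])
lemma uq_uminus: "uq (- x) = - uq x" by (rule uminus_uq_gl.abs_eq[symmetric])
lemma uq_0: "uq 0 = 0" by (rule zero_uq_gl.abs_eq[symmetric])
lemma uq_1: "uq 1 = 1" by (rule one_uq_gl.abs_eq[symmetric])
lemma uq_fscal: "uq (fscal c) = uscal c" by (rule uscal.abs_eq[symmetric])
lemma uq_gen: "uq (gen (Lgen s i j r)) = lgen s i j r" by (rule lgen.abs_eq[symmetric])
lemma uq_power: "uq (x ^ k) = uq x ^ k"
  by (induction k) (simp_all add: uq_1 uq_mult)
lemma uq_sum: "uq (sum f A) = (\<Sum>x\<in>A. uq (f x))"
  by (induction A rule: infinite_finite_induct) (simp_all add: uq_0 uq_add)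

lemma uq_rels_eq:
  assumes "(x, y) \<in> uq_rels LENGTH('m) LENGTH('n)"
  shows "(uq x :: ('m::len0, 'n::len0) uq_gl) = uq y"
  using assms by (auto simp: uq_gl.abs_eq_iff uq_rel_def uq_ideal_def intro: ideal_gen.base)

lemma fscal_add: "fscal (c + d) = fscal c + fscal d"
  by (simp add: fscal_def single_add)

lemma fscal_mult: "fscal (c * d) = fscal c * fscal d"
  by (simp add: fscal_def mult_single)

lemma fscal_commute: "p * fscal c = fscal c * p"
proof -
  have *: "(\<Sum>w\<in>Poly_Mapping.keys p. Poly_Mapping.single w (Poly_Mapping.lookup p w)) = p"
    by (rule poly_mapping_eqI) (auto simp: lookup_sum lookup_single when_def in_keys_iff)
  have "(\<Sum>w\<in>Poly_Mapping.keys p. Poly_Mapping.single w (Poly_Mapping.lookup p w)) * fscal c =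
    fscal c * (\<Sum>w\<in>Poly_Mapping.keys p. Poly_Mapping.single w (Poly_Mapping.lookup p w))"
    unfolding sum_distrib_left sum_distrib_right
    by (intro sum.cong refl) (simp add: fscal_def mult_single mult.commute)
  then show ?thesis unfolding * .
qed

lemma uscal_add: "uscal (c + d) = uscal c + uscal d"
  by (simp only: uq_fscal[symmetric] fscal_add uq_add)

lemma uscal_mult: "uscal (c * d) = uscal c * uscal d"
  by (simp only: uq_fscal[symmetric] fscal_mult uq_mult)

lemma uscal_0 [simp]: "uscal 0 = 0"
  using uscal_add[of 0 0] by simp

lemma uscal_1 [simp]: "uscal 1 = 1"
  by (simp only: uq_fscal[symmetric] fscal_def single_one uq_1)

lemma uscal_uminus: "uscal (- c) = - uscal c"
  using uscal_add[of c "- c"] by (simp add: eq_neg_iff_add_eq_0 add.commute)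

lemma uscal_diff: "uscal (c - d) = uscal c - uscal d"
  using uscal_add[of c "- d"] by (simp add: uscal_uminus)

lemma uscal_commute: "x * uscal c = uscal c * x"
  by (induction x rule: uq_gl.abs_induct) (simp only: uq_fscal[symmetric] uq_mult[symmetric] fscal_commute)

lemma uscal_left_commute: "x * (uscal c * y) = uscal c * (x * y)"
  by (simp only: mult.assoc[symmetric] uscal_commute)

lemma uscal_cancel: "c \<noteq> 0 \<Longrightarrow> uscal c * x = 0 \<Longrightarrow> x = 0"
proof -
  assume c: "c \<noteq> 0" and "uscal c * x = 0"
  then have "uscal (inverse c) * (uscal c * x) = 0" by simp
  then show "x = 0" using c by (simp add: mult.assoc[symmetric] uscal_mult[symmetric])
qed

text \<open>
  The conservation law of the six-vertex model: only the terms \<open>E\<^sub>i\<^sub>i \<otimes> E\<^sub>k\<^sub>k\<close> and \<open>E\<^sub>i\<^sub>k \<otimes> E\<^sub>k\<^sub>i\<close> occur.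
\<close>
definition ice_rule :: "cq tens2 \<Rightarrow> bool" where
  "ice_rule Q \<longleftrightarrow> (\<forall>i j k l. Q i j k l \<noteq> 0 \<longrightarrow> i = j \<and> k = l \<or> k = j \<and> l = i)"

text \<open>
  The component \<open>E\<^sub>i\<^sub>j \<otimes> E\<^sub>k\<^sub>l\<close> of \<open>Q X\<^sub>1 Y\<^sub>2 - Y\<^sub>2 X\<^sub>1 Q\<close>, for a tensor \<open>Q\<close> subject to the ice rule.
\<close>
definition rll_comp ::
  "(nat \<Rightarrow> nat) \<Rightarrow> cq tens2 \<Rightarrow> (nat \<Rightarrow> nat \<Rightarrow> ('m::len0, 'n::len0) uq_gl) \<Rightarrow> (nat \<Rightarrow> nat \<Rightarrow> ('m, 'n) uq_gl) \<Rightarrow>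
    ('m, 'n) uq_gl tens2" where
  "rll_comp p Q X Y i j k l =
     uscal (Q i i k k) * ((- 1) ^ ((p i + p j) * (p k + p l)) * (X i j * Y k l)) +
     (if i = k then 0 else uscal (Q i k k i) *
        ((- 1) ^ ((p i + p k) * (p k + p j) + (p k + p j) * (p i + p l)) * (X k j * Y i l))) -
     (uscal (Q j j l l) * (Y k l * X i j) +
      (if j = l then 0 else uscal (Q l j j l) *
        ((- 1) ^ ((p k + p j) * (p l + p j)) * (Y k j * X i l))))"

lemma sum_two:
  assumes "finite A" "x \<in> A" "y \<in> A" "\<And>a. a \<in> A \<Longrightarrow> a \<noteq> x \<Longrightarrow> a \<noteq> y \<Longrightarrow> f a = (0::'a::comm_monoid_add)"
  shows "sum f A = (if x = y then f x else f x + f y)"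
proof -
  have "sum f A = sum f {x, y}"
    by (rule sum.mono_neutral_right) (use assms in auto)
  then show ?thesis by auto
qed

lemma double_sign: "(- 1 :: 'a::ring_1) ^ ((a + a + b + b) * c + (b + b) * d) = 1"
  and swap_sign: "(- 1 :: 'a) ^ ((a + b + b + a) * c + (b + a) * d) = (- 1) ^ ((a + b) * d)"
  and double_sign': "(- 1 :: 'a) ^ (c * (a + a + b + b) + d * (a + a)) = 1"
  and swap_sign': "(- 1 :: 'a) ^ (c * (b + a + a + b) + d * (b + a)) = (- 1) ^ (d * (b + a))"
  by (cases "even a"; cases "even b"; simp add: minus_one_power_iff)+

lemma tmul_left_ice_rule:
  fixes X Y :: "'a::ring_1 tens2"
  assumes X: "\<And>a b. X i a k b \<noteq> 0 \<Longrightarrow> i = a \<and> k = b \<or> k = a \<and> b = i"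
    and ik: "i \<in> {1..M+N}" "k \<in> {1..M+N}"
  shows "tmul M N X Y i j k l = X i i k k * Y i j k l +
    (if i = k then 0 else (- 1) ^ ((par M i + par M k) * (par M k + par M j)) * X i k k i * Y k j i l)"
proof -
  let ?f = "\<lambda>(a, b). (- 1) ^ ((par M i + par M a + par M k + par M b) * (par M a + par M j + par M b + par M l) + (par M k + par M b) * (par M a + par M j))
        * X i a k b * Y a j b l"
  have "tmul M N X Y i j k l = sum ?f ({1..M+N} \<times> {1..M+N})"
    unfolding tmul_def Let_def sum.cartesian_product ..
  also have "\<dots> = (if (i, k) = (k, i) then ?f (i, k) else ?f (i, k) + ?f (k, i))"
  proof (rule sum_two)
    fix x assume x: "x \<noteq> (i, k)" "x \<noteq> (k, i)"
    obtain a b where ab: "x = (a, b)" by (cases x)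
    have "X i a k b = 0" using X[of a b] x ab by auto
    then show "?f x = 0" by (simp add: ab)
  qed (use ik in auto)
  also have "?f (i, k) = X i i k k * Y i j k l"
    unfolding prod.case double_sign mult_1_left ..
  also have "?f (k, i) = (- 1) ^ ((par M i + par M k) * (par M k + par M j)) * X i k k i * Y k j i l"
    unfolding prod.case swap_sign ..
  finally show ?thesis
    by (cases "i = k") (simp_all only: prod.inject if_True if_False simp_thms add_0_right)
qed

lemma tmul_right_ice_rule:
  fixes X Y :: "'a::ring_1 tens2"
  assumes Y: "\<And>a b. Y a j b l \<noteq> 0 \<Longrightarrow> a = j \<and> b = l \<or> b = j \<and> a = l"
    and jl: "j \<in> {1..M+N}" "l \<in> {1..M+N}"
  shows "tmul M N X Y i j k l = X i j k l * Y j j l l +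
    (if j = l then 0 else (- 1) ^ ((par M k + par M j) * (par M l + par M j)) * X i l k j * Y l j j l)"
proof -
  let ?f = "\<lambda>(a, b). (- 1) ^ ((par M i + par M a + par M k + par M b) * (par M a + par M j + par M b + par M l) + (par M k + par M b) * (par M a + par M j))
        * X i a k b * Y a j b l"
  have "tmul M N X Y i j k l = sum ?f ({1..M+N} \<times> {1..M+N})"
    unfolding tmul_def Let_def sum.cartesian_product ..
  also have "\<dots> = (if (j, l) = (l, j) then ?f (j, l) else ?f (j, l) + ?f (l, j))"
  proof (rule sum_two)
    fix x assume x: "x \<noteq> (j, l)" "x \<noteq> (l, j)"
    obtain a b where ab: "x = (a, b)" by (cases x)
    have "Y a j b l = 0" using Y[of a b] x ab by auto
    then show "?f x = 0" by (simp add: ab)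
  qed (use jl in auto)
  also have "?f (j, l) = X i j k l * Y j j l l"
    unfolding prod.case double_sign' mult_1_left ..
  also have "?f (l, j) = (- 1) ^ ((par M k + par M j) * (par M l + par M j)) * X i l k j * Y l j j l"
    unfolding prod.case swap_sign' ..
  finally show ?thesis
    by (cases "j = l") (simp_all only: prod.inject if_True if_False simp_thms add_0_right)
qed

lemma tmul_L2:
  assumes "j \<in> {1..M+N}"
  shows "tmul M N Z (L2 s r) i j k l =
    (\<Sum>b\<in>{1..M+N}. (- 1) ^ ((par M i + par M j + par M k + par M b) * (par M b + par M l)) * Z i j k b * gen (Lgen s b l r))"
proof -
  have "tmul M N Z (L2 s r) i j k l = (\<Sum>a\<in>{1..M+N}. if a = j then
     (\<Sum>b\<in>{1..M+N}. (- 1) ^ ((par M i + par M j + par M k + par M b) * (par M b + par M l)) * Z i j k b * gen (Lgen s b l r)) else 0)"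
    unfolding tmul_def Let_def
    by (intro sum.cong refl) (auto simp: L2_def minus_one_power_iff)
  then show ?thesis using assms by simp
qed

lemma tmul_L2_L1:
  assumes "i \<in> {1..M+N}" "b \<in> {1..M+N}"
  shows "tmul M N (L2 s' r') (L1 s r) i a k b = gen (Lgen s' k b r') * gen (Lgen s i a r)"
proof -
  have "tmul M N (L2 s' r') (L1 s r) i a k b =
     (\<Sum>c\<in>{1..M+N}. \<Sum>d\<in>{1..M+N}. if d = b then if c = i then gen (Lgen s' k b r') * gen (Lgen s i a r) else 0 else 0)"
    unfolding tmul_def Let_def
    by (intro sum.cong refl) (auto simp: L1_def L2_def minus_one_power_iff)
  then show ?thesis using assms by (simp only: sum.delta finite_atLeastAtMost if_True)
qed

lemma rll_comp_eq:
  assumes Q: "ice_rule Q" and idx: "i \<in> {1..M+N}" "j \<in> {1..M+N}" "k \<in> {1..M+N}" "l \<in> {1..M+N}"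
    and R: "\<And>i j k l. R i j k l = fscal (Q i j k l)"
  shows "uq (tmul M N (tmul M N R (L1 s r)) (L2 s r') i j k l) -
         uq (tmul M N (tmul M N (L2 s r') (L1 s r)) R i j k l) =
         rll_comp (par M) Q (\<lambda>i j. lgen s i j r) (\<lambda>i j. lgen s i j r') i j k l"
proof -
  have supp: "i = a \<and> k = b \<or> k = a \<and> b = i" if "R i a k b \<noteq> 0" for i a k b
    using Q that unfolding ice_rule_def R by (metis fscal_def single_zero)
  have neg: "uq ((-1) ^ e * x) = (-1) ^ e * uq x" for e x
    by (simp add: uq_mult uq_power uq_uminus uq_1)
  have left: "tmul M N (tmul M N R (L1 s r)) (L2 s r') i j k l =
     R i i k k * ((- 1) ^ ((par M i + par M j) * (par M k + par M l)) * (gen (Lgen s i j r) * gen (Lgen s k l r'))) +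
     (if i = k then 0 else
        R i k k i * ((- 1) ^ ((par M i + par M k) * (par M k + par M j) + (par M k + par M j) * (par M i + par M l)) *
          (gen (Lgen s k j r) * gen (Lgen s i l r'))))"
  proof -
    let ?f = "\<lambda>b. (- 1) ^ ((par M i + par M j + par M k + par M b) * (par M b + par M l)) * tmul M N R (L1 s r) i j k b * gen (Lgen s b l r')"
    have Z: "tmul M N R (L1 s r) i j k b = R i i k k * (if k = b then gen (Lgen s i j r) else 0) +
      (if i = k then 0 else (- 1) ^ ((par M i + par M k) * (par M k + par M j)) * R i k k i * (if i = b then gen (Lgen s k j r) else 0))" for b
      by (subst tmul_left_ice_rule[OF supp idx(1,3)]) (assumption, simp add: L1_def)
    have Zk: "tmul M N R (L1 s r) i j k k = R i i k k * gen (Lgen s i j r)"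
      unfolding Z by simp
    have Zi: "tmul M N R (L1 s r) i j k i =
        (- 1) ^ ((par M i + par M k) * (par M k + par M j)) * R i k k i * gen (Lgen s k j r)" if "i \<noteq> k"
      unfolding Z using that by simp
    have Rc: "(- 1) ^ e * (R a b c d * x) = R a b c d * ((- 1) ^ e * x)" for e a b c d x
      by (cases "even e") (simp_all add: minus_one_power_iff)
    have sk: "(- 1 :: free_alg) ^ ((a + b + c + c) * d) = (- 1) ^ ((a + b) * d)"
      and si: "(- 1 :: free_alg) ^ ((a + b + c + a) * d) = (- 1) ^ ((c + b) * d)" for a b c d :: nat
      by (cases "even a"; cases "even c"; simp add: minus_one_power_iff)+
    have sswap: "(- 1 :: free_alg) ^ a * ((- 1) ^ b * x) = (- 1) ^ b * ((- 1) ^ a * x)" for a b x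
      by (simp add: minus_one_power_iff)
    have fk: "?f k = R i i k k * ((- 1) ^ ((par M i + par M j) * (par M k + par M l)) * (gen (Lgen s i j r) * gen (Lgen s k l r')))"
      unfolding Zk sk mult.assoc Rc ..
    have fi: "?f i = R i k k i * ((- 1) ^ ((par M i + par M k) * (par M k + par M j) + (par M k + par M j) * (par M i + par M l)) *
          (gen (Lgen s k j r) * gen (Lgen s i l r')))" if "i \<noteq> k"
      unfolding Zi[OF that] si mult.assoc Rc power_add
      by (rule arg_cong[where f = "\<lambda>x. R i k k i * x"]) (rule sswap)
    have "tmul M N (tmul M N R (L1 s r)) (L2 s r') i j k l = sum ?f {1..M+N}"
      by (rule tmul_L2[OF idx(2)])
    also have "\<dots> = (if k = i then ?f k else ?f k + ?f i)"
      by (rule sum_two) (use idx in \<open>auto simp: Z\<close>)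
    also have "\<dots> = R i i k k * ((- 1) ^ ((par M i + par M j) * (par M k + par M l)) * (gen (Lgen s i j r) * gen (Lgen s k l r'))) +
     (if i = k then 0 else
        R i k k i * ((- 1) ^ ((par M i + par M k) * (par M k + par M j) + (par M k + par M j) * (par M i + par M l)) *
          (gen (Lgen s k j r) * gen (Lgen s i l r'))))"
    proof (cases "i = k")
      case True
      then show ?thesis using fk by (simp only: if_True add_0_right simp_thms)
    next
      case False
      then show ?thesis unfolding fk fi[OF False] using not_sym[OF False] by (simp only: if_False)
    qed
    finally show ?thesis .
  qed
  have right: "tmul M N (tmul M N (L2 s r') (L1 s r)) R i j k l =
     R j j l l * (gen (Lgen s k l r') * gen (Lgen s i j r)) +
     (if j = l then 0 else R l j j l *
        ((- 1) ^ ((par M k + par M j) * (par M l + par M j)) * (gen (Lgen s k j r') * gen (Lgen s i l r))))"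
  proof -
    have Rc: "x * R a b c d = R a b c d * x" for a b c d x
      by (simp add: R fscal_commute)
    have "tmul M N (tmul M N (L2 s r') (L1 s r)) R i j k l =
      tmul M N (L2 s r') (L1 s r) i j k l * R j j l l +
      (if j = l then 0 else (- 1) ^ ((par M k + par M j) * (par M l + par M j)) *
         tmul M N (L2 s r') (L1 s r) i l k j * R l j j l)"
      by (rule tmul_right_ice_rule) (use supp idx in blast)+
    then show ?thesis
      unfolding tmul_L2_L1[OF idx(1,4)] tmul_L2_L1[OF idx(1,2)] Rc by (simp add: mult.assoc)
  qed
  show ?thesis
    unfolding left right rll_comp_def R uq_add
    by (simp add: uq_0 uq_mult[of "fscal _"] uq_fscal neg uq_mult[of "gen _"] uq_gen
          if_distrib[of uq] cong: if_cong)
qed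

lemma rll_comp_linear:
  "rll_comp p (\<lambda>i j k l. c * Q i j k l + d * Q' i j k l) X Y i j k l =
   uscal c * rll_comp p Q X Y i j k l + uscal d * rll_comp p Q' X Y i j k l"
  by (simp add: rll_comp_def uscal_add uscal_mult algebra_simps)


section \<open>Removing the scalar factor\<close>

text \<open>
  With zero at negative modes, the finite sums over \<open>zw_idx\<close> can be extended to intervals that do not depend
  on the summands.
\<close>
definition lgen_int :: "pm \<Rightarrow> int \<Rightarrow> nat \<Rightarrow> nat \<Rightarrow> ('m::len0, 'n::len0) uq_gl" where
  "lgen_int s r i j = (if r < 0 then 0 else lgen s i j (nat r))"

lemma rll_comp_lgen_int_0:
  assumes "r < 0 \<or> r' < 0"
  shows "rll_comp p Q (lgen_int s r) (lgen_int s r') i j k l = 0"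
  using assms by (auto simp: rll_comp_def lgen_int_def)

lemma ice_rule_R_coeff: "ice_rule (R_coeff M N m)"
proof -
  have "R_coeff M N m i j k l = 0" if "\<not> (i = j \<and> k = l \<or> k = j \<and> l = i)" for i j k l
  proof -
    have "R_zw M fls_X_inv 1 i j k l = 0"
      using that unfolding R_zw_def by (simp only: de_Morgan_disj if_False)
    then show ?thesis by (simp add: R_coeff_def R_x_def R_bar_def)
  qed
  then show ?thesis unfolding ice_rule_def by blast
qed

lemma zw_idx_same:
  assumes "nat (max (- a) b) \<le> K"
  shows "zw_idx s s a b = (\<lambda>m. (m, nat (zexp s * (a + int m)), nat (zexp s * (b - int m)))) `
     {m \<in> {..K}. 0 \<le> zexp s * (a + int m) \<and> 0 \<le> zexp s * (b - int m)}"
proof (cases s)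
  case Plus
  show ?thesis
    unfolding zw_idx_def Plus zexp_def using assms by (auto simp: image_iff)
next
  case Minus
  show ?thesis
    unfolding zw_idx_def Minus zexp_def using assms by (auto simp: image_iff)
qed

context
  fixes s :: pm and i j k l :: nat
  assumes idx: "i \<in> {1..LENGTH('m::len0) + LENGTH('n::len0)}" "j \<in> {1..LENGTH('m) + LENGTH('n)}"
    "k \<in> {1..LENGTH('m) + LENGTH('n)}" "l \<in> {1..LENGTH('m) + LENGTH('n)}"
begin

text \<open>
  One mode of \<open>Q L\<^sub>1 L\<^sub>2 - L\<^sub>2 L\<^sub>1 Q\<close> in the fixed component.
\<close>
definition rll_coeff :: "cq tens2 \<Rightarrow> int \<Rightarrow> int \<Rightarrow> ('m, 'n) uq_gl" where
  "rll_coeff Q r r' = rll_comp (par LENGTH('m)) Q (lgen_int s r) (lgen_int s r') i j k l"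

lemma rll_coefficient_sum:
  assumes K: "nat (max (- a) b) \<le> K"
  shows "(\<Sum>m\<le>K. rll_coeff (R_coeff LENGTH('m) LENGTH('n) m) (zexp s * (a + int m)) (zexp s * (b - int m))) = 0"
proof -
  let ?M = "LENGTH('m)" and ?N = "LENGTH('n)"
  let ?F = "\<lambda>(m, r, r'). rll_comp (par ?M) (R_coeff ?M ?N m) (\<lambda>i j. lgen s i j r) (\<lambda>i j. lgen s i j r') i j k l :: ('m, 'n) uq_gl"
  let ?g = "\<lambda>m. (m, nat (zexp s * (a + int m)), nat (zexp s * (b - int m)))"
  let ?A = "{m \<in> {..K}. 0 \<le> zexp s * (a + int m) \<and> 0 \<le> zexp s * (b - int m)}"
  have "(uq (RLL ?M ?N s s 1 a b i j k l) :: ('m, 'n) uq_gl) = uq (LLR ?M ?N s s 1 a b i j k l)"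
    by (rule uq_rels_eq) (rule uq_rels.RLL_same[OF idx])
  then have "0 = (uq (RLL ?M ?N s s 1 a b i j k l) :: ('m, 'n) uq_gl) - uq (LLR ?M ?N s s 1 a b i j k l)"
    by simp
  also have "\<dots> = (\<Sum>x\<in>zw_idx s s a b. ?F x)"
    unfolding RLL_def LLR_def uq_sum sum_subtractf[symmetric]
  proof (intro sum.cong refl)
    fix x assume "x \<in> zw_idx s s a b"
    obtain m r r' where x: "x = (m, r, r')" by (cases x)
    have "uq (tmul ?M ?N (tmul ?M ?N (R_tw ?M ?N 1 m) (L1 s r)) (L2 s r') i j k l) -
         uq (tmul ?M ?N (tmul ?M ?N (L2 s r') (L1 s r)) (R_tw ?M ?N 1 m) i j k l) = ?F (m, r, r')"
      unfolding prod.case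
      by (rule rll_comp_eq[OF ice_rule_R_coeff idx]) (simp add: R_tw_def)
    then show "uq (case x of (m, r, r') \<Rightarrow> tmul ?M ?N (tmul ?M ?N (R_tw ?M ?N 1 m) (L1 s r)) (L2 s r') i j k l) -
         uq (case x of (m, r, r') \<Rightarrow> tmul ?M ?N (tmul ?M ?N (L2 s r') (L1 s r)) (R_tw ?M ?N 1 m) i j k l) = ?F x"
      unfolding x prod.case .
  qed
  also have "\<dots> = sum (\<lambda>m. ?F (?g m)) ?A"
    unfolding zw_idx_same[OF K] by (rule sum.reindex_cong[of ?g]) (auto intro: inj_onI)
  also have "\<dots> = (\<Sum>m\<in>?A. rll_coeff (R_coeff ?M ?N m) (zexp s * (a + int m)) (zexp s * (b - int m)))"
    by (intro sum.cong refl) (auto simp: rll_coeff_def lgen_int_def[abs_def] not_less[symmetric])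
  also have "\<dots> = (\<Sum>m\<le>K. rll_coeff (R_coeff ?M ?N m) (zexp s * (a + int m)) (zexp s * (b - int m)))"
    by (rule sum.mono_neutral_left) (auto simp: rll_coeff_def not_le intro!: rll_comp_lgen_int_0)
  finally show ?thesis by simp
qed

text \<open>
  The coefficient of \<open>z\<^sup>a\<^sup>+\<^sup>1 w\<^sup>b\<close> in the difference of the two sides of the RTT relation with the
  polynomial R-matrix \<open>R(z, w)\<close>.
\<close>
definition rll_defect :: "int \<Rightarrow> int \<Rightarrow> ('m, 'n) uq_gl" where
  "rll_defect a b = rll_coeff (R_lead LENGTH('m)) (zexp s * a) (zexp s * b) +
            rll_coeff (R_const LENGTH('m)) (zexp s * (a + 1)) (zexp s * (b - 1))"

text \<open>
  The given relations say \<open>\<Sum>\<^sub>m h\<^sub>m defect(a + m, b - m) = 0\<close> with the series \<open>h\<close> of \<open>R_coeff_factor\<close>.  As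
  \<open>m\<close> grows, one of the modes becomes negative and the defect vanishes.  So the defects vanish by
  induction on the number \<open>max (- a) b\<close>, which bounds the length of the sum for both signs, because \<open>h\<^sub>0\<close> is
  invertible.
\<close>
lemma rll_defect_eq_0:
  assumes "LENGTH('m) \<noteq> LENGTH('n)"
  shows "rll_defect a b = 0"
proof -
  obtain h :: "nat \<Rightarrow> cq" where h0: "h 0 \<noteq> 0" and
    hR: "\<forall>m i j k l. R_coeff LENGTH('m) LENGTH('n) m i j k l =
     h m * R_lead LENGTH('m) i j k l + (if m = 0 then 0 else h (m - 1) * R_const LENGTH('m) i j k l)"
    using R_coeff_factor[OF assms] by blast
  have h: "R_coeff LENGTH('m) LENGTH('n) m i j k l =
     h m * R_lead LENGTH('m) i j k l + (if m = 0 then 0 else h (m - 1)) * R_const LENGTH('m) i j k l" for m i j k l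
    unfolding hR[rule_format] by simp
  have neg: "rll_coeff Q (zexp s * a) (zexp s * b) = 0" if "max (- a) b < 0" for Q a b
    unfolding rll_coeff_def by (rule rll_comp_lgen_int_0) (use that in \<open>cases s; auto simp: zexp_def\<close>)
  have rll_coeff: "rll_coeff (R_coeff LENGTH('m) LENGTH('n) m) r r' = uscal (h m) * rll_coeff (R_lead LENGTH('m)) r r' +
      uscal (if m = 0 then 0 else h (m - 1)) * rll_coeff (R_const LENGTH('m)) r r'" for m r r'
    unfolding rll_coeff_def rll_comp_linear[symmetric] by (rule arg_cong[where f = "\<lambda>Q. rll_comp _ Q _ _ _ _ _ _"]) (intro ext h)
  have sum0: "(\<Sum>m\<le>K. uscal (h m) * rll_defect (a + int m) (b - int m)) = 0" if K: "nat (max (- a) b) \<le> K" for K a b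
  proof -
    define B where "B m = rll_coeff (R_const LENGTH('m)) (zexp s * (a + int m)) (zexp s * (b - int m))" for m
    have shift: "(\<Sum>m\<le>K. uscal (if m = 0 then 0 else h (m - 1)) * B m) + uscal (h K) * B (Suc K) =
      (\<Sum>m\<le>K. uscal (h m) * B (Suc m))" for K
      by (induction K) (simp_all add: algebra_simps)
    \<comment> \<open>the boundary term of the index shift is beyond the last nonzero mode\<close>
    have "B (Suc K) = 0"
      unfolding B_def by (rule neg) (use K in auto)
    have "(\<Sum>m\<le>K. uscal (h m) * rll_defect (a + int m) (b - int m)) =
      (\<Sum>m\<le>K. uscal (h m) * rll_coeff (R_lead LENGTH('m)) (zexp s * (a + int m)) (zexp s * (b - int m))) +
      (\<Sum>m\<le>K. uscal (h m) * B (Suc m))"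
      unfolding rll_defect_def B_def sum.distrib[symmetric] distrib_left
      by (intro sum.cong refl) (simp add: algebra_simps)
    also have "\<dots> = (\<Sum>m\<le>K. rll_coeff (R_coeff LENGTH('m) LENGTH('n) m) (zexp s * (a + int m)) (zexp s * (b - int m)))"
      unfolding shift[symmetric] unfolding \<open>B (Suc K) = 0\<close> rll_coeff sum.distrib
      unfolding B_def by simp
    also have "\<dots> = 0" by (rule rll_coefficient_sum[OF K])
    finally show ?thesis .
  qed
  have "max (- a) b < int K \<Longrightarrow> rll_defect a b = 0" for K a b
  proof (induction K arbitrary: a b)
    case 0
    then show ?case unfolding rll_defect_def by (subst (1 2) neg) auto
  next
    case (Suc K)
    have "rll_defect (a + int m) (b - int m) = 0" if "m \<noteq> 0" for m
      by (rule Suc.IH) (use that Suc.prems in auto)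
    then have "(\<Sum>m\<le>K. uscal (h m) * rll_defect (a + int m) (b - int m)) =
      (\<Sum>m\<le>K. if m = 0 then uscal (h 0) * rll_defect a b else 0)"
      by (intro sum.cong refl) auto
    then have "uscal (h 0) * rll_defect a b = 0"
      using sum0[of a b K] Suc.prems by simp
    then show ?case by (rule uscal_cancel[OF h0])
  qed
  from this[of a b "nat (max (- a) b + 1)"] show ?thesis by linarith
qed

lemma sum_int_window:
  fixes F :: "int \<Rightarrow> 'b::comm_monoid_add"
  assumes "finite J" "{- int n..int n} \<subseteq> J"
    and "\<And>a. zexp s * a < 0 \<or> int n < zexp s * a \<Longrightarrow> F a = 0"
  shows "sum F J = (\<Sum>r=0..n. F (zexp s * int r))"
proof -
  have ss: "zexp s * zexp s = 1" "zexp s = 1 \<or> zexp s = -1" by (cases s; simp add: zexp_def)+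
  have "(\<Sum>r=0..n. F (zexp s * int r)) = sum F ((\<lambda>r. zexp s * int r) ` {0..n})"
    using ss(2) by (subst sum.reindex) (auto intro!: inj_onI)
  also have "\<dots> = sum F J"
  proof (rule sum.mono_neutral_left[OF assms(1)])
    show "(\<lambda>r. zexp s * int r) ` {0..n} \<subseteq> J"
      using assms(2) ss(2) by (auto simp: subset_iff)
    show "\<forall>a\<in>J - (\<lambda>r. zexp s * int r) ` {0..n}. F a = 0"
    proof
      fix a assume a: "a \<in> J - (\<lambda>r. zexp s * int r) ` {0..n}"
      show "F a = 0"
      proof (rule ccontr)
        assume "F a \<noteq> 0"
        then have "0 \<le> zexp s * a" "zexp s * a \<le> int n" using assms(3)[of a] by force+
        moreover have "a = zexp s * int (nat (zexp s * a))"
          using calculation(1) ss(1) by (simp add: mult.assoc[symmetric])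
        ultimately have "a \<in> (\<lambda>r. zexp s * int r) ` {0..n}"
          by (intro image_eqI[of _ _ "nat (zexp s * a)"]) auto
        with a show False by simp
      qed
    qed
  qed
  finally show ?thesis by simp
qed

text \<open>
  Substituting \<open>z \<alpha>\<close> and \<open>z \<beta>\<close> for \<open>z\<close> and \<open>w\<close> and dividing by \<open>z\<close>: the left side is the coefficient of degree \<open>n\<close>.
  The substitution is legitimate since both series run in the same direction, so that each degree
  receives finitely many terms.
\<close>
lemma rll_coeff_weighted_sum:
  assumes MN: "LENGTH('m) \<noteq> LENGTH('n)" and nz: "\<alpha> \<noteq> 0" "\<beta> \<noteq> 0"
  shows "(\<Sum>r=0..n. uscal (\<alpha> powi (zexp s * int r) * \<beta> powi (zexp s * int (n - r))) *
     rll_coeff (\<lambda>i j k l. \<alpha> * R_lead LENGTH('m) i j k l + \<beta> * R_const LENGTH('m) i j k l) (int r) (int (n - r))) = 0"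
proof -
  let ?e = "zexp s" and ?A = "R_lead LENGTH('m)" and ?B = "R_const LENGTH('m)"
  have ss: "?e * ?e = 1" "?e = 1 \<or> ?e = -1" by (cases s; simp add: zexp_def)+
  have ee: "?e * (?e * x) = x" for x using ss by (simp add: mult.assoc[symmetric])
  \<comment> \<open>the exponents of \<open>z\<close> and \<open>w\<close> add up to \<open>c\<close>, the one belonging to degree \<open>n\<close>\<close>
  define c where "c = ?e * int n"
  define G where "G Q a = uscal (\<alpha> powi a * \<beta> powi (c - a)) * rll_coeff Q (?e * a) (?e * (c - a))" for Q a
  have G0: "G Q a = 0" if "?e * a < 0 \<or> int n < ?e * a" for Q a
  proof -
    have "?e * (c - a) = int n - ?e * a" by (simp add: c_def right_diff_distrib ee)
    then have "?e * a < 0 \<or> ?e * (c - a) < 0" using that by linarith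
    then show ?thesis unfolding G_def rll_coeff_def by (subst rll_comp_lgen_int_0) simp_all
  qed
  \<comment> \<open>the window is wide enough to contain the nonzero terms also after the shift of \<open>a\<close> by one\<close>
  let ?I = "{- int n - 1..int n + 1}"
  have "0 = (\<Sum>a\<in>?I. uscal (\<alpha> powi (a + 1) * \<beta> powi (c - a)) * rll_defect a (c - a))"
    by (simp add: rll_defect_eq_0[OF MN])
  also have "\<dots> = (\<Sum>a\<in>?I. uscal \<alpha> * G ?A a + uscal \<beta> * G ?B (a + 1))"
  proof (intro sum.cong refl)
    fix a
    have 1: "\<alpha> powi (a + 1) * \<beta> powi (c - a) = \<alpha> * (\<alpha> powi a * \<beta> powi (c - a))"
      using nz by (simp add: power_int_add_1)
    have "\<beta> powi (c - a) = \<beta> powi (c - (a + 1)) * \<beta>"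
      using nz power_int_add_1[of \<beta> "c - (a + 1)"] by simp
    then have 2: "\<alpha> powi (a + 1) * \<beta> powi (c - a) = \<beta> * (\<alpha> powi (a + 1) * \<beta> powi (c - (a + 1)))"
      by (simp add: mult_ac)
    show "uscal (\<alpha> powi (a + 1) * \<beta> powi (c - a)) * rll_defect a (c - a) = uscal \<alpha> * G ?A a + uscal \<beta> * G ?B (a + 1)"
      unfolding rll_defect_def distrib_left G_def
      by (subst 1, subst 2) (simp add: uscal_mult mult.assoc algebra_simps)
  qed
  also have "\<dots> = uscal \<alpha> * (\<Sum>a\<in>?I. G ?A a) + uscal \<beta> * (\<Sum>a\<in>?I. G ?B (a + 1))"
    by (simp only: sum.distrib sum_distrib_left)
  also have "(\<Sum>a\<in>?I. G ?A a) = (\<Sum>r=0..n. G ?A (?e * int r))"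
    by (rule sum_int_window) (auto simp: G0)
  also have "(\<Sum>a\<in>?I. G ?B (a + 1)) = (\<Sum>a\<in>{- int n..int n + 2}. G ?B a)"
    by (rule sum.reindex_bij_witness[of _ "\<lambda>a. a - 1" "\<lambda>a. a + 1"]) auto
  also have "\<dots> = (\<Sum>r=0..n. G ?B (?e * int r))"
    by (rule sum_int_window) (auto simp: G0)
  also have "uscal \<alpha> * (\<Sum>r=0..n. G ?A (?e * int r)) + uscal \<beta> * (\<Sum>r=0..n. G ?B (?e * int r)) =
    (\<Sum>r=0..n. uscal (\<alpha> powi (zexp s * int r) * \<beta> powi (zexp s * int (n - r))) *
     rll_coeff (\<lambda>i j k l. \<alpha> * ?A i j k l + \<beta> * ?B i j k l) (int r) (int (n - r)))"
    unfolding sum_distrib_left sum.distrib[symmetric]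
  proof (intro sum.cong refl)
    fix r assume r: "r \<in> {0..n}"
    have "c - ?e * int r = ?e * int (n - r)"
      using r by (simp add: c_def right_diff_distrib of_nat_diff)
    then have G: "G Q (?e * int r) = uscal (\<alpha> powi (?e * int r) * \<beta> powi (?e * int (n - r))) * rll_coeff Q (int r) (int (n - r))" for Q
      unfolding G_def by (simp only: ee)
    have lin: "rll_coeff (\<lambda>i j k l. \<alpha> * ?A i j k l + \<beta> * ?B i j k l) (int r) (int (n - r)) =
      uscal \<alpha> * rll_coeff ?A (int r) (int (n - r)) + uscal \<beta> * rll_coeff ?B (int r) (int (n - r))"
      unfolding rll_coeff_def by (rule rll_comp_linear)
    have swap: "uscal c * (uscal d * x) = uscal d * (uscal c * x)" for c d and x :: "('m, 'n) uq_gl"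
      by (rule uscal_left_commute)
    show "uscal \<alpha> * G ?A (?e * int r) + uscal \<beta> * G ?B (?e * int r) =
       uscal (\<alpha> powi (?e * int r) * \<beta> powi (?e * int (n - r))) *
       rll_coeff (\<lambda>i j k l. \<alpha> * ?A i j k l + \<beta> * ?B i j k l) (int r) (int (n - r))"
      unfolding G lin distrib_left swap[of \<alpha>] swap[of \<beta>] ..
  qed
  finally show ?thesis by simp
qed

end


section \<open>The RTT relation for power series\<close>

definition scal :: "cq \<Rightarrow> ('m::len0, 'n::len0) uq_gl fps" where
  "scal c = fps_const (uscal c)"

lemma scal_0 [simp]: "scal 0 = 0" and scal_1 [simp]: "scal 1 = 1"
  and scal_add: "scal (c + d) = scal c + scal d"
  and scal_mult: "scal (c * d) = scal c * scal d"
  and scal_uminus: "scal (- c) = - scal c"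
  and scal_nth_mult: "fps_nth (scal c * f) n = uscal c * fps_nth f n"
  by (simp_all add: scal_def uscal_add uscal_mult uscal_uminus flip: fps_const_add fps_const_mult fps_const_neg)

lemma scal_commute: "f * scal c = scal c * f"
  by (rule fps_ext) (simp add: scal_def uscal_commute)

lemma scal_minus_one_power: "(-1) ^ e * scal c = scal ((-1) ^ e * c)"
  by (simp add: minus_one_power_iff scal_uminus)

text \<open>
  The coefficients of \<open>R(\<alpha>, \<beta>)\<close>.  In \<open>h_num\<close> the sign of \<open>q\<^sub>k - q\<^sub>k\<^sup>-\<^sup>1 = \<plusminus> (q - q\<^sup>-\<^sup>1)\<close> is dropped; it is
  absorbed by the signs of \<open>graded_rtt\<close>.
\<close>
definition r_num :: "nat \<Rightarrow> cq \<Rightarrow> cq \<Rightarrow> nat \<Rightarrow> nat \<Rightarrow> cq" where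
  "r_num M \<alpha> \<beta> i k = (if i = k then \<alpha> * q_at M i - \<beta> * inverse (q_at M i) else \<alpha> - \<beta>)"

definition h_num :: "cq \<Rightarrow> cq \<Rightarrow> nat \<Rightarrow> nat \<Rightarrow> cq" where
  "h_num \<alpha> \<beta> i k = (if i = k then 0 else (if i < k then \<alpha> else \<beta>) * (qq - inverse qq))"

lemma q_at_diff: "q_at M k - inverse (q_at M k) = (-1) ^ par M k * (qq - inverse qq)"
  by (simp add: q_at_def par_def)

lemma R_num:
  "\<alpha> * R_lead M i i k k + \<beta> * R_const M i i k k = r_num M \<alpha> \<beta> i k"
  "i \<noteq> k \<Longrightarrow> \<alpha> * R_lead M i k k i + \<beta> * R_const M i k k i = (-1) ^ par M k * h_num \<alpha> \<beta> i k"
  by (simp add: R_lead_def R_const_def r_num_def)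
     (simp add: R_lead_def R_const_def h_num_def q_at_diff del: inverse_eq_divide)

text \<open>
  For given parities both equations differ at most by an overall sign.
\<close>
lemma twist_signs:
  fixes a b c d c' d' r1 r2 h1 h2 :: "'a::ring_1"
  assumes "r1 * ((-1) ^ ((ei + ej) * (ek + el)) * (a * b)) +
      (-1) ^ ek * h1 * ((-1) ^ ((ei + ek) * (ek + ej) + (ek + ej) * (ei + el)) * (c * d)) =
      r2 * (b * a) + (-1) ^ ej * h2 * ((-1) ^ ((ek + ej) * (el + ej)) * (c' * d'))"
  shows "(-1) ^ ((ei + ej) * ek) * r1 * (((-1) ^ (ei * ej + ej) * a) * ((-1) ^ (ek * el + el) * b)) +
      (-1) ^ (ei * ej) * h1 * (((-1) ^ (ek * ej + ej) * c) * ((-1) ^ (ei * el + el) * d)) =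
      (-1) ^ ((ei + ej) * el) * r2 * (((-1) ^ (ek * el + el) * b) * ((-1) ^ (ei * ej + ej) * a)) +
      (-1) ^ (ei * ej) * h2 * (((-1) ^ (ek * ej + ej) * c') * ((-1) ^ (ei * el + el) * d'))"
proof -
  have neg: "- A - B = - C - D" if "A + B = C + D" for A B C D :: 'a
    using arg_cong[OF that, of uminus] by (simp only: minus_add_distrib diff_conv_add_uminus)
  have neg': "A + B = D - C" if "- A - B = C - D" for A B C D :: 'a
    using arg_cong[OF that, of uminus] by (simp add: add.commute)
  have neg'': "B - A = D - C" if "A - B = C - D" for A B C D :: 'a
    using arg_cong[OF that, of uminus] by simp
  show ?thesis
    by (insert assms; cases "even ei"; cases "even ej"; cases "even ek"; cases "even el";
        simp add: minus_one_power_iff; (erule neg | erule neg' | erule neg''))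
qed

lemma Lmat_mult_nth:
  fixes s :: pm and x y :: int
  defines "\<alpha> \<equiv> qq powi x" and "\<beta> \<equiv> qq powi y"
  shows "fps_nth (Lmat s x i j * (Lmat s y k l :: ('m::len0, 'n::len0) uq_gl fps)) n =
     (\<Sum>r=0..n. uscal (\<alpha> powi (zexp s * int r) * \<beta> powi (zexp s * int (n - r))) *
        (lgen s i j r * lgen s k l (n - r)))" (is ?A)
    and "fps_nth (Lmat s y k l * (Lmat s x i j :: ('m::len0, 'n::len0) uq_gl fps)) n =
     (\<Sum>r=0..n. uscal (\<alpha> powi (zexp s * int r) * \<beta> powi (zexp s * int (n - r))) *
        (lgen s k l (n - r) * lgen s i j r))" (is ?B)
proof -
  have L: "fps_nth (Lmat s z i j) r = uscal ((qq powi z) powi (zexp s * int r)) * lgen s i j r" for z i j r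
    by (simp add: Lmat_def power_int_mult[symmetric] mult_ac)
  have mm: "(uscal c * u) * (uscal d * v) = uscal (c * d) * (u * v)" for c d and u v :: "('m, 'n) uq_gl"
    by (simp only: uscal_mult mult.assoc uscal_left_commute[of u])
  show ?A
    unfolding fps_mult_nth L mm \<alpha>_def \<beta>_def ..
  have "fps_nth (Lmat s y k l * (Lmat s x i j :: ('m, 'n) uq_gl fps)) n =
     (\<Sum>r=0..n. fps_nth (Lmat s y k l) (n - r) * fps_nth (Lmat s x i j) (n - (n - r)))"
    unfolding fps_mult_nth by (subst sum.atLeastAtMost_rev) simp
  also have "\<dots> = (\<Sum>r=0..n. uscal (\<alpha> powi (zexp s * int r) * \<beta> powi (zexp s * int (n - r))) *
        (lgen s k l (n - r) * lgen s i j r))"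
    by (intro sum.cong refl) (simp only: L mm atLeastAtMost_iff diff_diff_cancel \<alpha>_def \<beta>_def mult.commute[of "(qq powi y) powi _"])
  finally show ?B .
qed

definition L_twist :: "pm \<Rightarrow> int \<Rightarrow> nat \<Rightarrow> nat \<Rightarrow> ('m::len0, 'n::len0) uq_gl fps" where
  "L_twist s x i j = twist_sign (par LENGTH('m)) i j * Lmat s x i j"

text \<open>
  The coefficients of degree \<open>n\<close> are the weighted sums of \<open>rll_coeff_weighted_sum\<close>.
\<close>
theorem graded_rtt_L_twist:
  fixes s :: pm and x y :: int
  assumes MN: "LENGTH('m::len0) \<noteq> LENGTH('n::len0)"
  shows "graded_rtt (par LENGTH('m)) (LENGTH('m) + LENGTH('n))
     (\<lambda>i k. scal (r_num LENGTH('m) (qq powi x) (qq powi y) i k)) (\<lambda>i k. scal (h_num (qq powi x) (qq powi y) i k))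
     (L_twist s x) (L_twist s y :: nat \<Rightarrow> nat \<Rightarrow> ('m, 'n) uq_gl fps)"
  unfolding graded_rtt_def
proof (intro conjI allI ballI)
  show "f * scal c = scal c * f" "f * scal d = scal d * f" for f c d by (rule scal_commute)+
next
  fix i j k l
  assume idx: "i \<in> {1..LENGTH('m) + LENGTH('n)}" "j \<in> {1..LENGTH('m) + LENGTH('n)}"
    "k \<in> {1..LENGTH('m) + LENGTH('n)}" "l \<in> {1..LENGTH('m) + LENGTH('n)}"
  define \<alpha> \<beta> where "\<alpha> = qq powi x" and "\<beta> = qq powi y"
  let ?p = "par LENGTH('m)"
  let ?L = "Lmat s x :: nat \<Rightarrow> nat \<Rightarrow> ('m, 'n) uq_gl fps"
  let ?K = "Lmat s y :: nat \<Rightarrow> nat \<Rightarrow> ('m, 'n) uq_gl fps"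
  define Q where "Q = (\<lambda>i j k l. \<alpha> * R_lead LENGTH('m) i j k l + \<beta> * R_const LENGTH('m) i j k l)"
  define w where "w n r = \<alpha> powi (zexp s * int r) * \<beta> powi (zexp s * int (n - r))" for n r
  have sgn_nth: "fps_nth ((- 1) ^ e * f) n = (- 1) ^ e * fps_nth f n" for e n and f :: "('m, 'n) uq_gl fps"
    by (simp add: minus_one_power_iff)
  have swap: "uscal c * (uscal d * u) = uscal d * (uscal c * u)" for c d and u :: "('m, 'n) uq_gl"
    by (rule uscal_left_commute)
  have swap': "(- 1) ^ e * (uscal d * u) = uscal d * ((- 1) ^ e * u)" for e d and u :: "('m, 'n) uq_gl"
    by (rule uscal_left_commute)
  have "scal (Q i i k k) * ((- 1) ^ ((?p i + ?p j) * (?p k + ?p l)) * (?L i j * ?K k l)) +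
     (if i = k then 0 else scal (Q i k k i) *
        ((- 1) ^ ((?p i + ?p k) * (?p k + ?p j) + (?p k + ?p j) * (?p i + ?p l)) * (?L k j * ?K i l))) -
     (scal (Q j j l l) * (?K k l * ?L i j) +
      (if j = l then 0 else scal (Q l j j l) *
        ((- 1) ^ ((?p k + ?p j) * (?p l + ?p j)) * (?K k j * ?L i l)))) = 0" (is "?D = 0")
  proof (rule fps_ext)
    fix n
    have push: "uscal c * ((- 1) ^ e * (\<Sum>r=0..n. uscal (w n r) * X r)) =
        (\<Sum>r=0..n. uscal (w n r) * (uscal c * ((- 1) ^ e * X r)))"
      for c e and X :: "nat \<Rightarrow> ('m, 'n) uq_gl"
      unfolding sum_distrib_left swap' by (intro sum.cong refl) (rule swap)
    have push': "uscal c * (\<Sum>r=0..n. uscal (w n r) * X r) = (\<Sum>r=0..n. uscal (w n r) * (uscal c * X r))"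
      for c and X :: "nat \<Rightarrow> ('m, 'n) uq_gl"
      using push[of c 0 X] by simp
    have lgen_int: "lgen_int s (int r) = (\<lambda>i j. lgen s i j r :: ('m, 'n) uq_gl)" for r
      by (intro ext) (simp add: lgen_int_def)
    note nth = Lmat_mult_nth[where s = s and x = x and y = y, folded \<alpha>_def \<beta>_def, folded w_def]
    have zero: "fps_nth (if b then 0 else f) n = (if b then 0 else fps_nth f n)" for b and f :: "('m, 'n) uq_gl fps"
      by simp
    have "fps_nth ?D n = (\<Sum>r=0..n. uscal (w n r) * (rll_coeff s i j k l Q (int r) (int (n - r)) :: ('m, 'n) uq_gl))"
      unfolding rll_coeff_def[OF idx] rll_comp_def lgen_int fps_sub_nth fps_add_nth zero scal_nth_mult sgn_nth nth push push'
      by (cases "i = k"; cases "j = l"; simp only: if_True if_False simp_thms distrib_left right_diff_distrib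
          sum.distrib sum_subtractf add_0_right)
    also have "\<dots> = 0"
      unfolding w_def Q_def by (rule rll_coeff_weighted_sum[OF idx MN]) (simp_all add: \<alpha>_def \<beta>_def)
    finally show "fps_nth ?D n = fps_nth 0 n" by simp
  qed
  note D = this
  have h: "(if i = k then 0 else scal (Q i k k i) * f) = (- 1) ^ ?p k * scal (h_num \<alpha> \<beta> i k) * f"
    for i k and f :: "('m, 'n) uq_gl fps"
  proof (cases "i = k")
    case True
    then show ?thesis by (simp add: h_num_def)
  next
    case False
    then show ?thesis unfolding scal_minus_one_power Q_def R_num(2)[OF False] by simp
  qed
  have h': "(if j = l then 0 else scal (Q l j j l) * f) = (- 1) ^ ?p j * scal (h_num \<alpha> \<beta> l j) * f"
    for f :: "('m, 'n) uq_gl fps"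
    using h[of l j f] by (simp only: eq_commute[of j l])
  have r: "Q i i k k = r_num LENGTH('m) \<alpha> \<beta> i k" for i k
    by (simp add: Q_def R_num)
  show "(- 1) ^ ((?p i + ?p j) * ?p k) * scal (r_num LENGTH('m) (qq powi x) (qq powi y) i k) * (L_twist s x i j * L_twist s y k l) +
       (- 1) ^ (?p i * ?p j) * scal (h_num (qq powi x) (qq powi y) i k) * (L_twist s x k j * L_twist s y i l) =
       (- 1) ^ ((?p i + ?p j) * ?p l) * scal (r_num LENGTH('m) (qq powi x) (qq powi y) j l) * (L_twist s y k l * L_twist s x i j) +
       (- 1) ^ (?p i * ?p j) * scal (h_num (qq powi x) (qq powi y) l j) * (L_twist s y k j * (L_twist s x i l :: ('m, 'n) uq_gl fps))"
    unfolding L_twist_def twist_sign_def \<alpha>_def[symmetric] \<beta>_def[symmetric]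
    by (rule twist_signs) (use D in \<open>simp only: h h' r right_minus_eq\<close>)
qed


section \<open>Quasideterminants of L and their commutation\<close>

lemma lgen_triangular:
  fixes i j :: nat
  assumes "i \<in> {1..LENGTH('m) + LENGTH('n)}" "j \<in> {1..LENGTH('m) + LENGTH('n)}"
  shows "j < i \<Longrightarrow> (lgen Plus i j 0 :: ('m::len0, 'n::len0) uq_gl) = 0"
    and "i < j \<Longrightarrow> (lgen Minus i j 0 :: ('m, 'n) uq_gl) = 0"
  using assms uq_rels_eq[OF uq_rels.plus0[of j i "LENGTH('m)" "LENGTH('n)"]]
    uq_rels_eq[OF uq_rels.minus0[of i j "LENGTH('m)" "LENGTH('n)"]]
  by (simp_all add: uq_gen uq_0)

lemma lgen_diag_unit:
  assumes i: "i \<in> {1..LENGTH('m) + LENGTH('n)}"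
  shows "\<exists>c. (lgen s i i 0 :: ('m::len0, 'n::len0) uq_gl) * c = 1 \<and> c * lgen s i i 0 = 1"
proof -
  have "(lgen Minus i i 0 :: ('m, 'n) uq_gl) * lgen Plus i i 0 = 1"
       "(lgen Plus i i 0 :: ('m, 'n) uq_gl) * lgen Minus i i 0 = 1"
    using uq_rels_eq[OF uq_rels.minus_plus[OF i]] uq_rels_eq[OF uq_rels.plus_minus[OF i]]
    by (simp_all add: uq_gen uq_1 uq_mult)
  then show ?thesis by (cases s) blast+
qed

lemma L_twist_nth_0: "fps_nth (L_twist s x i j :: ('m::len0, 'n::len0) uq_gl fps) 0 = twist_sign (par LENGTH('m)) i j * lgen s i j 0"
  by (simp add: L_twist_def Lmat_def twist_sign_def minus_one_power_iff)

lemma L_twist_invertible: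
  assumes "n \<le> LENGTH('m) + LENGTH('n)"
  shows "\<exists>B. mat_inverse n (L_twist s x) (B :: nat \<Rightarrow> nat \<Rightarrow> ('m::len0, 'n::len0) uq_gl fps) \<and>
    (n \<noteq> 0 \<longrightarrow> (\<exists>d. B n n * d = 1 \<and> d * B n n = 1))"
proof (rule mat_inverse_triangular_const)
  have sub: "i \<in> {1..LENGTH('m) + LENGTH('n)}" if "i \<in> {1..n}" for i
    using that assms by auto
  show "(\<forall>i\<in>{1..n}. \<forall>j\<in>{1..n}. i < j \<longrightarrow> fps_nth (L_twist s x i j :: ('m, 'n) uq_gl fps) 0 = 0) \<or>
        (\<forall>i\<in>{1..n}. \<forall>j\<in>{1..n}. j < i \<longrightarrow> fps_nth (L_twist s x i j :: ('m, 'n) uq_gl fps) 0 = 0)"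
  proof (cases s)
    case Plus
    then show ?thesis by (intro disjI2 ballI impI) (simp only: L_twist_nth_0 lgen_triangular(1)[OF sub sub] mult_zero_right)
  next
    case Minus
    then show ?thesis by (intro disjI1 ballI impI) (simp only: L_twist_nth_0 lgen_triangular(2)[OF sub sub] mult_zero_right)
  qed
  show "\<exists>c. fps_nth (L_twist s x i i :: ('m, 'n) uq_gl fps) 0 * c = 1 \<and> c * fps_nth (L_twist s x i i) 0 = 1"
    if "i \<in> {1..n}" for i
    unfolding L_twist_nth_0 twist_sign_diag mult_1_left by (rule lgen_diag_unit[OF sub[OF that]])
qed

lemma L_twist_eq: "(\<lambda>i j. twist_sign (par LENGTH('m)) i j * (Lmat s x i j :: ('m::len0, 'n::len0) uq_gl fps)) = L_twist s x"
  by (intro ext) (simp add: L_twist_def)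

lemma L_quasidet_inverse:
  assumes B: "mat_inverse n (L_twist s x) (B :: nat \<Rightarrow> nat \<Rightarrow> ('m::len0, 'n::len0) uq_gl fps)"
    and n: "n \<in> {1..LENGTH('m) + LENGTH('n)}"
  shows "B n n * L_quasidet s x n = 1" "L_quasidet s x n * B n n = 1"
    "ring_inv (L_quasidet s x n) = B n n"
proof -
  obtain C d where C: "mat_inverse n (L_twist s x) (C :: nat \<Rightarrow> nat \<Rightarrow> ('m, 'n) uq_gl fps)" "C n n * d = 1" "d * C n n = 1"
    using L_twist_invertible[of n s x, where 'm='m and 'n='n] n by auto
  have BC: "B n n = C n n"
    by (rule mat_inverse_unique[OF C(1) B]) (use n in auto)
  have "L_quasidet s x n = d"
    unfolding L_quasidet_def
    by (rule quasidet_eq[of n "par LENGTH('m)" "Lmat s x" C])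
       (use C n in \<open>auto simp: L_twist_eq\<close>)
  then show "B n n * L_quasidet s x n = 1" "L_quasidet s x n * B n n = 1"
    using C(2,3) BC by simp_all
  then show "ring_inv (L_quasidet s x n) = B n n" by (intro ring_inv_eq)
qed

text \<open>
  A polynomial with coefficients in the algebra that vanishes at all powers \<open>u, u\<^sup>2, \<dots>\<close> is zero: with
  \<open>p(t)\<close> also \<open>p(u t) - u\<^sup>n\<^sup>+\<^sup>1 p(t)\<close> has this property, and its degree is at most \<open>n\<close>.
\<close>
lemma vandermonde_uscal:
  fixes c :: "nat \<Rightarrow> ('m::len0, 'n::len0) uq_gl"
  assumes u: "u \<noteq> 0" "\<And>k. k > 0 \<Longrightarrow> u ^ k \<noteq> 1"
    and eq: "\<And>k. k > 0 \<Longrightarrow> (\<Sum>r=0..n. uscal ((u ^ k) ^ r) * c r) = 0"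
    and r: "r \<le> n"
  shows "c r = 0"
  using eq r
proof (induction n arbitrary: c r)
  case 0
  then show ?case using 0(1)[of 1] by simp
next
  case (Suc n)
  let ?N = "Suc n"
  have less: "c r = 0" if "r \<le> n" for r
  proof -
    have "uscal (u ^ r - u ^ ?N) * c r = 0"
    proof (rule Suc.IH[OF _ that])
      fix k :: nat assume k: "k > 0"
      have "0 = (\<Sum>r=0..?N. uscal ((u ^ Suc k) ^ r) * c r) - uscal (u ^ ?N) * (\<Sum>r=0..?N. uscal ((u ^ k) ^ r) * c r)"
        using Suc.prems(1)[OF k] Suc.prems(1)[of "Suc k"] by simp
      also have "\<dots> = (\<Sum>r=0..?N. uscal ((u ^ k) ^ r) * (uscal (u ^ r - u ^ ?N) * c r))"
        unfolding sum_distrib_left sum_subtractf[symmetric]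
      proof (intro sum.cong refl)
        fix r
        have "(u ^ Suc k) ^ r - u ^ ?N * (u ^ k) ^ r = (u ^ k) ^ r * (u ^ r - u ^ ?N)"
          by (simp add: power_mult_distrib algebra_simps)
        then show "uscal ((u ^ Suc k) ^ r) * c r - uscal (u ^ ?N) * (uscal ((u ^ k) ^ r) * c r) =
          uscal ((u ^ k) ^ r) * (uscal (u ^ r - u ^ ?N) * c r)"
          by (simp only: mult.assoc[symmetric] uscal_mult[symmetric] left_diff_distrib[symmetric] uscal_diff[symmetric])
      qed
      finally show "(\<Sum>r=0..n. uscal ((u ^ k) ^ r) * (uscal (u ^ r - u ^ ?N) * c r)) = 0"
        by simp
    qed
    moreover have "u ^ r - u ^ ?N \<noteq> 0"
    proof
      assume "u ^ r - u ^ ?N = 0"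
      moreover have "u ^ r * u ^ (?N - r) = u ^ ?N"
        using that by (simp only: power_add[symmetric] le_add_diff_inverse le_SucI)
      ultimately have "u ^ r * u ^ (?N - r) = u ^ r * 1" by (simp only: right_minus_eq mult_1_right)
      then have "u ^ (?N - r) = 1" using u(1) by (simp only: mult_cancel_left power_not_zero[OF u(1)] simp_thms)
      then show False using u(2)[of "?N - r"] that by simp
    qed
    ultimately show ?thesis by (rule uscal_cancel[rotated])
  qed
  show ?case
  proof (cases "r = ?N")
    case True
    have "(\<Sum>r=0..n. uscal ((u ^ 1) ^ r) * c r) = 0"
      by (intro sum.neutral) (simp add: less)
    then have "uscal ((u ^ 1) ^ ?N) * c ?N = 0"
      using Suc.prems(1)[of 1] by (simp only: sum.atLeast0_atMost_Suc zero_less_one add_0_left)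
    then show ?thesis using True uscal_cancel[of "(u ^ 1) ^ ?N"] u(1) by simp
  qed (use less Suc.prems(2) in simp)
qed

text \<open>
  The substitution of \<open>c u\<close> for the variable \<open>u\<close>.  The algebra is not commutative, but \<open>c\<close> is central, so
  this is a ring homomorphism.
\<close>
definition dilate :: "cq \<Rightarrow> ('m::len0, 'n::len0) uq_gl fps \<Rightarrow> ('m, 'n) uq_gl fps" where
  "dilate c f = Abs_fps (\<lambda>r. uscal (c ^ r) * fps_nth f r)"

lemma dilate_mult: "dilate c (f * g) = dilate c f * dilate c g"
proof (rule fps_ext)
  fix n
  have "uscal (c ^ n) * (fps_nth f i * fps_nth g (n - i)) =
      uscal (c ^ i) * fps_nth f i * (uscal (c ^ (n - i)) * fps_nth g (n - i))" if "i \<in> {0..n}" for i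
  proof -
    have "c ^ n = c ^ i * c ^ (n - i)" using that by (simp flip: power_add)
    then show ?thesis
      by (simp only: uscal_mult mult.assoc uscal_left_commute[of "fps_nth f i"])
  qed
  then show "fps_nth (dilate c (f * g)) n = fps_nth (dilate c f * dilate c g) n"
    by (simp only: dilate_def fps_nth_Abs_fps fps_mult_nth sum_distrib_left cong: sum.cong)
qed

lemma dilate_sum: "dilate c (sum f A) = (\<Sum>x\<in>A. dilate c (f x))"
  by (rule fps_ext) (simp add: dilate_def fps_sum_nth sum_distrib_left)

lemma dilate_simps [simp]: "dilate c 1 = 1" "dilate c 0 = 0" "dilate 1 f = f"
  by (simp_all add: dilate_def fps_eq_iff)

lemma mat_inverse_dilate: "mat_inverse n A B \<Longrightarrow> mat_inverse n (\<lambda>i j. dilate c (A i j)) (\<lambda>i j. dilate c (B i j))"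
  unfolding mat_inverse_def dilate_mult[symmetric] dilate_sum[symmetric] by simp

lemma L_twist_dilate: "L_twist s x i j = dilate (qq powi (zexp s * x)) (L_twist s 0 i j)"
proof (rule fps_ext)
  fix n
  have "qq powi (zexp s * x * int n) = (qq powi (zexp s * x)) ^ n"
    by (simp add: power_int_power')
  then show "fps_nth (L_twist s x i j) n = fps_nth (dilate (qq powi (zexp s * x)) (L_twist s 0 i j)) n"
    by (simp add: dilate_def L_twist_def Lmat_def twist_sign_def minus_one_power_iff)
qed

text \<open>
  The inverse at shift \<open>z\<close> is the dilated inverse \<open>C\<close> at shift \<open>0\<close>.  For \<open>z \<noteq> 0\<close> the RTT relation makes the dilated corner
  entry commute with the entries of \<open>L\<close>.  Comparing a fixed degree for \<open>z = 1, 2, \<dots>\<close> gives polynomial identities in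
  \<open>q\<^sup>\<plusminus>\<^sup>z\<close>, from which all pairs of coefficients commute.  Then any two dilations commute.
\<close>
lemma corner_commute:
  fixes B :: "nat \<Rightarrow> nat \<Rightarrow> ('m::len0, 'n::len0) uq_gl fps"
  assumes MN: "LENGTH('m) \<noteq> LENGTH('n)" and n: "n \<le> LENGTH('m) + LENGTH('n)"
    and B: "mat_inverse n (L_twist s y) B" and ij: "i \<in> {1..<n}" "j \<in> {1..<n}"
  shows "B n n * L_twist s x i j = L_twist s x i j * B n n"
proof -
  let ?t = "L_twist s 0 i j :: ('m, 'n) uq_gl fps"
  obtain C where C: "mat_inverse n (L_twist s 0) (C :: nat \<Rightarrow> nat \<Rightarrow> ('m, 'n) uq_gl fps)"
    using L_twist_invertible[OF n] by blast
  have Cz: "mat_inverse n (L_twist s z) (\<lambda>i j. dilate (qq powi (zexp s * z)) (C i j))" for z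
    using mat_inverse_dilate[OF C, of "qq powi (zexp s * z)"] by (simp only: L_twist_dilate[symmetric])
  have n1: "i \<in> {1..n}" "j \<in> {1..n}" "i \<noteq> n" "j \<noteq> n" "n \<in> {1..n}" using ij by auto
  have comm: "dilate (qq powi (zexp s * z)) (C n n) * ?t = ?t * dilate (qq powi (zexp s * z)) (C n n)"
    if z: "z \<noteq> 0" for z
  \<comment> \<open>the entry is taken at shift \<open>0\<close>, so \<open>z - w\<close> becomes the scalar \<open>1 - q\<^sup>z\<close>\<close>
  proof (rule graded_rtt_corner_commute[OF graded_rtt_mono[OF graded_rtt_L_twist[OF MN] n] Cz n1(1-4)])
    show "scal (r_num LENGTH('m) (qq powi 0) (qq powi z) i n) = scal (1 - qq powi z)"
         "scal (r_num LENGTH('m) (qq powi 0) (qq powi z) j n) = scal (1 - qq powi z)"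
      using n1 by (simp_all add: r_num_def)
    have "1 - qq powi z \<noteq> 0" using z qq_powi_eq_1_iff[of z] by auto
    then show "scal (inverse (1 - qq powi z)) * scal (1 - qq powi z) = 1"
      by (simp flip: scal_mult)
  qed
  have coeff: "fps_nth (C n n) r * fps_nth ?t r' = fps_nth ?t r' * fps_nth (C n n) r" for r r'
  proof -
    define c where "c k = fps_nth (C n n) k * fps_nth ?t (r + r' - k) - fps_nth ?t (r + r' - k) * fps_nth (C n n) k" for k
    define u where "u = qq powi zexp s"
    have u: "u ^ k = qq powi (zexp s * int k)" for k by (simp add: u_def power_int_power')
    have zs: "zexp s \<noteq> 0" by (cases s) (simp_all add: zexp_def)
    have "c r = 0"
    proof (rule vandermonde_uscal)
      show "u \<noteq> 0" by (simp add: u_def)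
      show "u ^ k \<noteq> 1" if "k > 0" for k
        unfolding u qq_powi_eq_1_iff using that zs by simp
      fix k :: nat assume k: "k > 0"
      have D: "dilate (u ^ k) (C n n) * ?t = ?t * dilate (u ^ k) (C n n)"
        unfolding u by (rule comm) (use k in simp)
      have "(\<Sum>l=0..r+r'. uscal ((u ^ k) ^ l) * c l) =
         fps_nth (dilate (u ^ k) (C n n) * ?t) (r + r') - fps_nth (?t * dilate (u ^ k) (C n n)) (r + r')"
      proof -
        have "fps_nth (?t * dilate (u ^ k) (C n n)) (r + r') =
          (\<Sum>l=0..r+r'. fps_nth ?t (r + r' - l) * fps_nth (dilate (u ^ k) (C n n)) (r + r' - (r + r' - l)))"
          unfolding fps_mult_nth by (subst sum.atLeastAtMost_rev) simp
        also have "\<dots> = (\<Sum>l=0..r+r'. uscal ((u ^ k) ^ l) * (fps_nth ?t (r + r' - l) * fps_nth (C n n) l))"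
          by (intro sum.cong refl) (simp only: dilate_def fps_nth_Abs_fps atLeastAtMost_iff diff_diff_cancel uscal_left_commute[of "fps_nth ?t _"])
        finally show ?thesis
          unfolding fps_mult_nth[of "dilate _ _"] c_def
          by (simp add: dilate_def right_diff_distrib sum_subtractf mult.assoc)
      qed
      then show "(\<Sum>l=0..r+r'. uscal ((u ^ k) ^ l) * c l) = 0" unfolding D by simp
    qed simp
    then show ?thesis by (simp add: c_def)
  qed
  have BC: "B n n = dilate (qq powi (zexp s * y)) (C n n)"
    by (rule mat_inverse_unique[OF Cz B n1(5) n1(5)])
  show ?thesis
    unfolding BC L_twist_dilate[of s x]
  proof (rule fps_ext)
    fix N
    let ?a = "qq powi (zexp s * y)" and ?b = "qq powi (zexp s * x)"
    have sw: "(uscal a * f) * (uscal b * g) = (uscal b * g) * (uscal a * f)" if "f * g = g * f"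
      for a b and f g :: "('m, 'n) uq_gl"
    proof -
      have "(uscal a * f) * (uscal b * g) = uscal a * (uscal b * (f * g))"
        by (simp only: mult.assoc uscal_left_commute[of f])
      also have "\<dots> = uscal b * (uscal a * (g * f))"
        unfolding that by (rule uscal_left_commute)
      also have "\<dots> = (uscal b * g) * (uscal a * f)"
        by (simp only: mult.assoc uscal_left_commute[of g])
      finally show ?thesis .
    qed
    have "fps_nth (dilate ?a (C n n) * dilate ?b ?t) N =
      (\<Sum>l=0..N. fps_nth (dilate ?b ?t) (N - l) * fps_nth (dilate ?a (C n n)) l)"
      unfolding fps_mult_nth dilate_def fps_nth_Abs_fps
      by (intro sum.cong refl sw coeff)
    also have "\<dots> = (\<Sum>l=0..N. fps_nth (dilate ?b ?t) l * fps_nth (dilate ?a (C n n)) (N - l))"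
      by (subst sum.atLeastAtMost_rev) simp
    finally show "fps_nth (dilate ?a (C n n) * dilate ?b ?t) N = fps_nth (dilate ?b ?t * dilate ?a (C n n)) N"
      unfolding fps_mult_nth[of "dilate ?b ?t"] .
  qed
qed

lemma inverse_commute:
  fixes b c d :: "'a::ring_1"
  assumes "b * d = 1" "d * b = 1" "b * c = c * b"
  shows "d * c = c * d"
proof -
  have "d * c = d * (c * b) * d" using assms(1) by (simp add: mult.assoc)
  also have "\<dots> = d * b * c * d" by (simp only: assms(3)[symmetric] mult.assoc)
  finally show ?thesis by (simp add: assms(2))
qed

lemma ber_factor_commute_less:
  assumes MN: "LENGTH('m) \<noteq> LENGTH('n)" and ij: "1 \<le> i" "i < j" "j \<le> LENGTH('m) + LENGTH('n)"
  shows "(ber_factor s i :: ('m::len0, 'n::len0) uq_gl fps) * ber_factor s j = ber_factor s j * ber_factor s i"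
proof -
  have i: "i \<in> {1..LENGTH('m) + LENGTH('n)}" "j \<in> {1..LENGTH('m) + LENGTH('n)}" using ij by auto
  \<comment> \<open>the shifts of the argument in the two halves of the product\<close>
  define sh where "sh k = (if k \<le> LENGTH('m) then 2 * int k - 2 else 2 * int LENGTH('m) - 2 * int (k - LENGTH('m)))" for k
  obtain A where A: "mat_inverse i (L_twist s (sh i)) (A :: nat \<Rightarrow> nat \<Rightarrow> ('m, 'n) uq_gl fps)"
    using L_twist_invertible[of i] i by auto
  obtain B where B: "mat_inverse j (L_twist s (sh j)) (B :: nat \<Rightarrow> nat \<Rightarrow> ('m, 'n) uq_gl fps)"
    using L_twist_invertible[of j] i by auto
  note a = L_quasidet_inverse[OF A i(1)] and b = L_quasidet_inverse[OF B i(2)]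
  have 1: "B j j * A i i = A i i * B j j"
    by (rule mat_inverse_commute[OF A]) (use ij corner_commute[OF MN ij(3) B] in auto)
  have 2: "L_quasidet s (sh j) j * A i i = A i i * L_quasidet s (sh j) j"
    by (rule inverse_commute[OF b(1,2) 1])
  have 3: "L_quasidet s (sh i) i * B j j = B j j * L_quasidet s (sh i) i"
    by (rule inverse_commute[OF a(1,2) 1[symmetric]])
  have 4: "L_quasidet s (sh i) i * L_quasidet s (sh j) j = L_quasidet s (sh j) j * (L_quasidet s (sh i) i :: ('m, 'n) uq_gl fps)"
    by (rule inverse_commute[OF a(1,2) 2[symmetric]])
  have F: "ber_factor s k = (if k \<le> LENGTH('m) then L_quasidet s (sh k) k else ring_inv (L_quasidet s (sh k) k :: ('m, 'n) uq_gl fps))" for k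
    by (simp add: ber_factor_def sh_def)
  show ?thesis
    unfolding F a(3) b(3) using 1 2 3 4 by simp
qed


section \<open>The quantum Berezinian\<close>

lemma q_sign_power: "q_sign l = (scal (- inverse qq) :: ('m::len0, 'n::len0) uq_gl fps) ^ l"
proof -
  have "(- qq) powi (- int l) = (- inverse qq) ^ l"
    by (simp add: power_int_minus power_inverse[symmetric])
  moreover have "(scal c :: ('m, 'n) uq_gl fps) ^ l = scal (c ^ l)" for c
    by (induction l) (simp_all add: scal_mult)
  ultimately show ?thesis by (simp only: q_sign_def scal_def[symmetric])
qed

lemma scal_inverse_mult: "c \<noteq> 0 \<Longrightarrow> scal (inverse c) * scal c = 1"
  by (simp flip: scal_mult)

lemma v_w: "scal (- inverse qq) * scal (- qq) = 1"
  by (simp flip: scal_mult)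

lemma L_twist_even: "i \<le> LENGTH('m) \<Longrightarrow> j \<le> LENGTH('m) \<Longrightarrow> L_twist s x i j = (Lmat s x i j :: ('m::len0, 'n::len0) uq_gl fps)"
  by (simp add: L_twist_def twist_sign_def par_def)

lemma q_det_empty: "n < m \<Longrightarrow> q_det v T m n J = 1"
proof -
  have "perm_length n id = 0"
    unfolding perm_length_def card_eq_0_iff by auto
  moreover assume "n < m"
  ultimately show ?thesis by (simp add: q_det_def)
qed

lemma qq_powi_add_2: "qq powi (a + 2) = qq powi a * (qq * qq)"
  by (subst power_int_add) (simp_all add: power2_eq_square)

text \<open>
  For \<open>\<beta> = \<alpha> q\<^sup>2\<close> the diagonal coefficient \<open>\<alpha> q - \<beta> q\<^sup>-\<^sup>1\<close> vanishes.
\<close>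
lemma exchange_even:
  assumes MN: "LENGTH('m) \<noteq> LENGTH('n)" and k: "k \<ge> 1" and m: "m \<le> LENGTH('m)"
  shows "q_exchange (scal (- inverse qq)) (scal (- qq)) {1..m}
    (L_twist s (2 * int k - 2)) (L_twist s (2 * int (Suc k) - 2) :: nat \<Rightarrow> nat \<Rightarrow> ('m::len0, 'n::len0) uq_gl fps)"
proof -
  define \<alpha> \<beta> where "\<alpha> = qq powi (2 * int k - 2)" and "\<beta> = qq powi (2 * int (Suc k) - 2)"
  have \<beta>: "\<beta> = \<alpha> * (qq * qq)"
    using qq_powi_add_2[of "2 * int k - 2"] by (simp add: \<alpha>_def \<beta>_def)
  have diag: "\<beta> * inverse qq = \<alpha> * qq" by (simp add: \<beta> mult.assoc)
  have ne: "\<alpha> - \<beta> \<noteq> 0"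
    by (simp add: \<alpha>_def \<beta>_def qq_powi_inj)
  let ?scal = "scal :: cq \<Rightarrow> ('m, 'n) uq_gl fps"
  show ?thesis
  proof (rule q_exchange_even[OF graded_rtt_L_twist[OF MN, of "2 * int k - 2" "2 * int (Suc k) - 2" s, folded \<alpha>_def \<beta>_def]])
    show "{1..m} \<subseteq> {1..LENGTH('m) + LENGTH('n)}" using m by auto
    show "even (par LENGTH('m) i)" if "i \<in> {1..m}" for i using that m by (simp add: par_def)
    show "?scal (r_num LENGTH('m) \<alpha> \<beta> i k) = (if i = k then 0 else ?scal (\<alpha> - \<beta>))"
      if "i \<in> {1..m}" "k \<in> {1..m}" for i k
      using that m by (auto simp: r_num_def q_at_def par_def diag)
    have "\<alpha> * (qq - inverse qq) = (\<alpha> - \<beta>) * (- inverse qq)" "\<beta> * (qq - inverse qq) = (\<alpha> - \<beta>) * (- qq)"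
      by (simp_all add: \<beta> field_simps)
    then show "?scal (h_num \<alpha> \<beta> i k) = (if i = k then 0 else ?scal (\<alpha> - \<beta>) * (if i < k then ?scal (- inverse qq) else ?scal (- qq)))"
      for i k
      by (auto simp: h_num_def simp flip: scal_mult)
    show "?scal (inverse (\<alpha> - \<beta>)) * ?scal (\<alpha> - \<beta>) = 1" by (rule scal_inverse_mult[OF ne])
  qed
qed

lemma even_minor:
  assumes MN: "LENGTH('m) \<noteq> LENGTH('n)" and m: "m \<le> LENGTH('m)"
  shows "q_det (scal (- inverse qq)) (\<lambda>k. L_twist s (2 * int k - 2)) 1 m id =
    prod_list (map (\<lambda>j. L_quasidet s (2 * int j - 2) j :: ('m::len0, 'n::len0) uq_gl fps) [1..<m+1])"
  using m
proof (induction m)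
  case 0
  then show ?case by (simp add: q_det_empty)
next
  case (Suc m)
  let ?v = "scal (- inverse qq) :: ('m, 'n) uq_gl fps"
  let ?T = "\<lambda>k. L_twist s (2 * int k - 2) :: nat \<Rightarrow> nat \<Rightarrow> ('m, 'n) uq_gl fps"
  have "\<exists>V. V (Suc m) = q_det ?v ?T 1 (Suc m - 1) id \<and>
    (\<forall>j\<in>{1..Suc m}. (\<Sum>i\<in>{1..Suc m}. V i * ?T (Suc m) i j) = (if j = Suc m then q_det ?v ?T 1 (Suc m) id else 0))"
    by (rule q_det_expand_last[OF scal_commute[symmetric] v_w]) (use Suc.prems exchange_even[OF MN] in auto)
  then obtain V where V: "V (Suc m) = q_det ?v ?T 1 m id"
    "\<And>j. j \<in> {1..Suc m} \<Longrightarrow> (\<Sum>i\<in>{1..Suc m}. V i * ?T (Suc m) i j) = (if j = Suc m then q_det ?v ?T 1 (Suc m) id else 0)"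
    by auto
  obtain B where B: "mat_inverse (Suc m) (?T (Suc m)) (B :: nat \<Rightarrow> nat \<Rightarrow> ('m, 'n) uq_gl fps)"
    using L_twist_invertible[of "Suc m"] Suc.prems by force
  have n: "Suc m \<in> {1..LENGTH('m) + LENGTH('n)}" using Suc.prems by auto
  have "V (Suc m) = (\<Sum>k\<in>{1..Suc m}. (if k = Suc m then q_det ?v ?T 1 (Suc m) id else 0) * B k (Suc m))"
    by (rule mat_inverse_solve_right[OF B]) (use V(2) in auto)
  also have "\<dots> = (\<Sum>k\<in>{1..Suc m}. if k = Suc m then q_det ?v ?T 1 (Suc m) id * B k (Suc m) else 0)"
    by (intro sum.cong refl) simp
  also have "\<dots> = q_det ?v ?T 1 (Suc m) id * B (Suc m) (Suc m)" by simp
  finally have "q_det ?v ?T 1 m id * L_quasidet s (2 * int (Suc m) - 2) (Suc m) =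
      q_det ?v ?T 1 (Suc m) id * (B (Suc m) (Suc m) * L_quasidet s (2 * int (Suc m) - 2) (Suc m))"
    unfolding V(1) by (simp only: mult.assoc)
  then have "q_det ?v ?T 1 (Suc m) id = q_det ?v ?T 1 m id * L_quasidet s (2 * int (Suc m) - 2) (Suc m)"
    unfolding L_quasidet_inverse(1)[OF B n] by (simp only: mult_1_right)
  moreover have "[1..<Suc m + 1] = [1..<m + 1] @ [Suc m]" by simp
  ultimately show ?case
    using Suc.IH[OF Suc_leD[OF Suc.prems]]
    by (simp only: map_append prod_list.append list.map prod_list.Cons prod_list.Nil mult_1_right)
qed

context
  fixes s :: pm and P :: "nat \<Rightarrow> nat \<Rightarrow> nat \<Rightarrow> ('m::len0, 'n::len0) uq_gl fps"
  assumes MN: "LENGTH('m) \<noteq> LENGTH('n)"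
    and P: "\<And>k. mat_inverse (LENGTH('m) + LENGTH('n)) (L_twist s (2 * int LENGTH('m) - 2 * int k)) (P k)"
begin

text \<open>
  For \<open>\<alpha> = \<beta> q\<^sup>2\<close> the diagonal coefficient \<open>\<alpha> q\<^sup>-\<^sup>1 - \<beta> q\<close> vanishes; for odd indices \<open>q\<^sub>i = q\<^sup>-\<^sup>1\<close>, which is
  why the arguments decrease in the second half of the Berezinian.
\<close>
lemma exchange_odd:
  assumes m: "m \<ge> 1"
  shows "q_exchange (scal (- inverse qq)) (scal (- qq)) {m..LENGTH('n)}
    (\<lambda>i j. P k (LENGTH('m) + j) (LENGTH('m) + i)) (\<lambda>i j. P (Suc k) (LENGTH('m) + j) (LENGTH('m) + i))"
proof -
  define \<alpha> \<beta> where "\<alpha> = qq powi (2 * int LENGTH('m) - 2 * int k)" and "\<beta> = qq powi (2 * int LENGTH('m) - 2 * int (Suc k))"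
  have \<alpha>: "\<alpha> = \<beta> * (qq * qq)"
    using qq_powi_add_2[of "2 * int LENGTH('m) - 2 * int (Suc k)"] by (simp add: \<alpha>_def \<beta>_def)
  have diag: "\<alpha> * inverse qq = \<beta> * qq" by (simp add: \<alpha> mult.assoc)
  have ne: "\<alpha> - \<beta> \<noteq> 0"
    by (simp add: \<alpha>_def \<beta>_def qq_powi_inj)
  let ?scal = "scal :: cq \<Rightarrow> ('m, 'n) uq_gl fps"
  show ?thesis
  proof (rule q_exchange_odd[OF graded_rtt_L_twist[OF MN, of "2 * int LENGTH('m) - 2 * int k"
        "2 * int LENGTH('m) - 2 * int (Suc k)" s, folded \<alpha>_def \<beta>_def] P P])
    show "LENGTH('m) + i \<in> {1..LENGTH('m) + LENGTH('n)}" if "i \<in> {m..LENGTH('n)}" for i using that m by auto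
    show "odd (par LENGTH('m) (LENGTH('m) + i))" if "i \<in> {m..LENGTH('n)}" for i using that m by (simp add: par_def)
    show "?scal (r_num LENGTH('m) \<alpha> \<beta> (LENGTH('m) + i) (LENGTH('m) + k)) = (if i = k then 0 else ?scal (\<alpha> - \<beta>))"
      if "i \<in> {m..LENGTH('n)}" "k \<in> {m..LENGTH('n)}" for i k
      using that m by (auto simp: r_num_def q_at_def par_def diag power_int_minus)
    have "\<alpha> * (qq - inverse qq) = - ((\<alpha> - \<beta>) * (- qq))" "\<beta> * (qq - inverse qq) = - ((\<alpha> - \<beta>) * (- inverse qq))"
      by (simp_all add: \<alpha> field_simps)
    then show "?scal (h_num \<alpha> \<beta> (LENGTH('m) + i) (LENGTH('m) + k)) =
        (if i = k then 0 else - (?scal (\<alpha> - \<beta>) * (if i < k then ?scal (- qq) else ?scal (- inverse qq))))"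
      for i k
      by (auto simp: h_num_def simp flip: scal_mult scal_uminus)
    show "?scal (inverse (\<alpha> - \<beta>)) * ?scal (\<alpha> - \<beta>) = 1" by (rule scal_inverse_mult[OF ne])
  qed
qed

text \<open>
  Recursion in the first row: with \<open>X = P W\<close> supported in the first \<open>M + m\<close> places and \<open>W\<close> in the places from
  \<open>M + m\<close> on, the equation \<open>L X = W\<close> restricts to the principal submatrix of size \<open>M + m\<close> as \<open>L\<^sup>(\<^sup>M\<^sup>+\<^sup>m\<^sup>) X = W\<^sub>m e\<^sub>M\<^sub>+\<^sub>m\<close>, and \<open>X\<close> ends with
  the minor itself.
\<close>
lemma odd_minor:
  assumes "1 \<le> m" "m \<le> Suc LENGTH('n)"
  shows "q_det (scal (- inverse qq)) (\<lambda>k i j. P k (LENGTH('m) + j) (LENGTH('m) + i)) m LENGTH('n) id =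
    prod_list (map (\<lambda>k. ring_inv (L_quasidet s (2 * int LENGTH('m) - 2 * int k) (LENGTH('m) + k))) [m..<LENGTH('n)+1])"
  using assms
proof (induction "Suc LENGTH('n) - m" arbitrary: m)
  case 0
  then show ?case by (simp add: q_det_empty)
next
  case (Suc d)
  let ?M = "LENGTH('m)" and ?N = "LENGTH('n)"
  let ?v = "scal (- inverse qq) :: ('m, 'n) uq_gl fps"
  let ?T = "\<lambda>k i j. P k (?M + j) (?M + i)"
  have m: "1 \<le> m" "m \<le> ?N" using Suc by auto
  let ?D = "q_det ?v ?T m ?N id" and ?n = "?M + m"
  have "\<exists>W. W m = q_det ?v ?T (Suc m) ?N id \<and>
    (\<forall>j\<in>{m..?N}. (\<Sum>i\<in>{m..?N}. ?T m i j * W i) = (if j = m then ?D else 0))"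
    by (rule q_det_expand_first[OF scal_commute[symmetric] v_w m(1) _ m(2)]) (rule exchange_odd[OF m(1)])
  then obtain W where W: "W m = q_det ?v ?T (Suc m) ?N id"
    "\<And>j. j \<in> {m..?N} \<Longrightarrow> (\<Sum>i\<in>{m..?N}. P m (?M + j) (?M + i) * W i) = (if j = m then ?D else 0)"
    by auto
  let ?A = "L_twist s (2 * int ?M - 2 * int m) :: nat \<Rightarrow> nat \<Rightarrow> ('m, 'n) uq_gl fps"
  \<comment> \<open>the expansion determines the entries of \<open>X\<close> from \<open>M + m\<close> on: they are \<open>?D\<close> followed by zeros\<close>
  define X where "X a = (\<Sum>i\<in>{m..?N}. P m a (?M + i) * W i)" for a
  have AX: "(\<Sum>a\<in>{1..?n}. ?A b a * X a) = (if b = ?n then W m else 0)" if b: "b \<in> {1..?n}" for b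
  proof -
    have b': "b \<in> {1..?M + ?N}" using b m by auto
    have "X a = 0" if "a \<in> {1..?M + ?N} - {1..?n}" for a
    proof -
      have "a = ?M + (a - ?M)" "a - ?M \<in> {m..?N}" "a - ?M \<noteq> m" using that by auto
      then show ?thesis unfolding X_def using W(2)[of "a - ?M"] by (simp only: if_False)
    qed
    then have "(\<Sum>a\<in>{1..?n}. ?A b a * X a) = (\<Sum>a\<in>{1..?M + ?N}. ?A b a * X a)"
      using m by (intro sum.mono_neutral_left) auto
    also have "\<dots> = (\<Sum>i\<in>{m..?N}. (\<Sum>a\<in>{1..?M + ?N}. ?A b a * P m a (?M + i)) * W i)"
      unfolding X_def sum_distrib_left sum_distrib_right mult.assoc by (rule sum.swap)
    also have "\<dots> = (\<Sum>i\<in>{m..?N}. if i = m then if b = ?n then W m else 0 else 0)"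
    proof (intro sum.cong refl)
      fix i assume i: "i \<in> {m..?N}"
      then have "?M + i \<in> {1..?M + ?N}" using m by auto
      then have "(\<Sum>a\<in>{1..?M + ?N}. ?A b a * P m a (?M + i)) = (if b = ?M + i then 1 else 0)"
        by (rule mat_inverseD(1)[OF P b'])
      then show "(\<Sum>a\<in>{1..?M + ?N}. ?A b a * P m a (?M + i)) * W i = (if i = m then if b = ?n then W m else 0 else 0)"
        using b i by auto
    qed
    also have "\<dots> = (if b = ?n then W m else 0)" using m by simp
    finally show ?thesis .
  qed
  obtain B where B: "mat_inverse ?n ?A (B :: nat \<Rightarrow> nat \<Rightarrow> ('m, 'n) uq_gl fps)"
    using L_twist_invertible[of ?n] m by force
  have n: "?n \<in> {1..?M + ?N}" using m by auto
  have "X ?n = (\<Sum>k\<in>{1..?n}. B ?n k * (if k = ?n then W m else 0))"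
    by (rule mat_inverse_solve_left[OF B _ AX]) (use m in auto)
  also have "\<dots> = (\<Sum>k\<in>{1..?n}. if k = ?n then B ?n k * W m else 0)"
    by (intro sum.cong refl) simp
  also have "\<dots> = B ?n ?n * W m" using m by simp
  finally have "?D = B ?n ?n * W m"
    using W(2)[of m] m by (simp add: X_def)
  moreover have "[m..<?N+1] = m # [Suc m..<?N+1]" using m by (simp add: upt_conv_Cons)
  moreover have "q_det ?v ?T (Suc m) ?N id =
    prod_list (map (\<lambda>k. ring_inv (L_quasidet s (2 * int ?M - 2 * int k) (?M + k))) [Suc m..<?N+1])"
    by (rule Suc.hyps(1)) (use Suc.hyps(2) m in auto)
  ultimately show ?case
    using W(1) L_quasidet_inverse(3)[OF B n] by (simp only: list.map prod_list.Cons)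
qed

end

theorem theorem4p2:
  fixes s :: pm
  assumes "LENGTH('m::len0) \<noteq> LENGTH('n::len0)"
  shows "(q_berezinian s :: ('m, 'n) uq_gl fps) =
           prod_list (map (\<lambda>j. L_quasidet s (2 * int j - 2) j) [1..<LENGTH('m) + 1]) *
           prod_list (map (\<lambda>k. ring_inv (L_quasidet s (2 * int LENGTH('m) - 2 * int k) (LENGTH('m) + k)))
                        [1..<LENGTH('n) + 1])
         \<and> (\<forall>i\<in>{1..LENGTH('m) + LENGTH('n)}. \<forall>j\<in>{1..LENGTH('m) + LENGTH('n)}.
              (ber_factor s i :: ('m, 'n) uq_gl fps) * ber_factor s j = ber_factor s j * ber_factor s i)"
proof (intro conjI ballI)
  let ?M = "LENGTH('m)" and ?N = "LENGTH('n)"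
  let ?v = "scal (- inverse qq) :: ('m, 'n) uq_gl fps"
  define P where "P k = (SOME B. mat_inverse (?M + ?N) (L_twist s (2 * int ?M - 2 * int k)) (B :: nat \<Rightarrow> nat \<Rightarrow> ('m, 'n) uq_gl fps))"
    for k
  have P: "mat_inverse (?M + ?N) (L_twist s (2 * int ?M - 2 * int k)) (P k)" for k
  proof -
    obtain B where "mat_inverse (?M + ?N) (L_twist s (2 * int ?M - 2 * int k)) (B :: nat \<Rightarrow> nat \<Rightarrow> ('m, 'n) uq_gl fps)"
      using L_twist_invertible[where 'm = 'm and 'n = 'n, OF order_refl, of s "2 * int ?M - 2 * int k"] by (elim exE conjE)
    then show ?thesis
      unfolding P_def by (rule someI[where P = "mat_inverse (?M + ?N) (L_twist s (2 * int ?M - 2 * int k))"])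
  qed
  have "(\<Sum>\<sigma> | \<sigma> permutes {1..?M}. q_sign (perm_length ?M \<sigma>) *
         prod_list (map (\<lambda>j. Lmat s (2 * int j - 2) (\<sigma> j) j) [1..<?M+1])) =
      q_det ?v (\<lambda>k. L_twist s (2 * int k - 2)) 1 ?M id"
    unfolding q_det_def q_sign_power
  proof (intro sum.cong refl arg_cong[where f = "\<lambda>x. _ * prod_list x"] map_cong)
    fix \<sigma> k assume \<sigma>: "\<sigma> \<in> {\<sigma>. \<sigma> permutes {1..?M}}" "k \<in> set [1..<?M+1]"
    then have "k \<in> {1..?M}" by auto
    moreover from this \<sigma> have "\<sigma> k \<in> {1..?M}" using permutes_mem[of \<sigma> 1 ?M k] by simp
    ultimately show "Lmat s (2 * int k - 2) (\<sigma> k) k = (L_twist s (2 * int k - 2) (\<sigma> k) (id k) :: ('m, 'n) uq_gl fps)"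
      by (simp add: L_twist_even)
  qed
  moreover have "(\<Sum>\<tau> | \<tau> permutes {1..?N}. q_sign (perm_length ?N \<tau>) *
         prod_list (map (\<lambda>k. smat_inv (par ?M) (?M + ?N) (Lmat s (2 * int ?M - 2 * int k))
                               (?M + k) (?M + \<tau> k)) [1..<?N+1])) =
      q_det ?v (\<lambda>k i j. P k (?M + j) (?M + i)) 1 ?N id"
    unfolding q_det_def q_sign_power
  proof (intro sum.cong refl arg_cong[where f = "\<lambda>x. _ * prod_list x"] map_cong)
    fix \<tau> k assume \<tau>: "\<tau> \<in> {\<tau>. \<tau> permutes {1..?N}}" "k \<in> set [1..<?N+1]"
    then have "k \<in> {1..?N}" by auto
    moreover from this \<tau> have "\<tau> k \<in> {1..?N}" using permutes_mem[of \<tau> 1 ?N k] by simp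
    ultimately show "smat_inv (par ?M) (?M + ?N) (Lmat s (2 * int ?M - 2 * int k)) (?M + k) (?M + \<tau> k) = P k (?M + id k) (?M + \<tau> k)"
      unfolding smat_inv_eq[OF P[of k, folded L_twist_eq]] by (auto simp: twist_sign_def par_def)
  qed
  ultimately show "(q_berezinian s :: ('m, 'n) uq_gl fps) =
           prod_list (map (\<lambda>j. L_quasidet s (2 * int j - 2) j) [1..<?M + 1]) *
           prod_list (map (\<lambda>k. ring_inv (L_quasidet s (2 * int ?M - 2 * int k) (?M + k))) [1..<?N + 1])"
    unfolding q_berezinian_def Let_def
    by (simp only: even_minor[OF assms order_refl] odd_minor[OF assms P order_refl Suc_leI[OF zero_less_Suc, folded One_nat_def]])
next
  fix i j assume "i \<in> {1..LENGTH('m) + LENGTH('n)}" "j \<in> {1..LENGTH('m) + LENGTH('n)}"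
  then show "(ber_factor s i :: ('m, 'n) uq_gl fps) * ber_factor s j = ber_factor s j * ber_factor s i"
    using ber_factor_commute_less[OF assms, of i j s] ber_factor_commute_less[OF assms, of j i s]
    by (cases i j rule: linorder_cases) auto
qed

end
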